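(* Consider the closed-loop agents $$d\hat x_i(t)=-B(R+D^TPD)^{-1}B^TP(\hat x_i(t)-\bar x_0)dt-D(R+D^TPD)^{-1}B^TP(\hat x_i(t)-\bar x_0)dW_i(t),\quad i=1,\dots,N.$$ These agents reach mean-square consensus if and only if $[-B(R+D^TPD)^{-1}B^TP,\,-D(R+D^TPD)^{-1}B^TP]$ is stable. In particular, if $R>0$ and $\rho=0$, the agents achieve mean-square consensus.
   Context: Multiple-integrator model: $x_i\in\mathbb{R}^n$, $u_i\in\mathbb{R}^m$, $dx_i=Bu_idt+Du_idW_i$, $i=1,\dots,N$, with mutually independent one-dimensional standard Brownian motions $W_i$; costs $J_i(u_i,u_{-i})=\mathbb{E}\int_0^\infty e^{-\rho t}\{\|x_i-x^{(N)}\|^2+u_i^TRu_i\}dt$, $x^{(N)}=\frac1N\sum_jx_j$, $\rho\ge0$, $R$ symmetric. The initial states $x_i(0)$ are mutually independent with common mean $\bar x_0$, have second moments bounded uniformly in $i$ and $N$, and are independent of $\{W_i\}$. The displayed closed loop results from $\hat u_i=-(R+D^TPD)^{-1}B^TP(x_i-\bar x_0)$. $P$ is the stabilizing solution of the algebraic Riccati equation $\rho P=I-PB(R+D^TPD)^{-1}B^TP$, i.e. the symmetric solution such that $-B(R+D^TPD)^{-1}B^TP-\frac\rho2I$ is Hurwitz. $[\mathcal{A},\mathcal{C}]$ is stable if the system $dx=\mathcal{A}x\,dt+\mathcal{C}x\,dW$ ($W$ a standard Brownian motion) satisfies $\mathbb{E}\int_0^\infty\|x(t)\|^2dt<\infty$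 (i.e. it is $\rho$-stable with $\rho=0$). Mean-square consensus: there exists a random variable $x^*$ such that $\lim_{t\to\infty}\mathbb{E}\|x_i(t)-x^*\|^2=0$ for all agents $i$. *)

theory Defs
  imports "HOL-Probability.Probability"
begin

section \<open>Probabilistic preliminaries\<close>

text \<open>Time-dependent quantities are functions of type \<open>real \<Rightarrow> 'w \<Rightarrow> _\<close>, used only for times
  \<open>t \<ge> 0\<close>. Second moments are Lebesgue integrals with values in \<open>[0, \<infinity>]\<close>, so that an
  infinite second moment is not silently read as \<open>0\<close>.\<close>

definition second_moment :: "'w measure \<Rightarrow> ('w \<Rightarrow> real ^ 'n) \<Rightarrow> ennreal" where
  "second_moment M X = (\<integral>\<^sup>+ \<omega>. ennreal ((norm (X \<omega>))\<^sup>2) \<partial>M)"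

text \<open>The library's \<open>indep_var\<close> needs both variables to have the same codomain; here a vector is
  compared with a whole path.\<close>

definition independent_rv ::
  "'w measure \<Rightarrow> 'a measure \<Rightarrow> ('w \<Rightarrow> 'a) \<Rightarrow> 'b measure \<Rightarrow> ('w \<Rightarrow> 'b) \<Rightarrow> bool" where
  "independent_rv M S X T Y \<longleftrightarrow>
     X \<in> measurable M S \<and> Y \<in> measurable M T \<and>
     prob_space.indep_set M {X -` A \<inter> space M | A. A \<in> sets S} {Y -` A \<inter> space M | A. A \<in> sets T}"

definition standard_brownian_motion :: "'w measure \<Rightarrow> (real \<Rightarrow> 'w \<Rightarrow> real) \<Rightarrow> bool" where
  "standard_brownian_motion M W \<longleftrightarrow>
     prob_space M \<and>
     (\<forall>t\<ge>0. W t \<in> borel_measurable M) \<and>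
     (AE \<omega> in M. W 0 \<omega> = 0) \<and>
     (AE \<omega> in M. continuous_on {0..} (\<lambda>t. W t \<omega>)) \<and>
     (\<forall>s t. 0 \<le> s \<and> s < t \<longrightarrow>
        distributed M lborel (\<lambda>\<omega>. W t \<omega> - W s \<omega>) (\<lambda>y. ennreal (normal_density 0 (sqrt (t - s)) y)) \<and>
        independent_rv M borel (\<lambda>\<omega>. W t \<omega> - W s \<omega>)
          (PiM {0..s} (\<lambda>_. borel)) (\<lambda>\<omega>. \<lambda>r\<in>{0..s}. W r \<omega>))"

text \<open>The filtration generated by the initial value \<open>\<xi>\<close> and the driving Brownian motion,
  augmented by the null sets.\<close>

definition augmented_filtration ::
  "'w measure \<Rightarrow> (real \<Rightarrow> 'w \<Rightarrow> real) \<Rightarrow> ('w \<Rightarrow> real ^ 'n) \<Rightarrow> real \<Rightarrow> 'w measure" where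
  "augmented_filtration M W \<xi> t =
     sigma (space M)
       ({\<xi> -` A \<inter> space M | A. A \<in> sets borel} \<union>
        {W s -` A \<inter> space M | s A. 0 \<le> s \<and> s \<le> t \<and> A \<in> sets borel} \<union>
        null_sets M)"

section \<open>Ito integrals and stochastic differential equations\<close>

definition L2_adapted ::
  "'w measure \<Rightarrow> (real \<Rightarrow> 'w measure) \<Rightarrow> real \<Rightarrow> (real \<Rightarrow> 'w \<Rightarrow> real ^ 'n) \<Rightarrow> bool" where
  "L2_adapted M F T H \<longleftrightarrow>
     (\<lambda>(s, \<omega>). H s \<omega>) \<in> borel_measurable (restrict_space lborel {0..T} \<Otimes>\<^sub>M M) \<and>
     (\<forall>s\<in>{0..T}. H s \<in> borel_measurable (F s)) \<and>
     (\<integral>\<^sup>+ \<omega>. (\<integral>\<^sup>+ s\<in>{0..T}. ennreal ((norm (H s \<omega>))\<^sup>2) \<partial>lborel) \<partial>M) < \<infinity>"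

text \<open>The elementary process with partition \<open>\<tau> 0 \<le> \<dots> \<le> \<tau> k\<close> and value \<open>e j\<close> on
  \<open>[\<tau> j, \<tau> (j + 1))\<close>, where \<open>e j\<close> must be known at time \<open>\<tau> j\<close>.\<close>

definition elementary_data ::
  "'w measure \<Rightarrow> (real \<Rightarrow> 'w measure) \<Rightarrow> real \<Rightarrow> nat \<Rightarrow> (nat \<Rightarrow> real) \<Rightarrow> (nat \<Rightarrow> 'w \<Rightarrow> real ^ 'n) \<Rightarrow> bool" where
  "elementary_data M F T k \<tau> e \<longleftrightarrow>
     0 \<le> \<tau> 0 \<and> \<tau> k \<le> T \<and> (\<forall>j<k. \<tau> j \<le> \<tau> (Suc j)) \<and>
     (\<forall>j<k. e j \<in> borel_measurable (F (\<tau> j)) \<and> second_moment M (e j) < \<infinity>)"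

definition elementary_process ::
  "nat \<Rightarrow> (nat \<Rightarrow> real) \<Rightarrow> (nat \<Rightarrow> 'w \<Rightarrow> real ^ 'n) \<Rightarrow> real \<Rightarrow> 'w \<Rightarrow> real ^ 'n" where
  "elementary_process k \<tau> e s \<omega> = (\<Sum>j<k. indicator {\<tau> j..<\<tau> (Suc j)} s *\<^sub>R e j \<omega>)"

definition elementary_integral ::
  "(real \<Rightarrow> 'w \<Rightarrow> real) \<Rightarrow> nat \<Rightarrow> (nat \<Rightarrow> real) \<Rightarrow> (nat \<Rightarrow> 'w \<Rightarrow> real ^ 'n) \<Rightarrow> 'w \<Rightarrow> real ^ 'n" where
  "elementary_integral W k \<tau> e \<omega> = (\<Sum>j<k. (W (\<tau> (Suc j)) \<omega> - W (\<tau> j) \<omega>) *\<^sub>R e j \<omega>)"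

text \<open>\<open>I\<close> is (a version of) the Ito integral \<open>\<integral>\<^sub>0\<^sup>T H dW\<close>: the mean-square limit of the integrals of
  elementary processes approximating \<open>H\<close> in \<open>L\<^sup>2([0,T] \<times> \<Omega>)\<close>.\<close>

definition is_ito_integral ::
  "'w measure \<Rightarrow> (real \<Rightarrow> 'w measure) \<Rightarrow> (real \<Rightarrow> 'w \<Rightarrow> real) \<Rightarrow> real \<Rightarrow>
   (real \<Rightarrow> 'w \<Rightarrow> real ^ 'n) \<Rightarrow> ('w \<Rightarrow> real ^ 'n) \<Rightarrow> bool" where
  "is_ito_integral M F W T H I \<longleftrightarrow>
     L2_adapted M F T H \<and> I \<in> borel_measurable M \<and>
     (\<exists>k \<tau> e.
        (\<forall>m. elementary_data M F T (k m) (\<tau> m) (e m)) \<and>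
        (\<lambda>m. \<integral>\<^sup>+ \<omega>. (\<integral>\<^sup>+ s\<in>{0..T}.
            ennreal ((norm (H s \<omega> - elementary_process (k m) (\<tau> m) (e m) s \<omega>))\<^sup>2) \<partial>lborel) \<partial>M)
          \<longlonglongrightarrow> 0 \<and>
        (\<lambda>m. second_moment M (\<lambda>\<omega>. I \<omega> - elementary_integral W (k m) (\<tau> m) (e m) \<omega>))
          \<longlonglongrightarrow> 0)"

text \<open>\<open>x\<close> is a strong solution, in the class of processes that are square integrable on bounded time
  intervals, of \<open>dx = b(x) dt + g(x) dW\<close>, \<open>x(0) = \<xi>\<close>. The equation in integral form reads:
  \<open>x(t) - \<xi> - \<integral>\<^sub>0\<^sup>t b(x(s)) ds\<close> is the Ito integral of \<open>g(x)\<close> over \<open>[0,t]\<close>.\<close>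

definition strong_solution ::
  "'w measure \<Rightarrow> (real \<Rightarrow> 'w \<Rightarrow> real) \<Rightarrow> ('w \<Rightarrow> real ^ 'n) \<Rightarrow>
   (real ^ 'n \<Rightarrow> real ^ 'n) \<Rightarrow> (real ^ 'n \<Rightarrow> real ^ 'n) \<Rightarrow> (real \<Rightarrow> 'w \<Rightarrow> real ^ 'n) \<Rightarrow> bool" where
  "strong_solution M W \<xi> b g x \<longleftrightarrow>
     (AE \<omega> in M. continuous_on {0..} (\<lambda>t. x t \<omega>)) \<and>
     (AE \<omega> in M. x 0 \<omega> = \<xi> \<omega>) \<and>
     (\<forall>t\<ge>0. L2_adapted M (augmented_filtration M W \<xi>) t x \<and>
        is_ito_integral M (augmented_filtration M W \<xi>) W t (\<lambda>s \<omega>. g (x s \<omega>))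
          (\<lambda>\<omega>. x t \<omega> - \<xi> \<omega> - (LINT s:{0..t}|lborel. b (x s \<omega>))))"

text \<open>Stability of \<open>[A, C]\<close>. The sample space type is an explicit argument because probability
  spaces, Brownian motions and initial values are quantified inside the definition.\<close>

definition ms_stable :: "'w itself \<Rightarrow> real ^ 'n ^ 'n \<Rightarrow> real ^ 'n ^ 'n \<Rightarrow> bool" where
  "ms_stable _ A C \<longleftrightarrow>
     (\<forall>(M :: 'w measure) W \<xi> x.
        standard_brownian_motion M W \<and>
        second_moment M \<xi> < \<infinity> \<and>
        independent_rv M borel \<xi> (PiM {0..} (\<lambda>_. borel)) (\<lambda>\<omega>. \<lambda>t\<in>{0..}. W t \<omega>) \<and>
        strong_solution M W \<xi> (\<lambda>y. A *v y) (\<lambda>y. C *v y) x \<longrightarrow>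
        (\<integral>\<^sup>+ \<omega>. (\<integral>\<^sup>+ t\<in>{0..}. ennreal ((norm (x t \<omega>))\<^sup>2) \<partial>lborel) \<partial>M) < \<infinity>)"

section \<open>The algebraic Riccati equation\<close>

definition positive_definite :: "real ^ 'm ^ 'm \<Rightarrow> bool" where
  "positive_definite R \<longleftrightarrow> transpose R = R \<and> (\<forall>v. v \<noteq> 0 \<longrightarrow> v \<bullet> (R *v v) > 0)"

definition hurwitz :: "real ^ 'n ^ 'n \<Rightarrow> bool" where
  "hurwitz A \<longleftrightarrow>
     (\<forall>(z :: complex) v. v \<noteq> 0 \<and> map_matrix complex_of_real A *v v = z *s v \<longrightarrow> Re z < 0)"

text \<open>The gain \<open>(R + D\<^sup>T P D)\<^sup>-\<^sup>1 B\<^sup>T P\<close>.\<close>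

definition fb_gain ::
  "real ^ 'm ^ 'n \<Rightarrow> real ^ 'm ^ 'n \<Rightarrow> real ^ 'm ^ 'm \<Rightarrow> real ^ 'n ^ 'n \<Rightarrow> real ^ 'n ^ 'm" where
  "fb_gain B D R P = matrix_inv (R + transpose D ** P ** D) ** transpose B ** P"

text \<open>Invertibility has to be required explicitly, since \<open>matrix_inv\<close> is a total function.\<close>

definition stabilizing_solution ::
  "real \<Rightarrow> real ^ 'm ^ 'n \<Rightarrow> real ^ 'm ^ 'n \<Rightarrow> real ^ 'm ^ 'm \<Rightarrow> real ^ 'n ^ 'n \<Rightarrow> bool" where
  "stabilizing_solution \<rho> B D R P \<longleftrightarrow>
     transpose P = P \<and>
     invertible (R + transpose D ** P ** D) \<and>
     \<rho> *\<^sub>R P = mat 1 - P ** B ** matrix_inv (R + transpose D ** P ** D) ** transpose B ** P \<and>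
     hurwitz (- (B ** fb_gain B D R P) - (\<rho> / 2) *\<^sub>R mat 1)"

section \<open>The agents\<close>

definition multi_agent_data ::
  "nat \<Rightarrow> real ^ 'n \<Rightarrow> 'w measure \<Rightarrow> (nat \<Rightarrow> real \<Rightarrow> 'w \<Rightarrow> real) \<Rightarrow> (nat \<Rightarrow> 'w \<Rightarrow> real ^ 'n) \<Rightarrow> bool" where
  "multi_agent_data N xbar M W x0 \<longleftrightarrow>
     prob_space M \<and>
     (\<forall>i\<in>{1..N}. standard_brownian_motion M (W i)) \<and>
     prob_space.indep_vars M (\<lambda>_. PiM {0..} (\<lambda>_. borel)) (\<lambda>i \<omega>. \<lambda>t\<in>{0..}. W i t \<omega>) {1..N} \<and>
     prob_space.indep_vars M (\<lambda>_. borel) x0 {1..N} \<and>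
     independent_rv M
       (PiM {1..N} (\<lambda>_. borel)) (\<lambda>\<omega>. \<lambda>i\<in>{1..N}. x0 i \<omega>)
       (PiM ({1..N} \<times> {0..}) (\<lambda>_. borel)) (\<lambda>\<omega>. \<lambda>p\<in>{1..N} \<times> {0..}. W (fst p) (snd p) \<omega>) \<and>
     (\<forall>i\<in>{1..N}. integrable M (x0 i) \<and> (LINT \<omega>|M. x0 i \<omega>) = xbar) \<and>
     (\<exists>c :: real. \<forall>i\<in>{1..N}. second_moment M (x0 i) \<le> ennreal c)"

definition closed_loop_agents ::
  "real ^ 'm ^ 'n \<Rightarrow> real ^ 'm ^ 'n \<Rightarrow> real ^ 'm ^ 'm \<Rightarrow> real ^ 'n ^ 'n \<Rightarrow> nat \<Rightarrow> real ^ 'n \<Rightarrow>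
   'w measure \<Rightarrow> (nat \<Rightarrow> real \<Rightarrow> 'w \<Rightarrow> real) \<Rightarrow> (nat \<Rightarrow> 'w \<Rightarrow> real ^ 'n) \<Rightarrow>
   (nat \<Rightarrow> real \<Rightarrow> 'w \<Rightarrow> real ^ 'n) \<Rightarrow> bool" where
  "closed_loop_agents B D R P N xbar M W x0 x \<longleftrightarrow>
     (\<forall>i\<in>{1..N}. strong_solution M (W i) (x0 i)
        (\<lambda>y. - (B ** fb_gain B D R P) *v (y - xbar))
        (\<lambda>y. - (D ** fb_gain B D R P) *v (y - xbar)) (x i))"

definition mean_square_consensus ::
  "'w measure \<Rightarrow> nat \<Rightarrow> (nat \<Rightarrow> real \<Rightarrow> 'w \<Rightarrow> real ^ 'n) \<Rightarrow> bool" where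
  "mean_square_consensus M N x \<longleftrightarrow>
     (\<exists>xs \<in> borel_measurable M. \<forall>i\<in>{1..N}.
        ((\<lambda>t. second_moment M (\<lambda>\<omega>. x i t \<omega> - xs \<omega>)) \<longlongrightarrow> 0) at_top)"

text \<open>Consensus is a property of the closed-loop system and is required for all admissible initial
  states: for degenerate ones (all equal to \<open>xbar\<close>) it would hold trivially, whatever
  the system matrices are. As in \<open>ms_stable\<close>, the realization (probability space, Brownian
  motions, initial states) ranges over all those with sample space type \<open>'w\<close>.\<close>

definition closed_loop_reaches_consensus ::
  "'w itself \<Rightarrow> real ^ 'm ^ 'n \<Rightarrow> real ^ 'm ^ 'n \<Rightarrow> real ^ 'm ^ 'm \<Rightarrow> real ^ 'n ^ 'n \<Rightarrow>
   nat \<Rightarrow> real ^ 'n \<Rightarrow> bool" where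
  "closed_loop_reaches_consensus _ B D R P N xbar \<longleftrightarrow>
     (\<forall>(M :: 'w measure) W x0 x.
        multi_agent_data N xbar M W x0 \<and> closed_loop_agents B D R P N xbar M W x0 x \<longrightarrow>
        mean_square_consensus M N x)"

end

theory Submission
  imports Defs
begin

text \<open>For a solution of \<open>dx = A x dt + C x dW\<close> the matrix \<open>X(t) = E[x x\<^sup>T]\<close> satisfies the linear
  equation \<open>X' = A X + X A\<^sup>T + C X C\<^sup>T\<close>. A trajectory of a finite-dimensional linear equation tends to
  zero iff it is absolutely integrable, so \<open>E \<parallel>x(t)\<parallel>\<^sup>2 \<longrightarrow> 0\<close> iff \<open>E \<integral> \<parallel>x\<parallel>\<^sup>2 dt < \<infinity>\<close>, for each
  single solution.

  The deviations \<open>x\<^sub>i - xbar\<close> solve this equation, whence stability implies consensus. Conversely, the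
  deviations of two agents are independent and centred, so consensus forces
  \<open>E \<parallel>x\<^sub>i - xbar\<parallel>\<^sup>2 \<longrightarrow> 0\<close>. To conclude for an arbitrary solution \<open>x\<close> on \<open>M\<close> with initial value \<open>\<xi>\<close>, no
  existence theorem for stochastic differential equations is needed: \<open>N\<close> independent copies of \<open>x\<close>,
  restricted to \<open>{h \<bullet> \<xi> > 0}\<close> and multiplied by independent signs to centre them, live on a
  product space that is carried over to the type of \<open>M\<close> by an injection, and form an admissible
  multi-agent system. Finitely many half-spaces \<open>h \<bullet> \<xi> > 0\<close> cover \<open>\<xi> \<noteq> 0\<close>, and \<open>x\<close> vanishes on
  \<open>\<xi> = 0\<close>.

  For \<open>\<rho> = 0\<close> and \<open>R > 0\<close>, the Riccati equation makes \<open>E[x\<^sup>T P x]\<close> decrease at least at the rate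
  \<open>E \<parallel>x\<parallel>\<^sup>2\<close>; it is nonnegative because \<open>P\<close> is minus the inverse of the symmetric Hurwitz matrix
  \<open>A\<close>.\<close>

section \<open>Linear autonomous differential equations\<close>

text \<open>Three constraints shape the necessity argument. Agents must have mean
  \<open>xbar\<close>, and orthogonality of two independent deviations needs centring, whereas
  \<open>ms_stable\<close> admits initial values of any mean: hence the random signs. A strong
  solution must be adapted to the filtration of its own initial value and noise, but an independent
  sign need not be a function of the signed value; on an open half-space it is, which is why initial
  values are restricted to one. Finally, consensus is assumed only for the sample space type of the
  given solution, so the product space must fit into that type; a type carrying a Gaussian variable
  is infinite, and this suffices.

  The moment equation comes from splitting the solution into an absolutely continuous part, with the
  ordinary product rule, and an Ito integral I. For the mixed terms the key is E[I(t) x(s)] =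
  E[I(s) x(s)] for s <= t, which follows from uniqueness for a linear equation.

  Decay and integrability are compared inside the span of one trajectory, since the matrix equation
  may be unstable in directions that this trajectory never meets.\<close>

lemma linear_ode_norm_bounds:
  fixes f :: "real \<Rightarrow> 'a::real_inner"
  assumes c: "\<And>x. norm (L x) \<le> c * norm x" and st: "s \<le> t"
    and f: "\<And>r. r \<in> {s..t} \<Longrightarrow> (f has_vector_derivative L (f r)) (at r within {s..t})"
  shows "norm (f t) \<le> exp (c * (t - s)) * norm (f s)"
    and "norm (f s) \<le> exp (c * (t - s)) * norm (f t)"
proof -
  have cs: "\<bar>inner x (L x)\<bar> \<le> c * (norm x)\<^sup>2" for x
  proof -
    have "\<bar>inner x (L x)\<bar> \<le> norm x * norm (L x)" by (rule Cauchy_Schwarz_ineq2)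
    also have "\<dots> \<le> norm x * (c * norm x)" using c by (intro mult_left_mono) auto
    finally show ?thesis by (simp add: power2_eq_square algebra_simps)
  qed
  \<comment> \<open>The mean value theorem for \<open>exp (2 * k * r)\<close> times the squared norm
    of \<open>f r\<close>; the first disjunct covers \<open>s = t\<close>. By Cauchy-Schwarz the
    derivative is nonpositive for \<open>k = -c\<close> and nonnegative for \<open>k = c\<close>,
    which gives the forward and the backward bound.\<close>
  have mono: "exp (2 * k * t) * (norm (f t))\<^sup>2 - exp (2 * k * s) * (norm (f s))\<^sup>2 = 0 \<or>
     (\<exists>r. exp (2 * k * t) * (norm (f t))\<^sup>2 - exp (2 * k * s) * (norm (f s))\<^sup>2 =
       (t - s) * (exp (2 * k * r) * (2 * (k * (norm (f r))\<^sup>2 + inner (f r) (L (f r))))))" for k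
  proof (cases "s = t")
    case False
    let ?g = "\<lambda>r. exp (2 * k * r) * inner (f r) (f r)"
    have "(?g has_derivative (\<lambda>h. h * (exp (2 * k * r) * (2 * (k * (norm (f r))\<^sup>2 + inner (f r) (L (f r)))))))
       (at r within {s..t})" if "s \<le> r" "r \<le> t" for r
      using f[of r] that unfolding has_vector_derivative_def
      by (auto intro!: derivative_eq_intros ext simp: power2_norm_eq_inner algebra_simps inner_commute)
    from mvt_simple[OF _ this] False st
    obtain r where "?g t - ?g s = (t - s) * (exp (2 * k * r) * (2 * (k * (norm (f r))\<^sup>2 + inner (f r) (L (f r)))))"
      by force
    then show ?thesis by (auto simp: power2_norm_eq_inner)
  qed auto
  have e: "exp (2 * k * x) = (exp (k * x))\<^sup>2" for k x :: real
    by (simp add: power2_eq_square exp_add[symmetric])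
  have "exp (2 * (-c) * t) * (norm (f t))\<^sup>2 \<le> exp (2 * (-c) * s) * (norm (f s))\<^sup>2"
  proof -
    have "(t - s) * (exp (2 * (-c) * r) * (2 * ((-c) * (norm (f r))\<^sup>2 + inner (f r) (L (f r))))) \<le> 0" for r
      using st cs[of "f r"] by (intro mult_nonneg_nonpos) auto
    with mono[of "-c"] show ?thesis by (smt (verit, best))
  qed
  then have "(exp ((-c) * t) * norm (f t))\<^sup>2 \<le> (exp ((-c) * s) * norm (f s))\<^sup>2"
    unfolding e by (simp add: power_mult_distrib)
  then have 1: "exp ((-c) * t) * norm (f t) \<le> exp ((-c) * s) * norm (f s)"
    by (rule power2_le_imp_le) auto
  have "exp (2 * c * s) * (norm (f s))\<^sup>2 \<le> exp (2 * c * t) * (norm (f t))\<^sup>2"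
  proof -
    have "(t - s) * (exp (2 * c * r) * (2 * (c * (norm (f r))\<^sup>2 + inner (f r) (L (f r))))) \<ge> 0" for r
      using st cs[of "f r"] by (intro mult_nonneg_nonneg) auto
    with mono[of c] show ?thesis by (smt (verit, best))
  qed
  then have "(exp (c * s) * norm (f s))\<^sup>2 \<le> (exp (c * t) * norm (f t))\<^sup>2"
    unfolding e by (simp add: power_mult_distrib)
  then have 2: "exp (c * s) * norm (f s) \<le> exp (c * t) * norm (f t)"
    by (rule power2_le_imp_le) auto
  show "norm (f t) \<le> exp (c * (t - s)) * norm (f s)"
    using 1 by (simp add: exp_diff exp_minus field_simps)
  show "norm (f s) \<le> exp (c * (t - s)) * norm (f t)"
    using 2 by (simp add: exp_diff field_simps)
qed

lemma linear_ode_unique: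
  fixes f g :: "real \<Rightarrow> 'a::real_inner"
  assumes L: "bounded_linear L" and st: "s \<le> t"
    and f: "\<And>r. r \<in> {s..t} \<Longrightarrow> (f has_vector_derivative L (f r)) (at r within {s..t})"
    and g: "\<And>r. r \<in> {s..t} \<Longrightarrow> (g has_vector_derivative L (g r)) (at r within {s..t})"
    and init: "f s = g s"
  shows "f t = g t"
proof -
  obtain c where c: "\<And>x. norm (L x) \<le> norm x * c" using bounded_linear.bounded[OF L] by blast
  have "norm (f t - g t) \<le> exp (c * (t - s)) * norm (f s - g s)"
  proof (rule linear_ode_norm_bounds(1)[of L _ s t "\<lambda>r. f r - g r"])
    show "norm (L x) \<le> c * norm x" for x using c[of x] by (simp add: mult.commute)
    show "((\<lambda>r. f r - g r) has_vector_derivative L (f r - g r)) (at r within {s..t})" if "r \<in> {s..t}" for r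
      using has_vector_derivative_diff[OF f[OF that] g[OF that]]
      by (simp add: linear_diff[OF bounded_linear.linear[OF L]])
  qed (use st in auto)
  then show ?thesis using init by simp
qed

text \<open>On the span of the trajectory the flow contracts: by finite dimension, decay along
  finitely many starting points makes some fixed time step \<open>T0\<close> halve the norm of every
  \<open>f s\<close>. The integral over \<open>{0..T}\<close> is then at most the integral over
  \<open>{0..T0}\<close> plus half of itself.\<close>

lemma linear_ode_tendsto_zero_imp_integral_bounded:
  fixes f :: "real \<Rightarrow> 'a::euclidean_space"
  assumes L: "bounded_linear L"
    and f: "\<And>t. t \<ge> 0 \<Longrightarrow> (f has_vector_derivative L (f t)) (at t within {0..})"
    and lim: "(f \<longlongrightarrow> 0) at_top"
  shows "\<exists>K. \<forall>T\<ge>0. integral {0..T} (\<lambda>t. norm (f t)) \<le> K"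
proof -
  have cont: "continuous_on {0..} f"
    unfolding continuous_on_eq_continuous_within
    using f has_vector_derivative_continuous by fastforce
  \<comment> \<open>A basis of the span drawn from the trajectory itself, so that each basis vector
    is a value \<open>f (\<tau> b)\<close> whose later evolution is again given by
    \<open>f\<close>.\<close>
  obtain B where B: "B \<subseteq> f ` {0..}" "independent B" "f ` {0..} \<subseteq> span B"
    by (rule maximal_independent_subset)
  then have "\<forall>b\<in>B. \<exists>t\<ge>0. b = f t" by auto
  then obtain \<tau> where \<tau>: "\<And>b. b \<in> B \<Longrightarrow> \<tau> b \<ge> 0 \<and> b = f (\<tau> b)" by metis
  have fin: "finite B" using B(2) by (rule independent_imp_finite)
  \<comment> \<open>Coordinate functionals of the basis, extended to the whole space, where linear
    maps are bounded.\<close>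
  have "\<exists>g::'a\<Rightarrow>real. linear g \<and> (\<forall>x\<in>B. g x = (if x = b then 1 else 0))" for b
    using linear_independent_extend[OF B(2), of "\<lambda>x. if x = b then 1 else 0 :: real"] by auto
  then obtain c :: "'a \<Rightarrow> 'a \<Rightarrow> real" where
    c: "\<And>b. linear (c b)" "\<And>b x. x \<in> B \<Longrightarrow> c b x = (if x = b then 1 else 0)" by metis
  have "\<exists>K\<ge>0. \<forall>x. \<bar>c b x\<bar> \<le> K * norm x" for b
    using linear_bounded_pos[OF c(1)[of b]] by (metis less_imp_le real_norm_def)
  then obtain K where K: "\<And>b. K b \<ge> 0" "\<And>b x. \<bar>c b x\<bar> \<le> K b * norm x" by metis
  have lincomb: "linear (\<lambda>v. \<Sum>b\<in>B. c b v *\<^sub>R b)"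
    by (intro linear_compose_sum ballI) (auto intro: linearI simp: linear_add[OF c(1)] linear_scale[OF c(1)] scaleR_add_left)
  have rep: "v = (\<Sum>b\<in>B. c b v *\<^sub>R b)" if "v \<in> span B" for v
  proof (rule linear_eq_on_span[OF linear_ident lincomb _ that])
    fix x assume "x \<in> B"
    have "(\<Sum>b\<in>B. c b x *\<^sub>R b) = (\<Sum>b\<in>B. if x = b then x else 0)"
      using \<open>x \<in> B\<close> by (intro sum.cong) (auto simp: c(2))
    then show "x = (\<Sum>b\<in>B. c b x *\<^sub>R b)" using fin \<open>x \<in> B\<close> by simp
  qed
  have shift: "((\<lambda>r. f (a + r)) has_vector_derivative L (f (a + r))) (at r within {0..T})"
    if "r \<in> {0..T}" "a \<ge> 0" for r a T
  proof -
    have "((\<lambda>r. f (a + r)) has_vector_derivative 1 *\<^sub>R L (f (a + r))) (at r within {0..T})"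
      using that
      by (intro vector_diff_chain_within[of "\<lambda>r. a + r" 1 r "{0..T}" f, unfolded o_def]
           has_vector_derivative_within_subset[OF f])
         (auto intro!: derivative_eq_intros)
    then show ?thesis by simp
  qed
  \<comment> \<open>Both sides solve the same equation in \<open>T\<close> and agree at
    \<open>T = 0\<close>; thus the coordinates of \<open>f s\<close> govern the whole future after
    \<open>s\<close>.\<close>
  have flow: "f (s + T) = (\<Sum>b\<in>B. c b (f s) *\<^sub>R f (\<tau> b + T))" if "s \<ge> 0" "T \<ge> 0" for s T
  proof (rule linear_ode_unique[OF L that(2)])
    show "((\<lambda>r. f (s + r)) has_vector_derivative L (f (s + r))) (at r within {0..T})" if "r \<in> {0..T}" for r
      using shift that \<open>s \<ge> 0\<close> by blast
    show "((\<lambda>T. \<Sum>b\<in>B. c b (f s) *\<^sub>R f (\<tau> b + T)) has_vector_derivative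
         L (\<Sum>b\<in>B. c b (f s) *\<^sub>R f (\<tau> b + r))) (at r within {0..T})" if "r \<in> {0..T}" for r
    proof -
      have "L (\<Sum>b\<in>B. c b (f s) *\<^sub>R f (\<tau> b + r)) = (\<Sum>b\<in>B. c b (f s) *\<^sub>R L (f (\<tau> b + r)))"
        using bounded_linear.linear[OF L] by (simp add: linear_sum linear_scale)
      then show ?thesis
        using that shift[of r T] \<tau>
        by (auto intro!: has_vector_derivative_sum bounded_linear.has_vector_derivative[OF bounded_linear_scaleR_right])
    qed
    show "f (s + 0) = (\<Sum>b\<in>B. c b (f s) *\<^sub>R f (\<tau> b + 0))"
      using rep[of "f s"] B(3) \<tau> that(1) by (auto simp: subset_iff intro!: sum.cong)
  qed
  have "((\<lambda>T. \<Sum>b\<in>B. K b * norm (f (\<tau> b + T))) \<longlongrightarrow> (\<Sum>b\<in>B. K b * norm (0::'a))) at_top"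
    by (intro tendsto_intros filterlim_compose[OF lim] filterlim_tendsto_add_at_top[OF tendsto_const] filterlim_ident)
  then have "\<forall>\<^sub>F T in at_top. (\<Sum>b\<in>B. K b * norm (f (\<tau> b + T))) < 1/2"
    by (intro order_tendstoD) auto
  then obtain T1 where "\<forall>T\<ge>T1. (\<Sum>b\<in>B. K b * norm (f (\<tau> b + T))) < 1/2"
    unfolding eventually_at_top_linorder ..
  \<comment> \<open>The weighted sum bounds the growth factor from \<open>f s\<close> to
    \<open>f (s + T0)\<close> uniformly in \<open>s\<close>, because the weights \<open>K b\<close>
    bound the coordinate functionals.\<close>
  then obtain T0 where T0: "T0 \<ge> 0" "(\<Sum>b\<in>B. K b * norm (f (\<tau> b + T0))) < 1/2"
    using that[of "max 0 T1"] by simp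
  have half: "norm (f (s + T0)) \<le> 1/2 * norm (f s)" if "s \<ge> 0" for s
  proof -
    have "norm (f (s + T0)) \<le> (\<Sum>b\<in>B. (K b * norm (f s)) * norm (f (\<tau> b + T0)))"
      unfolding flow[OF that T0(1)]
      by (intro sum_norm_le) (auto intro!: mult_right_mono K)
    also have "\<dots> = (\<Sum>b\<in>B. K b * norm (f (\<tau> b + T0))) * norm (f s)"
      by (simp add: sum_distrib_left sum_distrib_right algebra_simps)
    also have "\<dots> \<le> 1/2 * norm (f s)" using T0(2) by (intro mult_right_mono) auto
    finally show ?thesis .
  qed
  have ci: "continuous_on {a..b} (\<lambda>t. norm (f t))" if "a \<ge> 0" for a b
    using that by (intro continuous_intros continuous_on_subset[OF cont]) auto
  \<comment> \<open>The factor 2 arises from absorbing half of the integral over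
    \<open>{0..T}\<close> into the left-hand side.\<close>
  have "integral {0..T} (\<lambda>t. norm (f t)) \<le> 2 * integral {0..T0} (\<lambda>t. norm (f t))" if "T \<ge> 0" for T
  proof -
    have "integral {0..T} (\<lambda>t. norm (f t)) \<le> integral {0..T+T0} (\<lambda>t. norm (f t))"
      using T0 by (intro integral_subset_le integrable_continuous_interval ci) auto
    also have "\<dots> = integral {0..T0} (\<lambda>t. norm (f t)) + integral {T0..T+T0} (\<lambda>t. norm (f t))"
      using T0 that by (intro Henstock_Kurzweil_Integration.integral_combine[symmetric] integrable_continuous_interval ci) auto
    also have "integral {T0..T+T0} (\<lambda>t. norm (f t)) = integral {0..T} (\<lambda>t. norm (f (t + T0)))"
      using integral_shift_Icc_real[of 0 T "\<lambda>t. norm (f t)" T0]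
      by (simp add: o_def add.commute)
    also have "\<dots> \<le> integral {0..T} (\<lambda>t. 1/2 * norm (f t))"
    proof (rule integral_le)
      have "continuous_on {0..T} (\<lambda>t. norm (f (t + T0)))"
        using T0 by (intro continuous_intros continuous_on_compose2[OF cont]) auto
      then show "(\<lambda>t. norm (f (t + T0))) integrable_on {0..T}" by (rule integrable_continuous_interval)
      show "(\<lambda>t. 1/2 * norm (f t)) integrable_on {0..T}"
        by (intro integrable_continuous_interval continuous_intros ci[unfolded o_def]
            continuous_on_subset[OF cont]) auto
      show "norm (f (t + T0)) \<le> 1/2 * norm (f t)" if "t \<in> {0..T}" for t
        using half that by auto
    qed
    also have "\<dots> = 1/2 * integral {0..T} (\<lambda>t. norm (f t))" by simp
    finally show ?thesis by simp
  qed
  then show ?thesis by blast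
qed

text \<open>Integrability alone would not force pointwise decay. Here the backward bound keeps
  \<open>f\<close> from dropping quickly after a large value: \<open>norm (f t)\<close> is at most
  \<open>exp c\<close> times the norm at any time of the following unit interval, hence at most
  \<open>exp c\<close> times the integral over that interval. Such increments of the bounded
  monotone \<open>F\<close> vanish in the limit.\<close>

lemma linear_ode_integral_bounded_imp_tendsto_zero:
  fixes f :: "real \<Rightarrow> 'a::euclidean_space"
  assumes L: "bounded_linear L"
    and f: "\<And>t. t \<ge> 0 \<Longrightarrow> (f has_vector_derivative L (f t)) (at t within {0..})"
    and K: "\<And>T. T \<ge> 0 \<Longrightarrow> integral {0..T} (\<lambda>t. norm (f t)) \<le> K"
  shows "(f \<longlongrightarrow> 0) at_top"
proof -
  have cont: "continuous_on {0..} f"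
    unfolding continuous_on_eq_continuous_within
    using f has_vector_derivative_continuous by fastforce
  have ci: "(\<lambda>t. norm (f t)) integrable_on {a..b}" if "a \<ge> 0" for a b
    using that by (intro integrable_continuous_interval continuous_intros continuous_on_subset[OF cont]) auto
  define F where "F T = integral {0..T} (\<lambda>t. norm (f t))" for T
  obtain c where c: "c \<ge> 0" "\<And>x. norm (L x) \<le> norm x * c" using bounded_linear.nonneg_bounded[OF L] by blast
  have c': "norm (L x) \<le> c * norm x" for x using c(2)[of x] by (simp add: mult.commute)
  have mono: "F s \<le> F t" if "0 \<le> s" "s \<le> t" for s t
    unfolding F_def using that by (intro integral_subset_le ci) auto
  have bnd: "norm (f t) \<le> exp c * (F (t + 1) - F t)" if "t \<ge> 0" for t
  proof -
    have "norm (f t) \<le> exp c * norm (f s)" if "s \<in> {t..t+1}" for s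
    proof -
      have "norm (f t) \<le> exp (c * (s - t)) * norm (f s)"
        using \<open>t \<ge> 0\<close> that
        by (intro linear_ode_norm_bounds(2)[OF c'] has_vector_derivative_within_subset[OF f]) auto
      also have "\<dots> \<le> exp (c * 1) * norm (f s)"
        using that c mult_left_mono[of "s - t" 1 c] by (intro mult_right_mono) auto
      finally show ?thesis by simp
    qed
    then have "integral {t..t+1} (\<lambda>s. norm (f t)) \<le> integral {t..t+1} (\<lambda>s. exp c * norm (f s))"
      using ci[OF that] by (intro integral_le integrable_on_cmult_left) (auto simp: integrable_on_cmult_left)
    also have "\<dots> = exp c * integral {t..t+1} (\<lambda>s. norm (f s))" by simp
    also have "integral {t..t+1} (\<lambda>s. norm (f s)) = F (t + 1) - F t"
      using Henstock_Kurzweil_Integration.integral_combine[of 0 t "t+1" "\<lambda>s. norm (f s)"] that ci[of 0]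
      by (simp add: F_def)
    finally show ?thesis by simp
  qed
  have "\<exists>l. (F \<longlongrightarrow> l) at_top"
  proof -
    let ?l = "SUP t\<in>{0..}. F t"
    have bdd: "bdd_above (F ` {0..})" using K by (intro bdd_aboveI2[of _ _ K]) (auto simp: F_def)
    have "(F \<longlongrightarrow> ?l) at_top"
    proof (rule order_tendstoI)
      fix a assume "a < ?l"
      then obtain s where s: "s \<ge> 0" "a < F s" using bdd by (subst (asm) less_cSUP_iff) auto
      then have "\<forall>t\<ge>s. a < F t" using mono by fastforce
      then show "\<forall>\<^sub>F t in at_top. a < F t" by (auto simp: eventually_at_top_linorder)
    next
      fix a assume "?l < a"
      then have "\<forall>t\<ge>0. F t < a" using cSUP_upper[OF _ bdd] by (smt (verit) atLeast_iff)
      then show "\<forall>\<^sub>F t in at_top. F t < a" by (auto simp: eventually_at_top_linorder)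
    qed
    then show ?thesis by blast
  qed
  then obtain l where l: "(F \<longlongrightarrow> l) at_top" by blast
  have "filterlim (\<lambda>t::real. t + 1) at_top at_top"
    using filterlim_tendsto_add_at_top[OF tendsto_const filterlim_ident, of "1::real"] by (simp add: add.commute)
  then have "((\<lambda>t. exp c * (F (t + 1) - F t)) \<longlongrightarrow> exp c * (l - l)) at_top"
    by (intro tendsto_intros l filterlim_compose[OF l])
  then have lim0: "((\<lambda>t. exp c * (F (t + 1) - F t)) \<longlongrightarrow> 0) at_top" by simp
  have "\<forall>\<^sub>F t in at_top. norm (f t) \<le> exp c * (F (t + 1) - F t)"
    using bnd by (auto simp: eventually_at_top_linorder)
  from Lim_null_comparison[OF this lim0] show ?thesis .
qed

section \<open>Brownian filtrations\<close>

definition square_integrable :: "'a measure \<Rightarrow> ('a \<Rightarrow> real) \<Rightarrow> bool" where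
  "square_integrable M f \<longleftrightarrow> f \<in> borel_measurable M \<and> integrable M (\<lambda>x. (f x)\<^sup>2)"

lemma square_integrable_measurable [measurable_dest]:
  "square_integrable M f \<Longrightarrow> f \<in> borel_measurable M"
  by (simp add: square_integrable_def)

lemma square_integrable_mult:
  assumes "square_integrable M f" "square_integrable M g"
  shows "integrable M (\<lambda>x. f x * g x)"
proof (rule Bochner_Integration.integrable_bound)
  show "integrable M (\<lambda>x. (f x)\<^sup>2 + (g x)\<^sup>2)"
    using assms by (auto simp: square_integrable_def)
  show "(\<lambda>x. f x * g x) \<in> borel_measurable M"
    using assms by (auto simp: square_integrable_def)
  have "\<bar>a * b\<bar> \<le> a\<^sup>2 + b\<^sup>2" for a b :: real
    using sum_squares_bound[of "\<bar>a\<bar>" "\<bar>b\<bar>"] mult_nonneg_nonneg[OF abs_ge_zero[of a] abs_ge_zero[of b]]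
    unfolding abs_mult power2_abs by linarith
  then show "AE x in M. norm (f x * g x) \<le> norm ((f x)\<^sup>2 + (g x)\<^sup>2)" by simp
qed

lemma square_integrable_add:
  assumes "square_integrable M f" "square_integrable M g"
  shows "square_integrable M (\<lambda>x. f x + g x)"
proof -
  have "integrable M (\<lambda>x. (f x)\<^sup>2 + 2 * (f x * g x) + (g x)\<^sup>2)"
    using assms square_integrable_mult[OF assms] by (auto simp: square_integrable_def)
  moreover have "(\<lambda>x. (f x)\<^sup>2 + 2 * (f x * g x) + (g x)\<^sup>2) = (\<lambda>x. (f x + g x)\<^sup>2)"
    by (auto simp: power2_sum)
  ultimately show ?thesis using assms by (auto simp: square_integrable_def)
qed

lemma square_integrable_cmult:
  "square_integrable M f \<Longrightarrow> square_integrable M (\<lambda>x. c * f x)"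
  by (auto simp: square_integrable_def power_mult_distrib)

lemma square_integrable_diff:
  assumes "square_integrable M f" "square_integrable M g"
  shows "square_integrable M (\<lambda>x. f x - g x)"
  using square_integrable_add[OF assms(1) square_integrable_cmult[OF assms(2), of "-1"]] by simp

lemma square_integrable_zero: "square_integrable M (\<lambda>x. 0)"
  by (simp add: square_integrable_def)

lemma square_integrable_sum:
  "(\<And>i. i \<in> I \<Longrightarrow> square_integrable M (f i)) \<Longrightarrow> square_integrable M (\<lambda>x. \<Sum>i\<in>I. f i x)"
proof (induction I rule: infinite_finite_induct)
  case (insert i I)
  then show ?case using square_integrable_add[of M "f i" "\<lambda>x. \<Sum>i\<in>I. f i x"] by simp
qed (auto simp: square_integrable_zero)

lemma square_integrableI_nn_integral:
  assumes "f \<in> borel_measurable M" "(\<integral>\<^sup>+x. ennreal ((f x)\<^sup>2) \<partial>M) < \<infinity>"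
  shows "square_integrable M f"
  using assms by (auto simp: square_integrable_def intro!: integrableI_nonneg)

lemma square_integrable_dominated:
  assumes "f \<in> borel_measurable M" "square_integrable M g" "\<And>x. x \<in> space M \<Longrightarrow> \<bar>f x\<bar> \<le> \<bar>g x\<bar>"
  shows "square_integrable M f"
proof -
  have "integrable M (\<lambda>x. (f x)\<^sup>2)"
    by (rule Bochner_Integration.integrable_bound[of M "\<lambda>x. (g x)\<^sup>2"])
       (use assms in \<open>auto simp: square_integrable_def abs_le_square_iff intro!: AE_I2\<close>)
  then show ?thesis using assms by (auto simp: square_integrable_def)
qed

lemma integral_Cauchy_Schwarz:
  assumes f: "square_integrable M f" and g: "square_integrable M g"
  shows "\<bar>\<integral>x. f x * g x \<partial>M\<bar> \<le> sqrt (\<integral>x. (f x)\<^sup>2 \<partial>M) * sqrt (\<integral>x. (g x)\<^sup>2 \<partial>M)"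
proof -
  let ?a = "\<integral>x. (f x)\<^sup>2 \<partial>M" and ?b = "\<integral>x. f x * g x \<partial>M" and ?c = "\<integral>x. (g x)\<^sup>2 \<partial>M"
  have q: "?a + 2 * t * ?b + t\<^sup>2 * ?c \<ge> 0" for t
  proof -
    have "0 \<le> (\<integral>x. (f x + t * g x)\<^sup>2 \<partial>M)" by simp
    also have "(\<lambda>x. (f x + t * g x)\<^sup>2) = (\<lambda>x. (f x)\<^sup>2 + (2 * t) * (f x * g x) + t\<^sup>2 * (g x)\<^sup>2)"
      by (auto simp: power2_sum power_mult_distrib algebra_simps)
    also have "(\<integral>x. \<dots> x \<partial>M) = ?a + 2 * t * ?b + t\<^sup>2 * ?c"
      using f g square_integrable_mult[OF f g] by (simp add: square_integrable_def)
    finally show ?thesis .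
  qed
  have nonneg: "?a \<ge> 0" "?c \<ge> 0" by simp_all
  have "?b\<^sup>2 \<le> ?a * ?c"
  proof (cases "?c = 0")
    case True
    have "?b = 0"
    proof (rule ccontr)
      assume "?b \<noteq> 0"
      \<comment> \<open>With \<open>?c = 0\<close> the quadratic is affine in \<open>t\<close>, and
        this choice of \<open>t\<close> gives it the value -1.\<close>
      then show False using q[of "- (?a + 1) / (2 * ?b)"] True by (simp add: field_simps)
    qed
    then show ?thesis using nonneg by simp
  next
    case False
    then have "?c > 0" using nonneg by linarith
    then show ?thesis using q[of "- ?b / ?c"]
      by (simp add: field_simps power2_eq_square)
  qed
  then have "sqrt (?b\<^sup>2) \<le> sqrt (?a * ?c)" by (rule real_sqrt_le_mono)
  then show ?thesis by (simp add: real_sqrt_mult)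
qed

lemma square_integrable_limit_nn:
  assumes "square_integrable M f" "\<And>m. square_integrable M (fs m)"
    and "(\<lambda>m. \<integral>\<^sup>+x. ennreal ((f x - fs m x)\<^sup>2) \<partial>M) \<longlonglongrightarrow> 0"
  shows "(\<lambda>m. \<integral>x. (f x - fs m x)\<^sup>2 \<partial>M) \<longlonglongrightarrow> 0"
proof -
  have "(\<integral>\<^sup>+x. ennreal ((f x - fs m x)\<^sup>2) \<partial>M) = ennreal (\<integral>x. (f x - fs m x)\<^sup>2 \<partial>M)" for m
    using square_integrable_diff[OF assms(1) assms(2)[of m]]
    by (intro nn_integral_eq_integral) (auto simp: square_integrable_def)
  with assms(3) have "(\<lambda>m. ennreal (\<integral>x. (f x - fs m x)\<^sup>2 \<partial>M)) \<longlonglongrightarrow> ennreal 0" by simp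
  then show ?thesis by (subst (asm) tendsto_ennreal_iff) auto
qed

text \<open>The error splits into three products, each controlled by Cauchy-Schwarz. The convergence
  hypotheses are phrased with extended integrals, the form in which \<open>is_ito_integral\<close>
  supplies its approximations.\<close>

lemma square_integrable_inner_tendsto:
  assumes f: "square_integrable M f" "\<And>m. square_integrable M (fs m)"
    "(\<lambda>m. \<integral>\<^sup>+x. ennreal ((f x - fs m x)\<^sup>2) \<partial>M) \<longlonglongrightarrow> 0"
    and g: "square_integrable M g" "\<And>m. square_integrable M (gs m)"
    "(\<lambda>m. \<integral>\<^sup>+x. ennreal ((g x - gs m x)\<^sup>2) \<partial>M) \<longlonglongrightarrow> 0"
  shows "(\<lambda>m. \<integral>x. fs m x * gs m x \<partial>M) \<longlonglongrightarrow> (\<integral>x. f x * g x \<partial>M)"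
proof -
  let ?n = "\<lambda>h. sqrt (\<integral>x. (h x)\<^sup>2 \<partial>M)"
  let ?e = "\<lambda>m. ?n (\<lambda>x. f x - fs m x) * ?n g + ?n f * ?n (\<lambda>x. g x - gs m x) +
      ?n (\<lambda>x. f x - fs m x) * ?n (\<lambda>x. g x - gs m x)"
  have lims: "(\<lambda>m. ?n (\<lambda>x. f x - fs m x)) \<longlonglongrightarrow> sqrt 0" "(\<lambda>m. ?n (\<lambda>x. g x - gs m x)) \<longlonglongrightarrow> sqrt 0"
    by (intro tendsto_real_sqrt square_integrable_limit_nn f g)+
  have "?e \<longlonglongrightarrow> sqrt 0 * ?n g + ?n f * sqrt 0 + sqrt 0 * sqrt 0"
    by (intro tendsto_add tendsto_mult tendsto_const lims)
  then have e0: "?e \<longlonglongrightarrow> 0" by simp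
  have bd: "norm ((\<integral>x. fs m x * gs m x \<partial>M) - (\<integral>x. f x * g x \<partial>M)) \<le> ?e m" for m
  proof -
    note df = square_integrable_diff[OF f(1) f(2)[of m]] and dg = square_integrable_diff[OF g(1) g(2)[of m]]
    have "(\<integral>x. fs m x * gs m x \<partial>M) =
      (\<integral>x. f x * g x - (f x - fs m x) * g x - f x * (g x - gs m x) + (f x - fs m x) * (g x - gs m x) \<partial>M)"
      by (intro Bochner_Integration.integral_cong) (auto simp: algebra_simps)
    also have "\<dots> = (\<integral>x. f x * g x \<partial>M) - (\<integral>x. (f x - fs m x) * g x \<partial>M)
       - (\<integral>x. f x * (g x - gs m x) \<partial>M) + (\<integral>x. (f x - fs m x) * (g x - gs m x) \<partial>M)"
      using square_integrable_mult[OF f(1) g(1)] square_integrable_mult[OF df g(1)]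
        square_integrable_mult[OF f(1) dg] square_integrable_mult[OF df dg]
      by simp
    finally show ?thesis
      using integral_Cauchy_Schwarz[OF df g(1)] integral_Cauchy_Schwarz[OF f(1) dg]
        integral_Cauchy_Schwarz[OF df dg] by (simp add: abs_le_iff)
  qed
  show ?thesis
    by (rule LIM_zero_cancel, rule Lim_null_comparison[OF always_eventually[OF allI[OF bd]] e0])
qed

lemma ennreal_tendsto_zero_mono:
  fixes f g :: "'a \<Rightarrow> ennreal"
  assumes "(g \<longlongrightarrow> 0) F" "\<And>m. f m \<le> g m"
  shows "(f \<longlongrightarrow> 0) F"
  by (rule tendsto_sandwich[OF _ _ tendsto_const assms(1)]) (simp_all add: assms(2))

lemma Int_stable_preimages: "Int_stable {f -` A \<inter> X | A. A \<in> sets N}"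
proof (rule Int_stableI)
  fix a b assume "a \<in> {f -` A \<inter> X | A. A \<in> sets N}" "b \<in> {f -` A \<inter> X | A. A \<in> sets N}"
  then obtain A B where "A \<in> sets N" "B \<in> sets N" "a = f -` A \<inter> X" "b = f -` B \<inter> X" by auto
  then show "a \<inter> b \<in> {f -` A \<inter> X | A. A \<in> sets N}"
    by (intro CollectI exI[of _ "A \<inter> B"]) auto
qed

text \<open>The properties of the filtration on which the mean-square theory of the integral rests.
  The filtration stays abstract so that a process whose initial value is not the generating one can
  be treated over it, as in \<open>second_moment_zero_initial\<close>.\<close>

locale brownian_filtration = prob_space M for M :: "'w measure" +
  fixes F :: "real \<Rightarrow> 'w measure" and W :: "real \<Rightarrow> 'w \<Rightarrow> real"
  assumes space_F: "0 \<le> t \<Longrightarrow> space (F t) = space M"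
    and sets_F: "0 \<le> t \<Longrightarrow> sets (F t) \<subseteq> sets M"
    and F_mono: "0 \<le> s \<Longrightarrow> s \<le> t \<Longrightarrow> sets (F s) \<subseteq> sets (F t)"
    and W_adapted: "0 \<le> t \<Longrightarrow> W t \<in> borel_measurable (F t)"
    and increment_distributed: "0 \<le> s \<Longrightarrow> s < t \<Longrightarrow>
      distributed M lborel (\<lambda>\<omega>. W t \<omega> - W s \<omega>) (\<lambda>y. ennreal (normal_density 0 (sqrt (t - s)) y))"
    and increment_indep: "0 \<le> s \<Longrightarrow> s < t \<Longrightarrow> A \<in> sets (F s) \<Longrightarrow> B \<in> sets borel \<Longrightarrow>
      prob (A \<inter> ((\<lambda>\<omega>. W t \<omega> - W s \<omega>) -` B \<inter> space M)) =
      prob A * prob ((\<lambda>\<omega>. W t \<omega> - W s \<omega>) -` B \<inter> space M)"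
begin

lemma measurable_F_mono:
  assumes "0 \<le> s" "s \<le> t" "f \<in> measurable (F s) N"
  shows "f \<in> measurable (F t) N"
  using assms F_mono[of s t] space_F[of s] space_F[of t] by (auto simp: measurable_def)

lemma measurable_F_M:
  assumes "0 \<le> s" "f \<in> measurable (F s) N"
  shows "f \<in> measurable M N"
  using assms sets_F[of s] space_F[of s] by (auto simp: measurable_def)

lemma increment_moments:
  assumes "0 \<le> s" "s \<le> t"
  shows "integrable M (\<lambda>\<omega>. W t \<omega> - W s \<omega>)" "expectation (\<lambda>\<omega>. W t \<omega> - W s \<omega>) = 0"
    "integrable M (\<lambda>\<omega>. (W t \<omega> - W s \<omega>)\<^sup>2)" "expectation (\<lambda>\<omega>. (W t \<omega> - W s \<omega>)\<^sup>2) = t - s"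
proof -
  have "integrable M (\<lambda>\<omega>. W t \<omega> - W s \<omega>) \<and> expectation (\<lambda>\<omega>. W t \<omega> - W s \<omega>) = 0 \<and>
    integrable M (\<lambda>\<omega>. (W t \<omega> - W s \<omega>)\<^sup>2) \<and> expectation (\<lambda>\<omega>. (W t \<omega> - W s \<omega>)\<^sup>2) = t - s"
  proof (cases "s = t")
    case False
    then have st: "s < t" using assms by simp
    note D = increment_distributed[OF assms(1) st]
    have \<sigma>: "sqrt (t - s) > 0" using st by simp
    have E: "expectation (\<lambda>\<omega>. W t \<omega> - W s \<omega>) = 0"
      using normal_distributed_expectation[OF \<sigma> D] .
    have V: "expectation (\<lambda>\<omega>. (W t \<omega> - W s \<omega>)\<^sup>2) = t - s"
      using normal_distributed_variance[OF \<sigma> D] E st by simp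
    have "integrable M (\<lambda>\<omega>. W t \<omega> - W s \<omega>)"
      using distributed_integrable[OF D, of "\<lambda>y. y"] integrable_normal_moment_nz_1[OF \<sigma>, of 0] by simp
    moreover have "integrable M (\<lambda>\<omega>. (W t \<omega> - W s \<omega>)\<^sup>2)"
      using distributed_integrable[OF D, of "\<lambda>y. y\<^sup>2"] integrable_normal_moment[OF \<sigma>, of 0 2] by simp
    ultimately show ?thesis using E V by simp
  qed simp
  then show "integrable M (\<lambda>\<omega>. W t \<omega> - W s \<omega>)" "expectation (\<lambda>\<omega>. W t \<omega> - W s \<omega>) = 0"
    "integrable M (\<lambda>\<omega>. (W t \<omega> - W s \<omega>)\<^sup>2)" "expectation (\<lambda>\<omega>. (W t \<omega> - W s \<omega>)\<^sup>2) = t - s"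
    by blast+
qed

lemma increment_indep_var:
  assumes st: "0 \<le> s" "s < t" and f: "f \<in> borel_measurable (F s)"
  shows "indep_var borel f borel (\<lambda>\<omega>. W t \<omega> - W s \<omega>)"
proof -
  let ?D = "\<lambda>\<omega>. W t \<omega> - W s \<omega>"
  have m: "f \<in> borel_measurable M" "?D \<in> borel_measurable M"
    using measurable_F_M[OF st(1) f] st measurable_F_M[OF _ W_adapted[of s]] measurable_F_M[OF _ W_adapted[of t]]
    by auto
  have "indep_set {f -` A \<inter> space M | A. A \<in> sets borel} {?D -` A \<inter> space M | A. A \<in> sets borel}"
    using measurable_sets[OF f] space_F[OF st(1)] m
    by (intro indep_setI) (auto intro!: increment_indep[OF st] measurable_sets)
  then have "indep_set (sigma_sets (space M) {f -` A \<inter> space M | A. A \<in> sets borel})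
      (sigma_sets (space M) {?D -` A \<inter> space M | A. A \<in> sets borel})"
    by (rule indep_set_sigma_sets) (rule Int_stable_preimages)+
  then show ?thesis using m by (simp add: indep_var_eq)
qed

text \<open>A function known at time \<open>s\<close> is independent of the increment and of its
  square, so the expectations factorise. The law of the increment is given only for
  \<open>s < t\<close>; for \<open>s = t\<close> the increment is zero.\<close>

lemma
  assumes st: "0 \<le> s" "s \<le> t" and f: "f \<in> borel_measurable (F s)" "integrable M f"
  shows integrable_mult_increment: "integrable M (\<lambda>\<omega>. f \<omega> * (W t \<omega> - W s \<omega>))"
    and expectation_mult_increment: "expectation (\<lambda>\<omega>. f \<omega> * (W t \<omega> - W s \<omega>)) = 0"
    and integrable_mult_increment_sq: "integrable M (\<lambda>\<omega>. f \<omega> * (W t \<omega> - W s \<omega>)\<^sup>2)"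
    and expectation_mult_increment_sq:
      "expectation (\<lambda>\<omega>. f \<omega> * (W t \<omega> - W s \<omega>)\<^sup>2) = (t - s) * expectation f"
proof -
  have "integrable M (\<lambda>\<omega>. f \<omega> * (W t \<omega> - W s \<omega>)) \<and> expectation (\<lambda>\<omega>. f \<omega> * (W t \<omega> - W s \<omega>)) = 0 \<and>
    integrable M (\<lambda>\<omega>. f \<omega> * (W t \<omega> - W s \<omega>)\<^sup>2) \<and>
    expectation (\<lambda>\<omega>. f \<omega> * (W t \<omega> - W s \<omega>)\<^sup>2) = (t - s) * expectation f"
  proof (cases "s = t")
    case False
    then have st': "s < t" using st by simp
    note ind = increment_indep_var[OF st(1) st' f(1)]
    have ind2: "indep_var borel f borel (\<lambda>\<omega>. (W t \<omega> - W s \<omega>)\<^sup>2)"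
      using indep_var_compose[OF ind, of "\<lambda>x. x" borel "\<lambda>x. x\<^sup>2" borel] by (simp add: o_def)
    note mom = increment_moments[OF st]
    show ?thesis
      using indep_var_integrable[OF ind f(2) mom(1)] indep_var_lebesgue_integral[OF ind f(2) mom(1)]
        indep_var_integrable[OF ind2 f(2) mom(3)] indep_var_lebesgue_integral[OF ind2 f(2) mom(3)] mom
      by simp
  qed simp
  then show "integrable M (\<lambda>\<omega>. f \<omega> * (W t \<omega> - W s \<omega>))"
    "expectation (\<lambda>\<omega>. f \<omega> * (W t \<omega> - W s \<omega>)) = 0"
    "integrable M (\<lambda>\<omega>. f \<omega> * (W t \<omega> - W s \<omega>)\<^sup>2)"
    "expectation (\<lambda>\<omega>. f \<omega> * (W t \<omega> - W s \<omega>)\<^sup>2) = (t - s) * expectation f"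
    by blast+
qed

lemma square_integrable_mult_increment:
  assumes st: "0 \<le> s" "s \<le> t" and f: "f \<in> borel_measurable (F s)" "square_integrable M f"
  shows "square_integrable M (\<lambda>\<omega>. (W t \<omega> - W s \<omega>) * f \<omega>)"
proof -
  have "integrable M (\<lambda>\<omega>. (f \<omega>)\<^sup>2 * (W t \<omega> - W s \<omega>)\<^sup>2)"
    using f by (intro integrable_mult_increment_sq[OF st]) (auto simp: square_integrable_def)
  moreover have "W s \<in> borel_measurable M" "W t \<in> borel_measurable M"
    using st measurable_F_M[OF _ W_adapted] by auto
  ultimately show ?thesis
    using f(2) by (auto simp: square_integrable_def power_mult_distrib mult.commute)
qed

text \<open>The two intervals may overlap arbitrarily, so integrals over unrelated partitions can be
  compared term by term. The product is cut at \<open>c\<close> and at the first right endpoint; a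
  piece whose last increment is independent of its other factors has mean zero, and only the squared
  increment over the overlap contributes.\<close>

lemma increments_cross_le:
  assumes ord: "0 \<le> a" "a \<le> b" "a \<le> c" "c \<le> d"
    and e: "e \<in> borel_measurable (F a)" "square_integrable M e"
    and e': "e' \<in> borel_measurable (F c)" "square_integrable M e'"
  shows "expectation (\<lambda>\<omega>. ((W b \<omega> - W a \<omega>) * e \<omega>) * ((W d \<omega> - W c \<omega>) * e' \<omega>)) =
    measure lborel ({a..<b} \<inter> {c..<d}) * expectation (\<lambda>\<omega>. e \<omega> * e' \<omega>)"
proof (cases "b \<le> c")
  case True
  have [measurable]: "e \<in> borel_measurable (F c)" "e' \<in> borel_measurable (F c)"
    "W a \<in> borel_measurable (F c)" "W b \<in> borel_measurable (F c)"
    using ord True e(1) e'(1) measurable_F_mono[OF _ _ W_adapted, of a c]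
      measurable_F_mono[OF _ _ W_adapted, of b c] by (auto intro: measurable_F_mono)
  have "expectation (\<lambda>\<omega>. ((W b \<omega> - W a \<omega>) * e \<omega>) * e' \<omega> * (W d \<omega> - W c \<omega>)) = 0"
    using ord e e' by (intro expectation_mult_increment square_integrable_mult square_integrable_mult_increment) auto
  moreover have "{a..<b} \<inter> {c..<d} = {}" using True by auto
  then have "measure lborel ({a..<b} \<inter> {c..<d}) = 0" by (simp only: measure_empty)
  ultimately show ?thesis by (simp only: mult_zero_left) (simp add: ac_simps)
next
  case False
  \<comment> \<open>The overlap of the two intervals is \<open>{c..<m}\<close>.\<close>
  define m where "m = min b d"
  have m: "c \<le> m" "m \<le> b" "m \<le> d" using False ord by (auto simp: m_def)
  have c0: "0 \<le> c" using ord by simp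
  have mc[measurable]: "e \<in> borel_measurable (F c)" "e' \<in> borel_measurable (F c)"
    "W a \<in> borel_measurable (F c)" "W c \<in> borel_measurable (F c)"
    using ord e(1) e'(1) measurable_F_mono[OF _ _ W_adapted, of a c] by (auto intro: measurable_F_mono W_adapted)
  have m0: "0 \<le> m" using c0 m by simp
  have [measurable]: "e \<in> borel_measurable (F m)" "e' \<in> borel_measurable (F m)"
    "W m \<in> borel_measurable (F m)" "W c \<in> borel_measurable (F m)"
    by (rule measurable_F_mono[OF c0 m(1)] W_adapted[OF m0] mc)+
  have ee: "integrable M (\<lambda>\<omega>. e \<omega> * e' \<omega>)" using e e' by (intro square_integrable_mult)
  have 1: "integrable M (\<lambda>\<omega>. (((W c \<omega> - W a \<omega>) * e \<omega>) * e' \<omega>) * (W d \<omega> - W c \<omega>))"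
    "expectation (\<lambda>\<omega>. (((W c \<omega> - W a \<omega>) * e \<omega>) * e' \<omega>) * (W d \<omega> - W c \<omega>)) = 0"
    using ord e e' c0
    by (intro expectation_mult_increment integrable_mult_increment square_integrable_mult
        square_integrable_mult_increment; auto)+
  have 2: "integrable M (\<lambda>\<omega>. (e \<omega> * e' \<omega>) * (W m \<omega> - W c \<omega>)\<^sup>2)"
    "expectation (\<lambda>\<omega>. (e \<omega> * e' \<omega>) * (W m \<omega> - W c \<omega>)\<^sup>2) = (m - c) * expectation (\<lambda>\<omega>. e \<omega> * e' \<omega>)"
    using c0 m ee by (intro expectation_mult_increment_sq integrable_mult_increment_sq; auto)+
  have i: "integrable M (\<lambda>\<omega>. (e \<omega> * e' \<omega>) * (W m \<omega> - W c \<omega>))"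
    using c0 m ee by (intro integrable_mult_increment; auto)
  have 3: "integrable M (\<lambda>\<omega>. ((e \<omega> * e' \<omega>) * (W m \<omega> - W c \<omega>)) * (W r \<omega> - W m \<omega>))"
    "expectation (\<lambda>\<omega>. ((e \<omega> * e' \<omega>) * (W m \<omega> - W c \<omega>)) * (W r \<omega> - W m \<omega>)) = 0" if "m \<le> r" for r
    by (rule integrable_mult_increment[OF m0 that _ i] expectation_mult_increment[OF m0 that _ i], measurable)+
  \<comment> \<open>Besides the squared increment over the overlap, each summand ends with an
    increment that starts at a time when all its other factors are already known.\<close>
  have "(\<lambda>\<omega>. ((W b \<omega> - W a \<omega>) * e \<omega>) * ((W d \<omega> - W c \<omega>) * e' \<omega>)) =
    (\<lambda>\<omega>. (((W c \<omega> - W a \<omega>) * e \<omega>) * e' \<omega>) * (W d \<omega> - W c \<omega>) +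
        (e \<omega> * e' \<omega>) * (W m \<omega> - W c \<omega>)\<^sup>2 +
        ((e \<omega> * e' \<omega>) * (W m \<omega> - W c \<omega>)) * (W d \<omega> - W m \<omega>) +
        ((e \<omega> * e' \<omega>) * (W m \<omega> - W c \<omega>)) * (W b \<omega> - W m \<omega>))"
  proof
    fix \<omega>
    \<comment> \<open>As \<open>m\<close> is one of the two right endpoints, the product of the
      increments from \<open>m\<close> to \<open>b\<close> and from \<open>m\<close> to
      \<open>d\<close>, which is missing in the expansion, is zero.\<close>
    have "W b \<omega> = W m \<omega> \<or> W d \<omega> = W m \<omega>" by (auto simp: m_def min_def)
    then show "((W b \<omega> - W a \<omega>) * e \<omega>) * ((W d \<omega> - W c \<omega>) * e' \<omega>) =
        (((W c \<omega> - W a \<omega>) * e \<omega>) * e' \<omega>) * (W d \<omega> - W c \<omega>) +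
        (e \<omega> * e' \<omega>) * (W m \<omega> - W c \<omega>)\<^sup>2 +
        ((e \<omega> * e' \<omega>) * (W m \<omega> - W c \<omega>)) * (W d \<omega> - W m \<omega>) +
        ((e \<omega> * e' \<omega>) * (W m \<omega> - W c \<omega>)) * (W b \<omega> - W m \<omega>)"
      by (elim disjE) (simp_all add: algebra_simps power2_eq_square)
  qed
  then have "expectation (\<lambda>\<omega>. ((W b \<omega> - W a \<omega>) * e \<omega>) * ((W d \<omega> - W c \<omega>) * e' \<omega>)) =
     (m - c) * expectation (\<lambda>\<omega>. e \<omega> * e' \<omega>)"
    using 1 2 3(1)[OF m(3)] 3(2)[OF m(3)] 3(1)[OF m(2)] 3(2)[OF m(2)] by simp
  moreover have "{a..<b} \<inter> {c..<d} = {c..<m}" using ord by (auto simp: m_def)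
  ultimately show ?thesis using m by simp
qed

lemma increments_cross:
  assumes ord: "0 \<le> a" "a \<le> b" "0 \<le> c" "c \<le> d"
    and e: "e \<in> borel_measurable (F a)" "square_integrable M e"
    and e': "e' \<in> borel_measurable (F c)" "square_integrable M e'"
  shows "expectation (\<lambda>\<omega>. ((W b \<omega> - W a \<omega>) * e \<omega>) * ((W d \<omega> - W c \<omega>) * e' \<omega>)) =
    measure lborel ({a..<b} \<inter> {c..<d}) * expectation (\<lambda>\<omega>. e \<omega> * e' \<omega>)"
proof (cases "a \<le> c")
  case True
  then show ?thesis using increments_cross_le[OF ord(1,2) True ord(4) e e'] by simp
next
  case False
  then show ?thesis using increments_cross_le[OF ord(3,4) _ ord(2) e' e]
    by (simp add: mult.commute Int_commute)
qed

end

lemma augmented_filtration_space: "space (augmented_filtration M W \<xi> t) = space M"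
  unfolding augmented_filtration_def by (rule space_measure_of_conv)

lemma augmented_filtration_sets:
  "sets (augmented_filtration M W \<xi> t) = sigma_sets (space M)
       ({\<xi> -` A \<inter> space M | A. A \<in> sets borel} \<union>
        {W s -` A \<inter> space M | s A. 0 \<le> s \<and> s \<le> t \<and> A \<in> sets borel} \<union>
        null_sets M)"
  unfolding augmented_filtration_def
  by (rule sets_measure_of) (use sets.sets_into_space in \<open>auto simp: null_sets_def\<close>)

lemma augmented_filtration_mono:
  "s \<le> t \<Longrightarrow> sets (augmented_filtration M W \<xi> s) \<subseteq> sets (augmented_filtration M W \<xi> t)"
  unfolding augmented_filtration_sets
  by (intro sigma_sets_subseteq Un_mono order_refl subsetI) (clarsimp, metis order_trans)

lemma augmented_filtration_initial_measurable:
  "\<xi> \<in> borel_measurable (augmented_filtration M W \<xi> t)"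
  by (rule measurableI)
     (auto simp: augmented_filtration_space augmented_filtration_sets intro!: sigma_sets.Basic)

lemma augmented_filtration_brownian_measurable:
  "0 \<le> s \<Longrightarrow> s \<le> t \<Longrightarrow> W s \<in> borel_measurable (augmented_filtration M W \<xi> t)"
  by (rule measurableI)
     (auto simp: augmented_filtration_space augmented_filtration_sets intro!: sigma_sets.Basic)

lemma augmented_filtration_subset:
  assumes "\<xi> \<in> borel_measurable M" "\<And>t. 0 \<le> t \<Longrightarrow> W t \<in> borel_measurable M"
  shows "sets (augmented_filtration M W \<xi> t) \<subseteq> sets M"
  unfolding augmented_filtration_sets
  using assms by (intro sets.sigma_sets_subset) (auto intro: measurable_sets)

text \<open>By definition an increment is independent of the past of \<open>W\<close> alone, and
  \<open>\<xi>\<close> is independent of the path as a whole. Together this gives independence of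
  the increment from the pair of \<open>\<xi>\<close> and the past, first on an intersection-stable
  generator and then on the generated sigma-algebra.\<close>

lemma brownian_filtration_augmented:
  assumes W: "standard_brownian_motion M W"
    and ind: "independent_rv M borel \<xi> (PiM {0..} (\<lambda>_. borel)) (\<lambda>\<omega>. \<lambda>t\<in>{0..}. W t \<omega>)"
  shows "brownian_filtration M (augmented_filtration M W \<xi>) W"
proof -
  interpret prob_space M using W by (simp add: standard_brownian_motion_def)
  have \<xi>[measurable]: "\<xi> \<in> borel_measurable M" using ind by (simp add: independent_rv_def)
  have Wm: "0 \<le> t \<Longrightarrow> W t \<in> borel_measurable M" for t using W by (simp add: standard_brownian_motion_def)
  show ?thesis
  proof
    fix s t :: real
    show "space (augmented_filtration M W \<xi> t) = space M" by (rule augmented_filtration_space)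
    show "sets (augmented_filtration M W \<xi> t) \<subseteq> sets M" using augmented_filtration_subset[OF \<xi> Wm] .
    show "sets (augmented_filtration M W \<xi> s) \<subseteq> sets (augmented_filtration M W \<xi> t)" if "s \<le> t"
      using augmented_filtration_mono[OF that] .
    show "W t \<in> borel_measurable (augmented_filtration M W \<xi> t)" if "0 \<le> t"
      using that by (rule augmented_filtration_brownian_measurable) simp
    assume s: "0 \<le> s" and st: "s < t"
    let ?D = "\<lambda>\<omega>. W t \<omega> - W s \<omega>" and ?Y = "\<lambda>\<omega>. \<lambda>r\<in>{0..s}. W r \<omega>"
    show "distributed M lborel ?D (\<lambda>y. ennreal (normal_density 0 (sqrt (t - s)) y))"
      using W s st by (simp add: standard_brownian_motion_def)
    fix A B assume A: "A \<in> sets (augmented_filtration M W \<xi> s)" and B: "B \<in> sets (borel :: real measure)"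
    have indY: "independent_rv M borel ?D (PiM {0..s} (\<lambda>_. borel)) ?Y"
      using W s st by (simp add: standard_brownian_motion_def)
    then have [measurable]: "?Y \<in> measurable M (PiM {0..s} (\<lambda>_. borel))" "?D \<in> borel_measurable M"
      by (simp_all add: independent_rv_def)
    \<comment> \<open>Rectangles of an initial event and a past event. The null sets are adjoined
      because the filtration is augmented; they preserve both stability under intersections and the
      product rule.\<close>
    let ?G = "{\<xi> -` A \<inter> (?Y -` B \<inter> space M) | A B. A \<in> sets borel \<and> B \<in> sets (PiM {0..s} (\<lambda>_. borel))} \<union> null_sets M"
    let ?H = "{?D -` C \<inter> space M | C. C \<in> sets borel}"
    have "indep_set ?G ?H"
    proof (rule indep_setI)
      show "?G \<subseteq> events"
      proof -
        have "\<xi> -` A \<inter> (?Y -` B \<inter> space M) \<in> events" if "A \<in> sets borel" "B \<in> sets (PiM {0..s} (\<lambda>_. borel))" for A B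
        proof -
          have "\<xi> -` A \<inter> (?Y -` B \<inter> space M) = (\<xi> -` A \<inter> space M) \<inter> (?Y -` B \<inter> space M)" by auto
          also have "\<dots> \<in> events" using that by measurable
          finally show ?thesis .
        qed
        then show ?thesis by auto
      qed
      show "?H \<subseteq> events" by auto
      fix g h assume g: "g \<in> ?G" and "h \<in> ?H"
      then obtain C where C: "C \<in> sets borel" "h = ?D -` C \<inter> space M" by auto
      show "prob (g \<inter> h) = prob g * prob h"
      proof (cases "g \<in> null_sets M")
        case True
        then have "g \<inter> h \<in> null_sets M" using C by (intro null_set_Int2) auto
        with True show ?thesis by (simp add: measure_eq_0_null_sets)
      next
        case False
        with g obtain A B where AB: "A \<in> sets borel" "B \<in> sets (PiM {0..s} (\<lambda>_. borel))"
          "g = \<xi> -` A \<inter> (?Y -` B \<inter> space M)" by auto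
        let ?P = "\<lambda>\<omega>. \<lambda>t\<in>{0..}. W t \<omega>"
        \<comment> \<open>Independence of \<open>\<xi>\<close> is available against the full path,
          so the past event and the increment event are both written as events of that path.\<close>
        define E where "E = {f \<in> space (PiM {0..} (\<lambda>_::real. borel :: real measure)). restrict f {0..s} \<in> B}"
        define E' where "E' = {f \<in> space (PiM {0..} (\<lambda>_::real. borel :: real measure)). f t - f s \<in> C}"
        have Em: "E \<in> sets (PiM {0..} (\<lambda>_. borel))"
        proof -
          have "(\<lambda>f. restrict f {0..s}) \<in> measurable (PiM {0..} (\<lambda>_::real. borel :: real measure)) (PiM {0..s} (\<lambda>_. borel))"
            by (rule measurable_restrict_subset) auto
          from measurable_sets[OF this AB(2)] show ?thesis by (simp add: E_def vimage_def Int_def conj_commute)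
        qed
        have E'm: "E' \<in> sets (PiM {0..} (\<lambda>_. borel))"
        proof -
          have "(\<lambda>f. f t - f s) \<in> measurable (PiM {0..} (\<lambda>_::real. borel :: real measure)) borel"
            using s st by (intro borel_measurable_diff measurable_component_singleton) auto
          from measurable_sets[OF this C(1)] show ?thesis by (simp add: E'_def vimage_def Int_def conj_commute)
        qed
        have sp: "?P \<omega> \<in> space (PiM {0..} (\<lambda>_. borel))" for \<omega> by (auto simp: space_PiM)
        have r: "restrict (?P \<omega>) {0..s} = ?Y \<omega>" for \<omega> by (auto simp: restrict_def)
        have preE: "?P -` E \<inter> space M = ?Y -` B \<inter> space M"
          unfolding E_def using sp r by auto
        have preEE': "?P -` (E \<inter> E') \<inter> space M = (?Y -` B \<inter> space M) \<inter> h"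
          unfolding E_def E'_def C(2) using sp r s st by auto
        have joint: "prob ((\<xi> -` A \<inter> space M) \<inter> (?P -` Z \<inter> space M)) =
          prob (\<xi> -` A \<inter> space M) * prob (?P -` Z \<inter> space M)" if "Z \<in> sets (PiM {0..} (\<lambda>_. borel))" for Z
          using ind that AB(1) unfolding independent_rv_def by (auto elim!: indep_setD)
        have YD: "prob (h \<inter> (?Y -` B \<inter> space M)) = prob h * prob (?Y -` B \<inter> space M)"
          using indY AB(2) C unfolding independent_rv_def by (auto elim!: indep_setD)
        \<comment> \<open>First \<open>\<xi>\<close> is separated from the path event, then the
          increment from the past; the second equation for \<open>g\<close> recombines
          \<open>\<xi>\<close> with the past.\<close>
        have "g \<inter> h = (\<xi> -` A \<inter> space M) \<inter> (?P -` (E \<inter> E') \<inter> space M)"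
          unfolding preEE' AB(3) C(2) by auto
        then have "prob (g \<inter> h) = prob (\<xi> -` A \<inter> space M) * prob (h \<inter> (?Y -` B \<inter> space M))"
          using joint[of "E \<inter> E'"] Em E'm preEE' by (simp add: Int_commute)
        moreover have "g = (\<xi> -` A \<inter> space M) \<inter> (?P -` E \<inter> space M)"
          unfolding preE AB(3) by auto
        ultimately show ?thesis using joint[OF Em] YD preE by simp
      qed
    qed
    moreover have "Int_stable ?G"
    proof (rule Int_stableI)
      fix a b assume ab: "a \<in> ?G" "b \<in> ?G"
      note G_sets = indep_setD_ev1[OF \<open>indep_set ?G ?H\<close>]
      show "a \<inter> b \<in> ?G"
      proof (cases "a \<in> null_sets M \<or> b \<in> null_sets M")
        case True
        then have "a \<inter> b \<in> null_sets M"
          using ab G_sets by (meson null_set_Int1 null_set_Int2 subsetD)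
        then show ?thesis by blast
      next
        case False
        with ab obtain A B A' B' where
          "A \<in> sets borel" "B \<in> sets (PiM {0..s} (\<lambda>_. borel))" "a = \<xi> -` A \<inter> (?Y -` B \<inter> space M)"
          "A' \<in> sets borel" "B' \<in> sets (PiM {0..s} (\<lambda>_. borel))" "b = \<xi> -` A' \<inter> (?Y -` B' \<inter> space M)"
          by auto
        then show ?thesis
          by (intro UnI1 CollectI exI[of _ "A \<inter> A'"] exI[of _ "B \<inter> B'"]) auto
      qed
    qed
    moreover have "Int_stable ?H" by (rule Int_stable_preimages)
    ultimately have ind': "indep_set (sigma_sets (space M) ?G) (sigma_sets (space M) ?H)"
      by (rule indep_set_sigma_sets)
    have "sets (augmented_filtration M W \<xi> s) \<subseteq> sigma_sets (space M) ?G"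
      unfolding augmented_filtration_sets
    proof (rule sigma_sets_mono, intro Un_least subsetI)
      let ?\<Omega> = "space (PiM {0..s} (\<lambda>_. borel :: real measure))"
      have spY: "?Y \<omega> \<in> ?\<Omega>" for \<omega> by (auto simp: space_PiM)
      fix a assume "a \<in> {\<xi> -` A \<inter> space M | A. A \<in> sets borel}"
      then obtain A where "A \<in> sets borel" "a = \<xi> -` A \<inter> (?Y -` ?\<Omega> \<inter> space M)" using spY by auto
      then show "a \<in> sigma_sets (space M) ?G" by (intro sigma_sets.Basic) blast
    next
      let ?\<Omega> = "space (PiM {0..s} (\<lambda>_. borel :: real measure))"
      have spY: "?Y \<omega> \<in> ?\<Omega>" for \<omega> by (auto simp: space_PiM)
      fix a assume "a \<in> {W r -` A \<inter> space M | r A. 0 \<le> r \<and> r \<le> s \<and> A \<in> sets borel}"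
      then obtain r A where rA: "0 \<le> r" "r \<le> s" "A \<in> sets borel" "a = W r -` A \<inter> space M" by auto
      have "(\<lambda>f. f r) -` A \<inter> ?\<Omega> \<in> sets (PiM {0..s} (\<lambda>_. borel))"
        using rA by (intro measurable_sets[OF measurable_component_singleton]) auto
      moreover have "a = \<xi> -` UNIV \<inter> (?Y -` ((\<lambda>f. f r) -` A \<inter> ?\<Omega>) \<inter> space M)"
        using rA spY by auto
      ultimately show "a \<in> sigma_sets (space M) ?G"
        by (intro sigma_sets.Basic UnI1 CollectI exI[of _ UNIV] exI[of _ "(\<lambda>f. f r) -` A \<inter> ?\<Omega>"]) auto
    next
      fix a assume "a \<in> null_sets M"
      then show "a \<in> sigma_sets (space M) ?G" by (intro sigma_sets.Basic) blast
    qed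
    then show "prob (A \<inter> (?D -` B \<inter> space M)) = prob A * prob (?D -` B \<inter> space M)"
      using A B by (intro indep_setD[OF ind']) auto
  qed
qed

section \<open>Covariances of Ito integrals\<close>

lemma borel_measurable_vec_component [measurable (raw)]:
  fixes X :: "'a \<Rightarrow> real ^ 'n"
  assumes [measurable]: "X \<in> borel_measurable M"
  shows "(\<lambda>\<omega>. X \<omega> $ i) \<in> borel_measurable M"
proof -
  have "(\<lambda>\<omega>. inner (X \<omega>) (axis i 1)) \<in> borel_measurable M" by measurable
  then show ?thesis by (simp add: inner_axis)
qed

lemma square_integrable_component:
  fixes X :: "'w \<Rightarrow> real ^ 'n"
  assumes X: "X \<in> borel_measurable M" and "second_moment M X < \<infinity>"
  shows "square_integrable M (\<lambda>\<omega>. X \<omega> $ i)"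
proof (rule square_integrableI_nn_integral)
  have "(\<integral>\<^sup>+\<omega>. ennreal ((X \<omega> $ i)\<^sup>2) \<partial>M) \<le> second_moment M X"
    unfolding second_moment_def
    by (intro nn_integral_mono ennreal_leI) (simp add: abs_le_square_iff[symmetric] component_le_norm_cart)
  also note assms(2)
  finally show "(\<integral>\<^sup>+\<omega>. ennreal ((X \<omega> $ i)\<^sup>2) \<partial>M) < \<infinity>" .
qed (use X in measurable)

lemma square_integrable_const: "finite_measure M \<Longrightarrow> square_integrable M (\<lambda>x. c)"
  by (simp add: square_integrable_def finite_measure.integrable_const)

lemma square_integrable_imp_integrable_finite:
  assumes "finite_measure M" "square_integrable M f"
  shows "integrable M f"
  using square_integrable_mult[OF assms(2) square_integrable_const[OF assms(1), of 1]] by simp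

lemma
  fixes f :: "'a \<Rightarrow> real" and g :: "'b \<Rightarrow> real"
  assumes "pair_sigma_finite M1 M2" and f: "integrable M1 f" and g: "integrable M2 g"
  shows integrable_pair_mult: "integrable (M1 \<Otimes>\<^sub>M M2) (\<lambda>p. f (fst p) * g (snd p))"
    and integral_pair_mult: "(\<integral>p. f (fst p) * g (snd p) \<partial>(M1 \<Otimes>\<^sub>M M2)) = integral\<^sup>L M1 f * integral\<^sup>L M2 g"
proof -
  interpret pair_sigma_finite M1 M2 by fact
  note [measurable] = borel_measurable_integrable[OF f] borel_measurable_integrable[OF g]
  show i: "integrable (M1 \<Otimes>\<^sub>M M2) (\<lambda>p. f (fst p) * g (snd p))"
  proof (rule Fubini_integrable)
    show "integrable M1 (\<lambda>x. \<integral>y. norm (f (fst (x, y)) * g (snd (x, y))) \<partial>M2)"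
      using f g by (simp add: abs_mult)
    show "AE x in M1. integrable M2 (\<lambda>y. f (fst (x, y)) * g (snd (x, y)))"
      using g by simp
  qed measurable
  show "(\<integral>p. f (fst p) * g (snd p) \<partial>(M1 \<Otimes>\<^sub>M M2)) = integral\<^sup>L M1 f * integral\<^sup>L M2 g"
    using integral_fst'[OF i] by simp
qed

lemma integral_double_sum:
  fixes f :: "nat \<Rightarrow> nat \<Rightarrow> 'a \<Rightarrow> real"
  assumes "\<And>a b. a < k \<Longrightarrow> b < l \<Longrightarrow> integrable M (f a b)"
  shows "(\<integral>x. (\<Sum>a<k. \<Sum>b<l. f a b x) \<partial>M) = (\<Sum>a<k. \<Sum>b<l. \<integral>x. f a b x \<partial>M)"
proof -
  have "(\<integral>x. (\<Sum>a<k. \<Sum>b<l. f a b x) \<partial>M) = (\<Sum>a<k. \<integral>x. (\<Sum>b<l. f a b x) \<partial>M)"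
    using assms by (intro Bochner_Integration.integral_sum Bochner_Integration.integrable_sum) auto
  also have "\<dots> = (\<Sum>a<k. \<Sum>b<l. \<integral>x. f a b x \<partial>M)"
    using assms by (intro sum.cong refl Bochner_Integration.integral_sum) auto
  finally show ?thesis .
qed

lemma square_integrable_snd:
  fixes f :: "'b \<Rightarrow> real"
  assumes "finite_measure N" "sigma_finite_measure M" "square_integrable M f"
  shows "square_integrable (N \<Otimes>\<^sub>M M) (\<lambda>p. f (snd p))"
proof -
  interpret N: finite_measure N by fact
  have "pair_sigma_finite N M"
    using assms(2) N.sigma_finite_measure_axioms by (simp add: pair_sigma_finite_def)
  note [measurable] = square_integrable_measurable[OF assms(3)]
  have "integrable (N \<Otimes>\<^sub>M M) (\<lambda>p. (f (snd p))\<^sup>2)"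
    using integrable_pair_mult[OF \<open>pair_sigma_finite N M\<close>, of "\<lambda>_. 1" "\<lambda>y. (f y)\<^sup>2"] assms(3)
    by (simp add: square_integrable_def)
  then show ?thesis unfolding square_integrable_def by simp
qed

text \<open>Cauchy-Schwarz against the constant 1 on the finite measure \<open>N\<close> bounds the
  square of the section integral by a multiple of the section integral of the square. The other two
  claims are Fubini; \<open>N\<close> will be the time interval.\<close>

lemma
  fixes g :: "'a \<times> 'w \<Rightarrow> real"
  assumes N: "finite_measure N" and M: "finite_measure M" and g: "square_integrable (N \<Otimes>\<^sub>M M) g"
  shows square_integrable_section_integral: "square_integrable M (\<lambda>\<omega>. \<integral>r. g (r, \<omega>) \<partial>N)"
    and integrable_section_inner: "square_integrable M Z \<Longrightarrow> integrable N (\<lambda>r. \<integral>\<omega>. Z \<omega> * g (r, \<omega>) \<partial>M)"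
    and integral_section_inner: "square_integrable M Z \<Longrightarrow>
      (\<integral>\<omega>. Z \<omega> * (\<integral>r. g (r, \<omega>) \<partial>N) \<partial>M) = (\<integral>r. (\<integral>\<omega>. Z \<omega> * g (r, \<omega>) \<partial>M) \<partial>N)"
proof -
  interpret N: finite_measure N by fact
  interpret M: finite_measure M by fact
  interpret pair_sigma_finite N M
    using N.sigma_finite_measure_axioms M.sigma_finite_measure_axioms by (simp add: pair_sigma_finite_def)
  note [measurable] = square_integrable_measurable[OF g]
  have ig2: "integrable (N \<Otimes>\<^sub>M M) (\<lambda>(r, \<omega>). (g (r, \<omega>))\<^sup>2)"
    using g by (simp add: square_integrable_def case_prod_beta')
  show "square_integrable M (\<lambda>\<omega>. \<integral>r. g (r, \<omega>) \<partial>N)"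
  proof -
    have [measurable]: "(\<lambda>\<omega>. \<integral>r. g (r, \<omega>) \<partial>N) \<in> borel_measurable M"
      by measurable
    have "integrable M (\<lambda>\<omega>. measure N (space N) * (\<integral>r. (g (r, \<omega>))\<^sup>2 \<partial>N))"
      using integrable_snd[OF ig2] by simp
    then have "integrable M (\<lambda>\<omega>. (\<integral>r. g (r, \<omega>) \<partial>N)\<^sup>2)"
    proof (rule Bochner_Integration.integrable_bound)
      show "AE \<omega> in M. norm ((\<integral>r. g (r, \<omega>) \<partial>N)\<^sup>2) \<le> norm (measure N (space N) * (\<integral>r. (g (r, \<omega>))\<^sup>2 \<partial>N))"
        using AE_integrable_snd[OF ig2] AE_space
      proof eventually_elim
        case (elim \<omega>)
        then have "square_integrable N (\<lambda>r. g (r, \<omega>))" by (simp add: square_integrable_def)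
        from integral_Cauchy_Schwarz[OF this square_integrable_const[OF N, of 1]]
        have "\<bar>\<integral>r. g (r, \<omega>) \<partial>N\<bar> \<le> sqrt (measure N (space N) * (\<integral>r. (g (r, \<omega>))\<^sup>2 \<partial>N))"
          by (simp add: real_sqrt_mult mult.commute)
        then have "\<bar>\<integral>r. g (r, \<omega>) \<partial>N\<bar>\<^sup>2 \<le> (sqrt (measure N (space N) * (\<integral>r. (g (r, \<omega>))\<^sup>2 \<partial>N)))\<^sup>2"
          by (rule power_mono) simp
        then show ?case by simp
      qed
    qed measurable
    then show ?thesis by (simp add: square_integrable_def)
  qed
  assume Z: "square_integrable M Z"
  have "integrable (N \<Otimes>\<^sub>M M) (\<lambda>p. Z (snd p) * g p)"
    by (intro square_integrable_mult square_integrable_snd N M.sigma_finite_measure_axioms Z g)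
  then have iZ: "integrable (N \<Otimes>\<^sub>M M) (\<lambda>(r, \<omega>). Z \<omega> * g (r, \<omega>))" by (simp add: case_prod_beta')
  show "integrable N (\<lambda>r. \<integral>\<omega>. Z \<omega> * g (r, \<omega>) \<partial>M)" using integrable_fst[OF iZ] .
  show "(\<integral>\<omega>. Z \<omega> * (\<integral>r. g (r, \<omega>) \<partial>N) \<partial>M) = (\<integral>r. (\<integral>\<omega>. Z \<omega> * g (r, \<omega>) \<partial>M) \<partial>N)"
    using Fubini_integral[OF iZ] by simp
qed

section \<open>Time intervals as finite measure spaces, elementary processes and their
  integrals\<close>

abbreviation time_measure :: "real \<Rightarrow> real measure" where
  "time_measure T \<equiv> restrict_space lborel {0..T}"

lemma finite_time_measure: "finite_measure (time_measure T)"
  by (rule finite_measureI) (simp add: emeasure_restrict_space space_restrict_space emeasure_lborel_Icc_eq)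

lemma id_measurable_time [measurable]: "(\<lambda>x. x) \<in> borel_measurable (time_measure T)"
  by (rule measurable_restrict_space1) simp

lemma space_time_measure: "space (time_measure T) = {0..T}"
  by (simp add: space_restrict_space)

lemma nn_integral_time_pair:
  assumes "sigma_finite_measure M" "f \<in> borel_measurable (time_measure T \<Otimes>\<^sub>M M)"
  shows "(\<integral>\<^sup>+ \<omega>. (\<integral>\<^sup>+ s\<in>{0..T}. f (s, \<omega>) \<partial>lborel) \<partial>M) = (\<integral>\<^sup>+ p. f p \<partial>(time_measure T \<Otimes>\<^sub>M M))"
proof -
  interpret T: finite_measure "time_measure T" by (rule finite_time_measure)
  interpret pair_sigma_finite "time_measure T" M
    using assms(1) T.sigma_finite_measure_axioms by (simp add: pair_sigma_finite_def)
  show ?thesis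
    using nn_integral_snd[of f] assms(2)
    by (simp add: nn_integral_restrict_space)
qed

lemma L2_adapted_square_integrable:
  assumes "sigma_finite_measure M" "L2_adapted M F T H"
  shows "square_integrable (time_measure T \<Otimes>\<^sub>M M) (\<lambda>p. H (fst p) (snd p) $ i)"
proof (rule square_integrableI_nn_integral)
  have [measurable]: "(\<lambda>p. H (fst p) (snd p)) \<in> borel_measurable (time_measure T \<Otimes>\<^sub>M M)"
    using assms(2) by (simp add: L2_adapted_def case_prod_beta')
  show "(\<lambda>p. H (fst p) (snd p) $ i) \<in> borel_measurable (time_measure T \<Otimes>\<^sub>M M)" by measurable
  have "(\<integral>\<^sup>+p. ennreal ((H (fst p) (snd p) $ i)\<^sup>2) \<partial>(time_measure T \<Otimes>\<^sub>M M)) \<le>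
      (\<integral>\<^sup>+p. ennreal ((norm (H (fst p) (snd p)))\<^sup>2) \<partial>(time_measure T \<Otimes>\<^sub>M M))"
    by (intro nn_integral_mono ennreal_leI) (simp add: abs_le_square_iff[symmetric] component_le_norm_cart)
  also have "\<dots> = (\<integral>\<^sup>+ \<omega>. (\<integral>\<^sup>+ s\<in>{0..T}. ennreal ((norm (H s \<omega>))\<^sup>2) \<partial>lborel) \<partial>M)"
    using nn_integral_time_pair[OF assms(1), of "\<lambda>p. ennreal ((norm (H (fst p) (snd p)))\<^sup>2)" T] by simp
  also have "\<dots> < \<infinity>" using assms(2) by (simp add: L2_adapted_def)
  finally show "(\<integral>\<^sup>+p. ennreal ((H (fst p) (snd p) $ i)\<^sup>2) \<partial>(time_measure T \<Otimes>\<^sub>M M)) < \<infinity>" .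
qed

lemma elementary_data_partition:
  assumes "elementary_data M F T k \<tau> e" "j < k"
  shows "0 \<le> \<tau> j" "\<tau> j \<le> \<tau> (Suc j)" "\<tau> (Suc j) \<le> T"
proof -
  have step: "\<tau> j \<le> \<tau> (Suc j)" if "j < k" for j using that assms(1) by (simp add: elementary_data_def)
  have "\<tau> i \<le> \<tau> l" if "i \<le> l" "l \<le> k" for i l
    using that
  proof (induction l rule: dec_induct)
    case (step n) then show ?case using \<open>\<And>j. j < k \<Longrightarrow> \<tau> j \<le> \<tau> (Suc j)\<close>[of n] by simp
  qed simp
  from this[of 0 j] this[of "Suc j" k] step[OF assms(2)] assms
  show "0 \<le> \<tau> j" "\<tau> j \<le> \<tau> (Suc j)" "\<tau> (Suc j) \<le> T" by (auto simp: elementary_data_def)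
qed

lemma elementary_integral_component:
  "elementary_integral W k \<tau> e \<omega> $ i = (\<Sum>j<k. (W (\<tau> (Suc j)) \<omega> - W (\<tau> j) \<omega>) * e j \<omega> $ i)"
  by (simp add: elementary_integral_def)

lemma elementary_process_component:
  "elementary_process k \<tau> e s \<omega> $ i = (\<Sum>j<k. indicator {\<tau> j..<\<tau> (Suc j)} s * e j \<omega> $ i)"
  by (simp add: elementary_process_def)

context brownian_filtration
begin

lemma elementary_data_value:
  assumes "elementary_data M F T k \<tau> e" "j < k"
  shows "(\<lambda>\<omega>. e j \<omega> $ i) \<in> borel_measurable (F (\<tau> j))" "e j \<in> borel_measurable M"
    "square_integrable M (\<lambda>\<omega>. e j \<omega> $ i)"
proof -
  have [measurable]: "e j \<in> borel_measurable (F (\<tau> j))" and s: "second_moment M (e j) < \<infinity>"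
    using assms by (auto simp: elementary_data_def)
  show "(\<lambda>\<omega>. e j \<omega> $ i) \<in> borel_measurable (F (\<tau> j))" by measurable
  show "e j \<in> borel_measurable M"
    using measurable_F_M[of "\<tau> j" "e j" borel] elementary_data_partition[OF assms] by simp
  then show "square_integrable M (\<lambda>\<omega>. e j \<omega> $ i)" using s by (rule square_integrable_component)
qed

lemma elementary_integral_square_integrable:
  assumes "elementary_data M F T k \<tau> e"
  shows "square_integrable M (\<lambda>\<omega>. elementary_integral W k \<tau> e \<omega> $ i)"
  unfolding elementary_integral_component
  using elementary_data_partition[OF assms] elementary_data_value[OF assms]
  by (intro square_integrable_sum square_integrable_mult_increment) auto

lemma elementary_process_square_integrable:
  assumes "elementary_data M F T k \<tau> e"
  shows "square_integrable (time_measure S \<Otimes>\<^sub>M M) (\<lambda>p. elementary_process k \<tau> e (fst p) (snd p) $ i)"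
  unfolding elementary_process_component
proof (intro square_integrable_sum)
  fix j assume j: "j \<in> {..<k}"
  then have [measurable]: "e j \<in> borel_measurable M" using elementary_data_value[OF assms] by simp
  show "square_integrable (time_measure S \<Otimes>\<^sub>M M) (\<lambda>p. indicator {\<tau> j..<\<tau> (Suc j)} (fst p) * e j (snd p) $ i)"
  proof (rule square_integrable_dominated)
    show "square_integrable (time_measure S \<Otimes>\<^sub>M M) (\<lambda>p. e j (snd p) $ i)"
      using j elementary_data_value[OF assms] by (intro square_integrable_snd finite_time_measure sigma_finite_measure_axioms) auto
  qed (auto simp: indicator_def)
qed

lemma elementary_data_measurable:
  assumes e: "elementary_data M F T k \<tau> e"
  shows "elementary_integral W k \<tau> e \<in> borel_measurable M"
    and "(\<lambda>p. elementary_process k \<tau> e (fst p) (snd p)) \<in> borel_measurable (time_measure S \<Otimes>\<^sub>M M)"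
proof -
  have m: "W (\<tau> j) \<in> borel_measurable M" "W (\<tau> (Suc j)) \<in> borel_measurable M" "e j \<in> borel_measurable M"
    if "j < k" for j
    using elementary_data_partition[OF e that] elementary_data_value[OF e that]
      measurable_F_M[OF _ W_adapted] by auto
  show "elementary_integral W k \<tau> e \<in> borel_measurable M"
    unfolding elementary_integral_def
    using m by (intro borel_measurable_sum borel_measurable_scaleR borel_measurable_diff) auto
  have "(\<lambda>p. indicator {\<tau> j..<\<tau> (Suc j)} (fst p) *\<^sub>R e j (snd p)) \<in> borel_measurable (time_measure S \<Otimes>\<^sub>M M)"
    if "j < k" for j
  proof -
    note [measurable] = m(3)[OF that]
    show ?thesis by measurable
  qed
  then show "(\<lambda>p. elementary_process k \<tau> e (fst p) (snd p)) \<in> borel_measurable (time_measure S \<Otimes>\<^sub>M M)"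
    unfolding elementary_process_def by (intro borel_measurable_sum) auto
qed

text \<open>Integrating over \<open>[0, T]\<close> suffices, since the first process vanishes after \<open>T\<close>.\<close>

lemma elementary_integral_cross:
  assumes e: "elementary_data M F T k \<tau> e" and e': "elementary_data M F T' k' \<tau>' e'"
  shows "expectation (\<lambda>\<omega>. elementary_integral W k \<tau> e \<omega> $ i * elementary_integral W k' \<tau>' e' \<omega> $ j) =
    (\<integral>p. elementary_process k \<tau> e (fst p) (snd p) $ i * elementary_process k' \<tau>' e' (fst p) (snd p) $ j
      \<partial>(time_measure T \<Otimes>\<^sub>M M))" (is "?L = ?R")
proof -
  interpret T: finite_measure "time_measure T" by (rule finite_time_measure)
  have psf: "pair_sigma_finite (time_measure T) M"
    using sigma_finite_measure_axioms T.sigma_finite_measure_axioms by (simp add: pair_sigma_finite_def)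
  note p = elementary_data_partition[OF e] and p' = elementary_data_partition[OF e']
  note v = elementary_data_value[OF e] and v' = elementary_data_value[OF e']
  let ?d = "\<lambda>a \<omega>. (W (\<tau> (Suc a)) \<omega> - W (\<tau> a) \<omega>) * e a \<omega> $ i"
  let ?d' = "\<lambda>b \<omega>. (W (\<tau>' (Suc b)) \<omega> - W (\<tau>' b) \<omega>) * e' b \<omega> $ j"
  let ?S = "\<lambda>a b. {\<tau> a..<\<tau> (Suc a)} \<inter> {\<tau>' b..<\<tau>' (Suc b)}"
  have "?L = expectation (\<lambda>\<omega>. \<Sum>a<k. \<Sum>b<k'. ?d a \<omega> * ?d' b \<omega>)"
    by (simp add: elementary_integral_component sum_product)
  also have "\<dots> = (\<Sum>a<k. \<Sum>b<k'. expectation (\<lambda>\<omega>. ?d a \<omega> * ?d' b \<omega>))"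
    by (rule integral_double_sum)
      (intro square_integrable_mult square_integrable_mult_increment p p' v v'; assumption)
  also have "\<dots> = (\<Sum>a<k. \<Sum>b<k'. measure lborel (?S a b) * expectation (\<lambda>\<omega>. e a \<omega> $ i * e' b \<omega> $ j))"
    using p p' v v' by (intro sum.cong refl increments_cross) auto
  also have "\<dots> = (\<Sum>a<k. \<Sum>b<k'. \<integral>p. indicator (?S a b) (fst p) * (e a (snd p) $ i * e' b (snd p) $ j) \<partial>(time_measure T \<Otimes>\<^sub>M M))"
  proof (intro sum.cong refl)
    fix a b assume a: "a \<in> {..<k}" and b: "b \<in> {..<k'}"
    have sub: "?S a b \<subseteq> {0..T}" using p[of a] a by auto
    have S: "?S a b \<in> sets (time_measure T)" using sub by (auto simp: sets_restrict_space_iff)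
    have "(\<integral>p. indicator (?S a b) (fst p) * (e a (snd p) $ i * e' b (snd p) $ j) \<partial>(time_measure T \<Otimes>\<^sub>M M)) =
      integral\<^sup>L (time_measure T) (indicator (?S a b)) * expectation (\<lambda>\<omega>. e a \<omega> $ i * e' b \<omega> $ j)"
    proof (rule integral_pair_mult[OF psf])
      show "integrable (time_measure T) (indicator (?S a b) :: real \<Rightarrow> real)"
        by (rule integrable_real_indicator[OF S]) (metis T.emeasure_finite top.not_eq_extremum infinity_ennreal_def)
      show "integrable M (\<lambda>\<omega>. e a \<omega> $ i * e' b \<omega> $ j)"
        using a b v v' by (intro square_integrable_mult) auto
    qed
    moreover have "integral\<^sup>L (time_measure T) (indicator (?S a b)) = measure lborel (?S a b)"
      using S sub by (simp add: measure_restrict_space Int_absorb2)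
    ultimately show "measure lborel (?S a b) * expectation (\<lambda>\<omega>. e a \<omega> $ i * e' b \<omega> $ j) =
      (\<integral>p. indicator (?S a b) (fst p) * (e a (snd p) $ i * e' b (snd p) $ j) \<partial>(time_measure T \<Otimes>\<^sub>M M))" by simp
  qed
  also have "\<dots> = (\<integral>p. (\<Sum>a<k. \<Sum>b<k'. indicator (?S a b) (fst p) * (e a (snd p) $ i * e' b (snd p) $ j)) \<partial>(time_measure T \<Otimes>\<^sub>M M))"
  proof -
    have "integrable (time_measure T \<Otimes>\<^sub>M M) (\<lambda>p. indicator (?S a b) (fst p) * (e a (snd p) $ i * e' b (snd p) $ j))"
      if "a < k" "b < k'" for a b
    proof (rule integrable_pair_mult[OF psf])
      have "?S a b \<subseteq> {0..T}" using p[of a] that by auto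
      then have S: "?S a b \<in> sets (time_measure T)" by (auto simp: sets_restrict_space_iff)
      show "integrable (time_measure T) (indicator (?S a b) :: real \<Rightarrow> real)"
        by (rule integrable_real_indicator[OF S]) (metis T.emeasure_finite top.not_eq_extremum infinity_ennreal_def)
      show "integrable M (\<lambda>\<omega>. e a \<omega> $ i * e' b \<omega> $ j)"
        using that v v' by (intro square_integrable_mult) auto
    qed
    then show ?thesis by (rule integral_double_sum[symmetric])
  qed
  also have "\<dots> = ?R"
    by (intro Bochner_Integration.integral_cong refl)
       (simp only: elementary_process_component sum_product indicator_inter_arith ac_simps)
  finally show ?thesis .
qed

text \<open>The definition demands measurability of \<open>I\<close>; the finite second moment comes
  from one elementary integral at finite mean-square distance from it.\<close>

lemma is_ito_integral_square_integrable:
  assumes "is_ito_integral M F W t H I"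
  shows "square_integrable M (\<lambda>\<omega>. I \<omega> $ i)"
proof -
  from assms obtain k \<tau> e where e: "\<And>m. elementary_data M F t (k m) (\<tau> m) (e m)"
    and lim: "(\<lambda>m. second_moment M (\<lambda>\<omega>. I \<omega> - elementary_integral W (k m) (\<tau> m) (e m) \<omega>)) \<longlonglongrightarrow> 0"
    and [measurable]: "I \<in> borel_measurable M"
    unfolding is_ito_integral_def by blast
  have "\<forall>\<^sub>F m in sequentially. second_moment M (\<lambda>\<omega>. I \<omega> - elementary_integral W (k m) (\<tau> m) (e m) \<omega>) < \<infinity>"
    using order_tendstoD(2)[OF lim, of \<infinity>] by simp
  then obtain m where m: "second_moment M (\<lambda>\<omega>. I \<omega> - elementary_integral W (k m) (\<tau> m) (e m) \<omega>) < \<infinity>"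
    by (auto dest: eventually_happens)
  have "elementary_integral W (k m) (\<tau> m) (e m) \<in> borel_measurable M" by (rule elementary_data_measurable[OF e])
  then have "square_integrable M (\<lambda>\<omega>. (I \<omega> - elementary_integral W (k m) (\<tau> m) (e m) \<omega>) $ i)"
    using m by (intro square_integrable_component) auto
  from square_integrable_add[OF this elementary_integral_square_integrable[OF e[of m], of i]]
  show ?thesis by simp
qed

lemma second_moment_component_tendsto:
  assumes "(\<lambda>m. second_moment M (\<lambda>\<omega>. X \<omega> - Y m \<omega>)) \<longlonglongrightarrow> 0"
  shows "(\<lambda>m. \<integral>\<^sup>+\<omega>. ennreal ((X \<omega> $ i - Y m \<omega> $ i)\<^sup>2) \<partial>M) \<longlonglongrightarrow> 0"
proof (rule ennreal_tendsto_zero_mono[OF assms])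
  show "(\<integral>\<^sup>+\<omega>. ennreal ((X \<omega> $ i - Y m \<omega> $ i)\<^sup>2) \<partial>M) \<le> second_moment M (\<lambda>\<omega>. X \<omega> - Y m \<omega>)" for m
    unfolding second_moment_def using component_le_norm_cart[of _ i]
    by (intro nn_integral_mono ennreal_leI) (simp add: abs_le_square_iff[symmetric] vector_minus_component[symmetric] del: vector_minus_component)
qed

text \<open>An approximation on \<open>{0..t}\<close> remains one on a shorter interval. This brings
  two integrals with different horizons into one space in
  \<open>ito_integral_covariance\<close>.\<close>

lemma process_component_tendsto:
  assumes H: "(\<lambda>p. H (fst p) (snd p)) \<in> borel_measurable (time_measure s \<Otimes>\<^sub>M M)"
    and e: "\<And>m. elementary_data M F t (k m) (\<tau> m) (e m)" and st: "s \<le> t"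
    and lim: "(\<lambda>m. \<integral>\<^sup>+ \<omega>. (\<integral>\<^sup>+ s\<in>{0..t}.
            ennreal ((norm (H s \<omega> - elementary_process (k m) (\<tau> m) (e m) s \<omega>))\<^sup>2) \<partial>lborel) \<partial>M) \<longlonglongrightarrow> 0"
  shows "(\<lambda>m. \<integral>\<^sup>+p. ennreal ((H (fst p) (snd p) $ i - elementary_process (k m) (\<tau> m) (e m) (fst p) (snd p) $ i)\<^sup>2)
     \<partial>(time_measure s \<Otimes>\<^sub>M M)) \<longlonglongrightarrow> 0"
proof (rule ennreal_tendsto_zero_mono[OF lim])
  show "(\<integral>\<^sup>+p. ennreal ((H (fst p) (snd p) $ i - elementary_process (k m) (\<tau> m) (e m) (fst p) (snd p) $ i)\<^sup>2)
     \<partial>(time_measure s \<Otimes>\<^sub>M M)) \<le> (\<integral>\<^sup>+ \<omega>. (\<integral>\<^sup>+ s\<in>{0..t}.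
            ennreal ((norm (H s \<omega> - elementary_process (k m) (\<tau> m) (e m) s \<omega>))\<^sup>2) \<partial>lborel) \<partial>M)" for m
  proof -
    let ?E = "elementary_process (k m) (\<tau> m) (e m)"
    have [measurable]: "(\<lambda>p. H (fst p) (snd p) $ i) \<in> borel_measurable (time_measure s \<Otimes>\<^sub>M M)"
      using H by measurable
    have [measurable]: "(\<lambda>p. ?E (fst p) (snd p) $ i) \<in> borel_measurable (time_measure s \<Otimes>\<^sub>M M)"
      using elementary_process_square_integrable[OF e[of m]] by (simp add: square_integrable_def)
    have "(\<integral>\<^sup>+p. ennreal ((H (fst p) (snd p) $ i - ?E (fst p) (snd p) $ i)\<^sup>2) \<partial>(time_measure s \<Otimes>\<^sub>M M)) =
      (\<integral>\<^sup>+ \<omega>. (\<integral>\<^sup>+ r\<in>{0..s}. ennreal ((H r \<omega> $ i - ?E r \<omega> $ i)\<^sup>2) \<partial>lborel) \<partial>M)"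
      using nn_integral_time_pair[OF sigma_finite_measure_axioms, of "\<lambda>p. ennreal ((H (fst p) (snd p) $ i - ?E (fst p) (snd p) $ i)\<^sup>2)" s]
      by simp
    also have "\<dots> \<le> (\<integral>\<^sup>+ \<omega>. (\<integral>\<^sup>+ r\<in>{0..t}. ennreal ((norm (H r \<omega> - ?E r \<omega>))\<^sup>2) \<partial>lborel) \<partial>M)"
      using st component_le_norm_cart[of _ i]
      by (intro nn_integral_mono mult_mono ennreal_leI)
         (auto simp: abs_le_square_iff[symmetric] vector_minus_component[symmetric] indicator_def simp del: vector_minus_component)
    finally show ?thesis .
  qed
qed

text \<open>The polarised Ito isometry, by passing to the limit in
  \<open>elementary_integral_cross\<close>. The right-hand side does not involve \<open>t\<close>:
  in this form the martingale property of the integral enters later.\<close>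

lemma ito_integral_covariance:
  assumes I: "is_ito_integral M F W s H I" and I': "is_ito_integral M F W t H I'" and st: "s \<le> t"
  shows "expectation (\<lambda>\<omega>. I \<omega> $ i * I' \<omega> $ j) =
    (\<integral>p. H (fst p) (snd p) $ i * H (fst p) (snd p) $ j \<partial>(time_measure s \<Otimes>\<^sub>M M))"
proof -
  from I obtain k \<tau> e where e: "\<And>m. elementary_data M F s (k m) (\<tau> m) (e m)"
    and eH: "(\<lambda>m. \<integral>\<^sup>+ \<omega>. (\<integral>\<^sup>+ r\<in>{0..s}.
            ennreal ((norm (H r \<omega> - elementary_process (k m) (\<tau> m) (e m) r \<omega>))\<^sup>2) \<partial>lborel) \<partial>M) \<longlonglongrightarrow> 0"
    and eI: "(\<lambda>m. second_moment M (\<lambda>\<omega>. I \<omega> - elementary_integral W (k m) (\<tau> m) (e m) \<omega>)) \<longlonglongrightarrow> 0"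
    and HL: "L2_adapted M F s H"
    unfolding is_ito_integral_def by blast
  from I' obtain k' \<tau>' e' where e': "\<And>m. elementary_data M F t (k' m) (\<tau>' m) (e' m)"
    and eH': "(\<lambda>m. \<integral>\<^sup>+ \<omega>. (\<integral>\<^sup>+ r\<in>{0..t}.
            ennreal ((norm (H r \<omega> - elementary_process (k' m) (\<tau>' m) (e' m) r \<omega>))\<^sup>2) \<partial>lborel) \<partial>M) \<longlonglongrightarrow> 0"
    and eI': "(\<lambda>m. second_moment M (\<lambda>\<omega>. I' \<omega> - elementary_integral W (k' m) (\<tau>' m) (e' m) \<omega>)) \<longlonglongrightarrow> 0"
    unfolding is_ito_integral_def by blast
  have Hm: "(\<lambda>p. H (fst p) (snd p)) \<in> borel_measurable (time_measure s \<Otimes>\<^sub>M M)"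
    using HL by (simp add: L2_adapted_def case_prod_beta')
  have "(\<lambda>m. expectation (\<lambda>\<omega>. elementary_integral W (k m) (\<tau> m) (e m) \<omega> $ i *
      elementary_integral W (k' m) (\<tau>' m) (e' m) \<omega> $ j)) \<longlonglongrightarrow> expectation (\<lambda>\<omega>. I \<omega> $ i * I' \<omega> $ j)"
    by (intro square_integrable_inner_tendsto is_ito_integral_square_integrable[OF I]
        is_ito_integral_square_integrable[OF I'] elementary_integral_square_integrable[OF e]
        elementary_integral_square_integrable[OF e'] second_moment_component_tendsto eI eI')
  moreover have "(\<lambda>m. \<integral>p. elementary_process (k m) (\<tau> m) (e m) (fst p) (snd p) $ i *
      elementary_process (k' m) (\<tau>' m) (e' m) (fst p) (snd p) $ j \<partial>(time_measure s \<Otimes>\<^sub>M M)) \<longlonglongrightarrow>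
      (\<integral>p. H (fst p) (snd p) $ i * H (fst p) (snd p) $ j \<partial>(time_measure s \<Otimes>\<^sub>M M))"
    by (intro square_integrable_inner_tendsto L2_adapted_square_integrable[OF sigma_finite_measure_axioms HL]
        elementary_process_square_integrable[OF e] elementary_process_square_integrable[OF e']
        process_component_tendsto[OF Hm e order_refl eH] process_component_tendsto[OF Hm e' st eH'])
  ultimately show ?thesis
    unfolding elementary_integral_cross[OF e e'] using LIMSEQ_unique by blast
qed

text \<open>\<open>Z\<close> is known before every increment, so each summand of an elementary
  integral contributes zero; continuity of the inner product carries this to the limit.\<close>

lemma ito_integral_orthogonal_initial:
  assumes I: "is_ito_integral M F W t H I"
    and Z: "Z \<in> borel_measurable (F 0)" "square_integrable M Z"
  shows "expectation (\<lambda>\<omega>. Z \<omega> * I \<omega> $ j) = 0"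
proof -
  from I obtain k \<tau> e where e: "\<And>m. elementary_data M F t (k m) (\<tau> m) (e m)"
    and eI: "(\<lambda>m. second_moment M (\<lambda>\<omega>. I \<omega> - elementary_integral W (k m) (\<tau> m) (e m) \<omega>)) \<longlonglongrightarrow> 0"
    unfolding is_ito_integral_def by blast
  have "(\<lambda>m. expectation (\<lambda>\<omega>. Z \<omega> * elementary_integral W (k m) (\<tau> m) (e m) \<omega> $ j)) \<longlonglongrightarrow>
      expectation (\<lambda>\<omega>. Z \<omega> * I \<omega> $ j)"
    by (intro square_integrable_inner_tendsto is_ito_integral_square_integrable[OF I] Z
        elementary_integral_square_integrable[OF e] second_moment_component_tendsto eI) simp
  moreover have "expectation (\<lambda>\<omega>. Z \<omega> * elementary_integral W (k m) (\<tau> m) (e m) \<omega> $ j) = 0" for m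
  proof -
    let ?d = "\<lambda>l \<omega>. (Z \<omega> * e m l \<omega> $ j) * (W (\<tau> m (Suc l)) \<omega> - W (\<tau> m l) \<omega>)"
    have "integrable M (?d l) \<and> expectation (?d l) = 0" if "l < k m" for l
    proof -
      note p = elementary_data_partition[OF e that] and v = elementary_data_value[OF e that]
      have "Z \<in> borel_measurable (F (\<tau> m l))" using measurable_F_mono[OF _ p(1) Z(1)] by simp
      then have "(\<lambda>\<omega>. Z \<omega> * e m l \<omega> $ j) \<in> borel_measurable (F (\<tau> m l))"
        using v(1)[of j] by measurable
      moreover have "integrable M (\<lambda>\<omega>. Z \<omega> * e m l \<omega> $ j)"
        using Z v by (intro square_integrable_mult) auto
      ultimately show ?thesis
        using integrable_mult_increment[OF p(1,2)] expectation_mult_increment[OF p(1,2)] by blast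
    qed
    then have "expectation (\<lambda>\<omega>. \<Sum>l<k m. ?d l \<omega>) = 0"
      by (subst Bochner_Integration.integral_sum) auto
    then show ?thesis by (simp add: elementary_integral_component sum_distrib_left ac_simps)
  qed
  ultimately show ?thesis using LIMSEQ_unique[of "\<lambda>_. 0" 0] by simp
qed

end

section \<open>The second moment equation\<close>

lemma square_integrable_cong_AE:
  assumes "square_integrable M f" "g \<in> borel_measurable M" "AE x in M. g x = f x"
  shows "square_integrable M g"
proof -
  note [measurable] = assms(2) square_integrable_measurable[OF assms(1)]
  have "integrable M (\<lambda>x. (g x)\<^sup>2) = integrable M (\<lambda>x. (f x)\<^sup>2)"
    by (rule integrable_cong_AE) (use assms(3) in auto)
  then show ?thesis using assms by (simp add: square_integrable_def)
qed

lemma time_integral_has_integral: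
  fixes f :: "real \<Rightarrow> real"
  assumes "integrable (time_measure t) f"
  shows "(f has_integral (\<integral>r. f r \<partial>time_measure t)) {0..t}"
proof -
  have "set_integrable lborel {0..t} f"
    using assms by (simp add: integrable_restrict_space set_integrable_def)
  from set_borel_integral_eq_integral[OF this]
  have "f integrable_on {0..t}" "(\<integral>r. f r \<partial>time_measure t) = integral {0..t} f"
    by (simp_all add: integral_restrict_space set_lebesgue_integral_def)
  then show ?thesis by (simp add: has_integral_integral)
qed

lemma time_integral_continuous:
  fixes f :: "real \<Rightarrow> real"
  assumes "continuous_on {0..t} f"
  shows "integrable (time_measure t) f" "(\<integral>r. f r \<partial>time_measure t) = integral {0..t} f"
proof -
  have "set_integrable lborel {0..t} f" using assms by (rule borel_integrable_atLeastAtMost')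
  then show i: "integrable (time_measure t) f" by (simp add: integrable_restrict_space set_integrable_def)
  from time_integral_has_integral[OF this] show "(\<integral>r. f r \<partial>time_measure t) = integral {0..t} f"
    by (simp add: integral_unique)
qed

text \<open>Regularity is bootstrapped from the integral equation: integrability of \<open>L\<close>
  along \<open>f\<close> makes \<open>f\<close> continuous, hence the integrand is continuous and
  the fundamental theorem applies. The equation is assumed coordinatewise because that is how it
  arises from expectations.\<close>

lemma volterra_has_vector_derivative:
  fixes f :: "real \<Rightarrow> 'a::euclidean_space"
  assumes L: "bounded_linear L"
    and f: "\<And>t b. 0 \<le> t \<Longrightarrow> t \<le> T \<Longrightarrow> b \<in> Basis \<Longrightarrow>
      ((\<lambda>r. inner (L (f r)) b) has_integral inner (f t - f 0) b) {0..t}"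
    and t: "t \<in> {0..T}"
  shows "(f has_vector_derivative L (f t)) (at t within {0..T})"
proof -
  have I: "((\<lambda>r. L (f r)) has_integral (f t - f 0)) {0..t}" if "t \<in> {0..T}" for t
    using f[of t] that by (subst has_integral_componentwise_iff) auto
  have fe: "f t = f 0 + integral {0..t} (\<lambda>r. L (f r))" if "t \<in> {0..T}" for t
    using integral_unique[OF I[OF that]] by simp
  have "(\<lambda>r. L (f r)) integrable_on {0..T}" using I[of T] t by (auto simp: integrable_on_def)
  then have "continuous_on {0..T} (\<lambda>t. f 0 + integral {0..t} (\<lambda>r. L (f r)))"
    by (intro continuous_intros indefinite_integral_continuous_1)
  then have "continuous_on {0..T} f" by (rule continuous_on_eq) (simp add: fe[symmetric])
  then have "continuous_on {0..T} (\<lambda>r. L (f r))"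
    by (intro bounded_linear.continuous_on[OF L])
  from integral_has_vector_derivative[OF this t]
  have "((\<lambda>t. f 0 + integral {0..t} (\<lambda>r. L (f r))) has_vector_derivative 0 + L (f t)) (at t within {0..T})"
    by (intro has_vector_derivative_add has_vector_derivative_const)
  then have "((\<lambda>t. f 0 + integral {0..t} (\<lambda>r. L (f r))) has_vector_derivative L (f t)) (at t within {0..T})"
    by simp
  then show ?thesis
    by (rule has_vector_derivative_transform[OF t fe, rotated])
qed

text \<open>\<open>strong_solution\<close> with the filtration made a parameter: restricting a
  solution to an event can lead to an initial value that does not generate the filtration in
  use.\<close>

definition ito_solution ::
  "'w measure \<Rightarrow> (real \<Rightarrow> 'w measure) \<Rightarrow> (real \<Rightarrow> 'w \<Rightarrow> real) \<Rightarrow> ('w \<Rightarrow> real ^ 'n) \<Rightarrow>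
   (real ^ 'n \<Rightarrow> real ^ 'n) \<Rightarrow> (real ^ 'n \<Rightarrow> real ^ 'n) \<Rightarrow> (real \<Rightarrow> 'w \<Rightarrow> real ^ 'n) \<Rightarrow> bool" where
  "ito_solution M F W \<xi> b g x \<longleftrightarrow>
     (AE \<omega> in M. continuous_on {0..} (\<lambda>t. x t \<omega>)) \<and>
     (AE \<omega> in M. x 0 \<omega> = \<xi> \<omega>) \<and>
     (\<forall>t\<ge>0. L2_adapted M F t x \<and>
        is_ito_integral M F W t (\<lambda>s \<omega>. g (x s \<omega>))
          (\<lambda>\<omega>. x t \<omega> - \<xi> \<omega> - (LINT s:{0..t}|lborel. b (x s \<omega>))))"

lemma strong_solution_iff_ito_solution:
  "strong_solution M W \<xi> b g x \<longleftrightarrow> ito_solution M (augmented_filtration M W \<xi>) W \<xi> b g x"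
  by (simp add: strong_solution_def ito_solution_def)

definition lyapunov_map :: "real ^ 'n ^ 'n \<Rightarrow> real ^ 'n ^ 'n \<Rightarrow> real ^ 'n ^ 'n \<Rightarrow> real ^ 'n ^ 'n" where
  "lyapunov_map A C X = A ** X + X ** transpose A + C ** X ** transpose C"

lemma bounded_linear_lyapunov_map: "bounded_linear (lyapunov_map A C)"
proof -
  have "linear (lyapunov_map A C)"
    by (rule linearI)
       (simp_all add: lyapunov_map_def matrix_add_ldistrib matrix_matrix_mult_def vec_eq_iff
         sum.distrib sum_distrib_left sum_distrib_right algebra_simps)
  then show ?thesis by (simp add: linear_conv_bounded_linear)
qed

section \<open>The linear stochastic equation and its matrix of second moments\<close>

locale linear_sde = brownian_filtration M F W
  for M :: "'w measure" and F :: "real \<Rightarrow> 'w measure" and W :: "real \<Rightarrow> 'w \<Rightarrow> real" +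
  fixes \<xi> :: "'w \<Rightarrow> real ^ 'n" and A C :: "real ^ 'n ^ 'n" and x :: "real \<Rightarrow> 'w \<Rightarrow> real ^ 'n"
  assumes initial_adapted: "\<xi> \<in> borel_measurable (F 0)"
    and initial_second_moment: "second_moment M \<xi> < \<infinity>"
    and solution: "ito_solution M F W \<xi> (\<lambda>y. A *v y) (\<lambda>y. C *v y) x"
begin

lemma finite_M: "finite_measure M" by (rule finite_measure_axioms)

lemma sigma_finite_M: "sigma_finite_measure M" by (rule sigma_finite_measure_axioms)

definition ito_part :: "real \<Rightarrow> 'w \<Rightarrow> real ^ 'n" where
  "ito_part t \<omega> = x t \<omega> - \<xi> \<omega> - (LINT s:{0..t}|lborel. A *v x s \<omega>)"

text \<open>Taken coordinatewise over the restricted time measure, to match the Fubini statements;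
  along continuous paths it agrees with the coordinates of the vector integral inside
  \<open>ito_part\<close>.\<close>

definition drift :: "'n \<Rightarrow> real \<Rightarrow> 'w \<Rightarrow> real" where
  "drift i t \<omega> = (\<integral>r. (A *v x r \<omega>) $ i \<partial>time_measure t)"

text \<open>The part of the solution with absolutely continuous paths (almost surely), whose
  products obey the classical product rule.\<close>

definition ac_part :: "'n \<Rightarrow> real \<Rightarrow> 'w \<Rightarrow> real" where
  "ac_part i t \<omega> = \<xi> \<omega> $ i + drift i t \<omega>"

lemma paths_continuous: "AE \<omega> in M. continuous_on {0..} (\<lambda>t. x t \<omega>)"
  using solution by (simp add: ito_solution_def)

lemma x_L2: "0 \<le> t \<Longrightarrow> L2_adapted M F t x"
  using solution by (simp add: ito_solution_def)

lemma ito_part_integral: "0 \<le> t \<Longrightarrow> is_ito_integral M F W t (\<lambda>s \<omega>. C *v x s \<omega>) (ito_part t)"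
  using solution by (simp add: ito_solution_def ito_part_def[abs_def])

lemma ito_part_square_integrable: "0 \<le> t \<Longrightarrow> square_integrable M (\<lambda>\<omega>. ito_part t \<omega> $ i)"
  by (rule is_ito_integral_square_integrable[OF ito_part_integral])

lemma initial_measurable [measurable]: "\<xi> \<in> borel_measurable M"
  using measurable_F_M[OF _ initial_adapted] by simp

lemma initial_square_integrable: "square_integrable M (\<lambda>\<omega>. \<xi> \<omega> $ i)"
  using initial_second_moment by (intro square_integrable_component initial_measurable)

lemma x_measurable: "0 \<le> t \<Longrightarrow> x t \<in> borel_measurable M"
  using x_L2[of t] measurable_F_M[of t "x t" borel] by (auto simp: L2_adapted_def)

lemma x_process_square_integrable:
  "0 \<le> t \<Longrightarrow> square_integrable (time_measure t \<Otimes>\<^sub>M M) (\<lambda>p. x (fst p) (snd p) $ i)"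
  by (rule L2_adapted_square_integrable[OF sigma_finite_M x_L2])

lemma Ax_process_square_integrable:
  "0 \<le> t \<Longrightarrow> square_integrable (time_measure t \<Otimes>\<^sub>M M) (\<lambda>p. (A *v x (fst p) (snd p)) $ i)"
  unfolding matrix_vector_mult_def vec_lambda_beta
  by (intro square_integrable_sum square_integrable_cmult x_process_square_integrable)

lemma drift_square_integrable: "0 \<le> t \<Longrightarrow> square_integrable M (drift i t)"
  using square_integrable_section_integral[OF finite_time_measure finite_M Ax_process_square_integrable, of t i]
  by (simp add: drift_def[abs_def])

lemma ac_part_square_integrable: "0 \<le> t \<Longrightarrow> square_integrable M (ac_part i t)"
  using square_integrable_add[OF initial_square_integrable drift_square_integrable, of t i i]
  by (simp add: ac_part_def[abs_def])

text \<open>Integrating a vector function commutes with taking coordinates when the function is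
  integrable; continuity of almost every path supplies this.\<close>

lemma x_decomposition:
  assumes t: "0 \<le> t"
  shows "AE \<omega> in M. x t \<omega> $ i = ac_part i t \<omega> + ito_part t \<omega> $ i"
  using paths_continuous
proof eventually_elim
  case (elim \<omega>)
  have "continuous_on {0..t} (\<lambda>r. A *v x r \<omega>)"
    using continuous_on_subset[OF elim, of "{0..t}"]
    by (intro bounded_linear.continuous_on[OF matrix_vector_mul_bounded_linear]) auto
  then have "integrable lborel (\<lambda>r. indicator {0..t} r *\<^sub>R (A *v x r \<omega>))"
    using borel_integrable_atLeastAtMost'[of 0 t "\<lambda>r. A *v x r \<omega>"] by (simp add: set_integrable_def)
  from integral_bounded_linear[OF bounded_linear_vec_nth this, of i]
  have "(LINT s:{0..t}|lborel. A *v x s \<omega>) $ i = drift i t \<omega>"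
    by (simp add: drift_def integral_restrict_space set_lebesgue_integral_def)
  then show ?case by (simp add: ac_part_def ito_part_def)
qed

lemma x_square_integrable:
  assumes t: "0 \<le> t"
  shows "square_integrable M (\<lambda>\<omega>. x t \<omega> $ i)"
proof (rule square_integrable_cong_AE)
  show "square_integrable M (\<lambda>\<omega>. ac_part i t \<omega> + ito_part t \<omega> $ i)"
    by (intro square_integrable_add ac_part_square_integrable ito_part_square_integrable t)
qed (use x_measurable[OF t] x_decomposition[OF t] in measurable)

lemma matrix_x_square_integrable:
  assumes t: "0 \<le> t"
  shows "square_integrable M (\<lambda>\<omega>. (B *v x t \<omega>) $ i)"
  unfolding matrix_vector_mult_def vec_lambda_beta
  by (intro square_integrable_sum square_integrable_cmult x_square_integrable t)

lemma expectation_mult_matrix: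
  assumes t: "0 \<le> t" and Z: "square_integrable M Z"
  shows "expectation (\<lambda>\<omega>. Z \<omega> * (B *v x t \<omega>) $ i) = (\<Sum>k\<in>UNIV. B $ i $ k * expectation (\<lambda>\<omega>. Z \<omega> * x t \<omega> $ k))"
proof -
  have "(\<lambda>\<omega>. Z \<omega> * (B *v x t \<omega>) $ i) = (\<lambda>\<omega>. \<Sum>k\<in>UNIV. B $ i $ k * (Z \<omega> * x t \<omega> $ k))"
    by (auto simp: matrix_vector_mult_def sum_distrib_left algebra_simps)
  then show ?thesis
    using square_integrable_mult[OF Z x_square_integrable[OF t]]
    by (simp add: Bochner_Integration.integral_sum)
qed

lemma integrable_time_drift:
  "0 \<le> t \<Longrightarrow> square_integrable M Z \<Longrightarrow> integrable (time_measure t) (\<lambda>r. expectation (\<lambda>\<omega>. Z \<omega> * (A *v x r \<omega>) $ i))"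
  using integrable_section_inner[OF finite_time_measure finite_M Ax_process_square_integrable] by simp

lemma expectation_mult_drift:
  "0 \<le> t \<Longrightarrow> square_integrable M Z \<Longrightarrow>
    expectation (\<lambda>\<omega>. Z \<omega> * drift i t \<omega>) = (\<integral>r. expectation (\<lambda>\<omega>. Z \<omega> * (A *v x r \<omega>) $ i) \<partial>time_measure t)"
  using integral_section_inner[OF finite_time_measure finite_M Ax_process_square_integrable] by (simp add: drift_def)

lemma expectation_mult_x:
  assumes t: "0 \<le> t" and Z: "square_integrable M Z"
  shows "expectation (\<lambda>\<omega>. Z \<omega> * x t \<omega> $ i) = expectation (\<lambda>\<omega>. Z \<omega> * \<xi> \<omega> $ i) +
    (\<integral>r. expectation (\<lambda>\<omega>. Z \<omega> * (A *v x r \<omega>) $ i) \<partial>time_measure t) +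
    expectation (\<lambda>\<omega>. Z \<omega> * ito_part t \<omega> $ i)"
proof -
  note [measurable] = square_integrable_measurable[OF Z] x_measurable[OF t]
    square_integrable_measurable[OF ac_part_square_integrable[OF t]]
    square_integrable_measurable[OF ito_part_square_integrable[OF t]]
    square_integrable_measurable[OF drift_square_integrable[OF t]]
  note i = square_integrable_mult[OF Z initial_square_integrable, of i]
    square_integrable_mult[OF Z drift_square_integrable[OF t], of i]
    square_integrable_mult[OF Z ito_part_square_integrable[OF t], of i]
  have "expectation (\<lambda>\<omega>. Z \<omega> * x t \<omega> $ i) =
      expectation (\<lambda>\<omega>. Z \<omega> * \<xi> \<omega> $ i + Z \<omega> * drift i t \<omega> + Z \<omega> * ito_part t \<omega> $ i)"
  proof (rule integral_cong_AE)
    show "AE \<omega> in M. Z \<omega> * x t \<omega> $ i = Z \<omega> * \<xi> \<omega> $ i + Z \<omega> * drift i t \<omega> + Z \<omega> * ito_part t \<omega> $ i"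
      using x_decomposition[OF t, of i] by eventually_elim (simp add: ac_part_def algebra_simps)
  qed measurable
  also have "\<dots> = expectation (\<lambda>\<omega>. Z \<omega> * \<xi> \<omega> $ i) + expectation (\<lambda>\<omega>. Z \<omega> * drift i t \<omega>) +
      expectation (\<lambda>\<omega>. Z \<omega> * ito_part t \<omega> $ i)"
    using i by simp
  finally show ?thesis by (simp add: expectation_mult_drift[OF t Z])
qed

text \<open>The vector of expectations of \<open>Z\<close> times \<open>x\<close> solves the
  homogeneous drift equation, since the contributions of the initial value and of the Ito part
  vanish by assumption. It starts at zero, so uniqueness keeps it at zero.\<close>

lemma expectation_mult_x_zero:
  assumes Z: "square_integrable M Z"
    and Z0: "\<And>i. expectation (\<lambda>\<omega>. Z \<omega> * \<xi> \<omega> $ i) = 0"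
    and ZI: "\<And>i r. 0 \<le> r \<Longrightarrow> r \<le> T \<Longrightarrow> expectation (\<lambda>\<omega>. Z \<omega> * ito_part r \<omega> $ i) = 0"
    and T: "0 \<le> T"
  shows "expectation (\<lambda>\<omega>. Z \<omega> * x T \<omega> $ i) = 0"
proof -
  define m where "m r = (\<chi> i. expectation (\<lambda>\<omega>. Z \<omega> * x r \<omega> $ i))" for r
  have mI: "((\<lambda>r. (A *v m r) $ i) has_integral m t $ i) {0..t}" if "0 \<le> t" "t \<le> T" for t i
  proof -
    have Am: "(A *v m r) $ i = expectation (\<lambda>\<omega>. Z \<omega> * (A *v x r \<omega>) $ i)" if "0 \<le> r" for r
      using expectation_mult_matrix[OF that Z, of A i] by (simp add: matrix_vector_mult_def m_def)
    have "m t $ i = (\<integral>r. expectation (\<lambda>\<omega>. Z \<omega> * (A *v x r \<omega>) $ i) \<partial>time_measure t)"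
      using expectation_mult_x[OF that(1) Z] Z0 ZI that by (simp add: m_def)
    then have "((\<lambda>r. expectation (\<lambda>\<omega>. Z \<omega> * (A *v x r \<omega>) $ i)) has_integral m t $ i) {0..t}"
      using time_integral_has_integral[OF integrable_time_drift[OF that(1) Z]] by simp
    then show ?thesis by (rule has_integral_eq[rotated]) (simp add: Am)
  qed
  \<comment> \<open>The integral equation over the degenerate interval from 0 to 0.\<close>
  have m0: "m 0 = 0"
    using integral_unique[OF mI[of 0]] T by (auto simp: vec_eq_iff)
  have "m T = 0"
  proof (rule linear_ode_unique[of "\<lambda>v. A *v v" 0 T m "\<lambda>_. 0"])
    show "(m has_vector_derivative A *v m r) (at r within {0..T})" if "r \<in> {0..T}" for r
    proof (rule volterra_has_vector_derivative[OF matrix_vector_mul_bounded_linear _ that])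
      fix t b assume "0 \<le> t" "t \<le> T" and "b \<in> (Basis :: (real^'n) set)"
      then obtain i where "b = axis i 1" by (auto simp: Basis_vec_def)
      then show "((\<lambda>r. inner (A *v m r) b) has_integral inner (m t - m 0) b) {0..t}"
        using mI[OF \<open>0 \<le> t\<close> \<open>t \<le> T\<close>, of i] by (simp add: inner_axis m0)
    qed
  qed (use T m0 in \<open>auto intro!: matrix_vector_mul_bounded_linear\<close>)
  then show ?thesis by (simp add: m_def vec_eq_iff)
qed

text \<open>Take for \<open>Z\<close> the increment of \<open>ito_part\<close> from \<open>s\<close>
  to \<open>t\<close>. It is orthogonal to the initial value and, because the covariance with an
  earlier \<open>ito_part r\<close> depends on \<open>r\<close> only, to every
  \<open>ito_part r\<close> with r <= s. Then \<open>expectation_mult_x_zero\<close> transfers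
  orthogonality to \<open>x s\<close>.\<close>

lemma ito_part_martingale:
  assumes s: "0 \<le> s" "s \<le> t"
  shows "expectation (\<lambda>\<omega>. ito_part t \<omega> $ j * x s \<omega> $ i) = expectation (\<lambda>\<omega>. ito_part s \<omega> $ j * x s \<omega> $ i)"
proof -
  have t: "0 \<le> t" using s by simp
  note sq = ito_part_square_integrable[OF s(1), of j] ito_part_square_integrable[OF t, of j]
  define Z where "Z \<omega> = ito_part t \<omega> $ j - ito_part s \<omega> $ j" for \<omega>
  have Z: "square_integrable M Z" unfolding Z_def by (intro square_integrable_diff sq)
  have E: "expectation (\<lambda>\<omega>. Z \<omega> * Y \<omega>) =
      expectation (\<lambda>\<omega>. ito_part t \<omega> $ j * Y \<omega>) - expectation (\<lambda>\<omega>. ito_part s \<omega> $ j * Y \<omega>)"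
    if "square_integrable M Y" for Y
    using square_integrable_mult[OF sq(1) that] square_integrable_mult[OF sq(2) that]
    by (simp add: Z_def left_diff_distrib)
  have "expectation (\<lambda>\<omega>. Z \<omega> * x s \<omega> $ i) = 0"
  proof (rule expectation_mult_x_zero[OF Z _ _ s(1)])
    fix i
    have "(\<lambda>\<omega>. \<xi> \<omega> $ i) \<in> borel_measurable (F 0)" using initial_adapted by measurable
    then show "expectation (\<lambda>\<omega>. Z \<omega> * \<xi> \<omega> $ i) = 0"
      using ito_integral_orthogonal_initial[OF ito_part_integral, of _ "\<lambda>\<omega>. \<xi> \<omega> $ i" j] s t
      by (simp add: E initial_square_integrable mult.commute)
    fix r assume r: "0 \<le> r" "r \<le> s"
    show "expectation (\<lambda>\<omega>. Z \<omega> * ito_part r \<omega> $ i) = 0"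
      using ito_integral_covariance[OF ito_part_integral[OF r(1)] ito_part_integral[OF t], of i j]
        ito_integral_covariance[OF ito_part_integral[OF r(1)] ito_part_integral[OF s(1)], of i j] r s
      by (simp add: E ito_part_square_integrable mult.commute)
  qed
  then show ?thesis using E[OF x_square_integrable[OF s(1)]] by simp
qed

lemma drift_continuous_path:
  assumes \<omega>: "continuous_on {0..} (\<lambda>t. x t \<omega>)" and r: "r \<in> {0..t}"
  shows "continuous_on {0..t} (\<lambda>r. (A *v x r \<omega>) $ i)"
    and "drift i r \<omega> = integral {0..r} (\<lambda>r. (A *v x r \<omega>) $ i)"
    and "((\<lambda>r. drift i r \<omega>) has_vector_derivative (A *v x r \<omega>) $ i) (at r within {0..t})"
    and "\<bar>drift i r \<omega>\<bar> \<le> (\<integral>s. \<bar>(A *v x s \<omega>) $ i\<bar> \<partial>time_measure t)"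
proof -
  have c: "continuous_on {0..s} (\<lambda>r. (A *v x r \<omega>) $ i)" for s
    using continuous_on_subset[OF \<omega>, of "{0..s}"]
    by (intro continuous_intros bounded_linear.continuous_on[OF matrix_vector_mul_bounded_linear]) auto
  then show "continuous_on {0..t} (\<lambda>r. (A *v x r \<omega>) $ i)" .
  have d: "drift i r \<omega> = integral {0..r} (\<lambda>r. (A *v x r \<omega>) $ i)" for r
    unfolding drift_def by (rule time_integral_continuous[OF c])
  then show "drift i r \<omega> = integral {0..r} (\<lambda>r. (A *v x r \<omega>) $ i)" .
  show "((\<lambda>r. drift i r \<omega>) has_vector_derivative (A *v x r \<omega>) $ i) (at r within {0..t})"
    unfolding d by (rule integral_has_vector_derivative[OF c r])
  have "continuous_on {0..s} (\<lambda>s. \<bar>(A *v x s \<omega>) $ i\<bar>)" for s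
    by (intro continuous_intros c)
  note ca = this time_integral_continuous[OF this]
  have "\<bar>drift i r \<omega>\<bar> \<le> integral {0..r} (\<lambda>s. \<bar>(A *v x s \<omega>) $ i\<bar>)"
    unfolding d real_norm_def[symmetric] using ca(1) c
    by (intro integral_norm_bound_integral integrable_continuous_interval) auto
  also have "\<dots> \<le> integral {0..t} (\<lambda>s. \<bar>(A *v x s \<omega>) $ i\<bar>)"
    using r ca(1) by (intro integral_subset_le integrable_continuous_interval) auto
  finally show "\<bar>drift i r \<omega>\<bar> \<le> (\<integral>s. \<bar>(A *v x s \<omega>) $ i\<bar> \<partial>time_measure t)"
    by (simp add: ca(3))
qed

text \<open>Both measurability and domination need an integral whose domain does not move with time:
  the former uses a cut-off under the integral over \<open>{0..t}\<close>, the latter the integral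
  of the absolute value over all of \<open>{0..t}\<close>.\<close>

lemma ac_part_process_square_integrable:
  assumes t: "0 \<le> t"
  shows "square_integrable (time_measure t \<Otimes>\<^sub>M M) (\<lambda>p. ac_part i (fst p) (snd p))"
proof -
  interpret T: finite_measure "time_measure t" by (rule finite_time_measure)
  note [measurable] = square_integrable_measurable[OF Ax_process_square_integrable[OF t]]
  have dm: "(\<lambda>p. drift i (fst p) (snd p)) \<in> borel_measurable (time_measure t \<Otimes>\<^sub>M M)"
  proof -
    have [measurable]: "(\<lambda>q. (A *v x (snd q) (snd (fst q))) $ i) \<in>
        borel_measurable ((time_measure t \<Otimes>\<^sub>M M) \<Otimes>\<^sub>M time_measure t)"
      using measurable_compose[OF measurable_Pair[OF measurable_snd measurable_compose[OF measurable_fst measurable_snd]]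
         square_integrable_measurable[OF Ax_process_square_integrable[OF t, of i]]]
      by simp
    have [measurable]: "snd \<in> borel_measurable ((time_measure t \<Otimes>\<^sub>M M) \<Otimes>\<^sub>M time_measure t)"
      by (rule measurable_compose[OF measurable_snd id_measurable_time])
    have [measurable]: "(\<lambda>q. fst (fst q)) \<in> borel_measurable ((time_measure t \<Otimes>\<^sub>M M) \<Otimes>\<^sub>M time_measure t)"
      by (rule measurable_compose[OF measurable_compose[OF measurable_fst measurable_fst] id_measurable_time])
    have "(\<lambda>p. \<integral>s. (if s \<le> fst p then (A *v x s (snd p)) $ i else 0) \<partial>time_measure t)
        \<in> borel_measurable (time_measure t \<Otimes>\<^sub>M M)"
      by (rule T.borel_measurable_lebesgue_integral) (simp add: case_prod_beta')
    then show ?thesis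
    proof (subst measurable_cong)
      fix p assume "p \<in> space (time_measure t \<Otimes>\<^sub>M M)"
      then have "fst p \<in> {0..t}" by (auto simp: space_pair_measure space_time_measure)
      then show "drift i (fst p) (snd p) = (\<integral>s. (if s \<le> fst p then (A *v x s (snd p)) $ i else 0) \<partial>time_measure t)"
        by (auto simp: drift_def integral_restrict_space indicator_def intro!: Bochner_Integration.integral_cong)
    qed
  qed
  have B: "square_integrable M (\<lambda>\<omega>. \<integral>s. \<bar>(A *v x s \<omega>) $ i\<bar> \<partial>time_measure t)" (is "square_integrable M ?B")
  proof -
    have "square_integrable (time_measure t \<Otimes>\<^sub>M M) (\<lambda>p. \<bar>(A *v x (fst p) (snd p)) $ i\<bar>)"
      by (rule square_integrable_dominated[OF _ Ax_process_square_integrable[OF t, of i]]) auto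
    from square_integrable_section_integral[OF finite_time_measure finite_M this] show ?thesis by simp
  qed
  have "square_integrable (time_measure t \<Otimes>\<^sub>M M) (\<lambda>p. drift i (fst p) (snd p))"
  proof (rule square_integrableI_nn_integral[OF dm])
    have "(\<integral>\<^sup>+p. ennreal ((drift i (fst p) (snd p))\<^sup>2) \<partial>(time_measure t \<Otimes>\<^sub>M M)) =
      (\<integral>\<^sup>+ \<omega>. (\<integral>\<^sup>+ r\<in>{0..t}. ennreal ((drift i r \<omega>)\<^sup>2) \<partial>lborel) \<partial>M)"
      using nn_integral_time_pair[OF sigma_finite_M, of "\<lambda>p. ennreal ((drift i (fst p) (snd p))\<^sup>2)"] dm by simp
    also have "\<dots> \<le> (\<integral>\<^sup>+ \<omega>. (\<integral>\<^sup>+ r\<in>{0..t}. ennreal ((?B \<omega>)\<^sup>2) \<partial>lborel) \<partial>M)"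
    proof (rule nn_integral_mono_AE)
      show "AE \<omega> in M. (\<integral>\<^sup>+ r\<in>{0..t}. ennreal ((drift i r \<omega>)\<^sup>2) \<partial>lborel) \<le> (\<integral>\<^sup>+ r\<in>{0..t}. ennreal ((?B \<omega>)\<^sup>2) \<partial>lborel)"
        using paths_continuous
      proof eventually_elim
        case (elim \<omega>)
        have "(drift i r \<omega>)\<^sup>2 \<le> (?B \<omega>)\<^sup>2" if "r \<in> {0..t}" for r
          using drift_continuous_path(4)[OF elim that, of i] by (metis abs_le_square_iff abs_of_nonneg abs_ge_zero order_trans)
        then show ?case
          by (intro nn_integral_mono) (auto simp: indicator_def intro: ennreal_leI)
      qed
    qed
    also have "\<dots> = (\<integral>\<^sup>+p. ennreal ((?B (snd p))\<^sup>2) \<partial>(time_measure t \<Otimes>\<^sub>M M))"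
      using nn_integral_time_pair[OF sigma_finite_M, of "\<lambda>p. ennreal ((?B (snd p))\<^sup>2)"]
        square_integrable_measurable[OF square_integrable_snd[OF finite_time_measure sigma_finite_M B]] by simp
    also have "\<dots> < \<infinity>"
      using square_integrable_snd[OF finite_time_measure[of t] sigma_finite_M B]
      by (simp add: square_integrable_def integrable_iff_bounded)
    finally show "(\<integral>\<^sup>+p. ennreal ((drift i (fst p) (snd p))\<^sup>2) \<partial>(time_measure t \<Otimes>\<^sub>M M)) < \<infinity>" .
  qed
  from square_integrable_add[OF square_integrable_snd[OF finite_time_measure sigma_finite_M initial_square_integrable] this]
  show ?thesis by (simp add: ac_part_def)
qed

text \<open>The product rule along each continuous path, followed by Fubini; square integrability of
  \<open>ac_part\<close> on time times sample space justifies the exchange.\<close>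

lemma ac_part_product:
  assumes t: "0 \<le> t"
  shows "expectation (\<lambda>\<omega>. ac_part i t \<omega> * ac_part j t \<omega>) = expectation (\<lambda>\<omega>. \<xi> \<omega> $ i * \<xi> \<omega> $ j) +
      (\<integral>r. expectation (\<lambda>\<omega>. (A *v x r \<omega>) $ i * ac_part j r \<omega> + ac_part i r \<omega> * (A *v x r \<omega>) $ j) \<partial>time_measure t)"
    (is "?lhs = ?e0 + (\<integral>r. ?h r \<partial>time_measure t)")
  and "integrable (time_measure t)
    (\<lambda>r. expectation (\<lambda>\<omega>. (A *v x r \<omega>) $ i * ac_part j r \<omega> + ac_part i r \<omega> * (A *v x r \<omega>) $ j))"
proof -
  interpret T: finite_measure "time_measure t" by (rule finite_time_measure)
  interpret P: pair_sigma_finite "time_measure t" M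
    using sigma_finite_M T.sigma_finite_measure_axioms by (simp add: pair_sigma_finite_def)
  let ?g = "\<lambda>r \<omega>. (A *v x r \<omega>) $ i * ac_part j r \<omega> + ac_part i r \<omega> * (A *v x r \<omega>) $ j"
  have int: "integrable (time_measure t \<Otimes>\<^sub>M M) (\<lambda>(r, \<omega>). ?g r \<omega>)"
    unfolding case_prod_beta'
    by (intro Bochner_Integration.integrable_add square_integrable_mult Ax_process_square_integrable
        ac_part_process_square_integrable t)
  show "integrable (time_measure t) (\<lambda>r. ?h r)" using P.integrable_fst[OF int] .
  have path: "AE \<omega> in M. ac_part i t \<omega> * ac_part j t \<omega> - \<xi> \<omega> $ i * \<xi> \<omega> $ j = (\<integral>r. ?g r \<omega> \<partial>time_measure t)"
    using paths_continuous
  proof eventually_elim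
    case (elim \<omega>)
    note d = drift_continuous_path[OF elim]
    have c: "continuous_on {0..t} (\<lambda>r. ac_part k r \<omega>)" for k
      unfolding ac_part_def continuous_on_eq_continuous_within
      using has_vector_derivative_continuous[OF d(3)] by (auto intro!: continuous_intros)
    have "continuous_on {0..t} (\<lambda>r. ?g r \<omega>)"
      using t by (intro continuous_intros c d(1)[of 0]) auto
    note ti = time_integral_continuous(2)[OF this]
    have der: "((\<lambda>r. ac_part k r \<omega>) has_vector_derivative (A *v x r \<omega>) $ k) (at r within {0..t})"
      if "r \<in> {0..t}" for r k
      unfolding ac_part_def using has_vector_derivative_add[OF has_vector_derivative_const d(3)[OF that]] by simp
    have "((\<lambda>r. ?g r \<omega>) has_integral (ac_part i t \<omega> * ac_part j t \<omega> - ac_part i 0 \<omega> * ac_part j 0 \<omega>)) {0..t}"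
    proof (rule fundamental_theorem_of_calculus[OF t])
      fix r assume "r \<in> {0..t}"
      from has_vector_derivative_mult[OF der[OF this] der[OF this], of i j]
      show "((\<lambda>r. ac_part i r \<omega> * ac_part j r \<omega>) has_vector_derivative ?g r \<omega>) (at r within {0..t})"
        by (simp add: add.commute)
    qed
    moreover have "ac_part k 0 \<omega> = \<xi> \<omega> $ k" for k
      using d(2)[of 0 0 k] by (simp add: ac_part_def)
    ultimately show ?case unfolding ti by (simp add: integral_unique)
  qed
  note sq = square_integrable_mult[OF ac_part_square_integrable[OF t] ac_part_square_integrable[OF t], of i j]
    square_integrable_mult[OF initial_square_integrable initial_square_integrable, of i j]
  have "?lhs - ?e0 = expectation (\<lambda>\<omega>. ac_part i t \<omega> * ac_part j t \<omega> - \<xi> \<omega> $ i * \<xi> \<omega> $ j)"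
    using sq by simp
  also have "\<dots> = expectation (\<lambda>\<omega>. \<integral>r. ?g r \<omega> \<partial>time_measure t)"
    using path borel_measurable_integrable[OF P.integrable_snd[OF int]] sq
    by (intro integral_cong_AE) auto
  also have "\<dots> = (\<integral>r. ?h r \<partial>time_measure t)" by (rule P.Fubini_integral[OF int])
  finally show "?lhs = ?e0 + (\<integral>r. ?h r \<partial>time_measure t)" by simp
qed

definition second_moments :: "real \<Rightarrow> real ^ 'n ^ 'n" where
  "second_moments t = (\<chi> i j. expectation (\<lambda>\<omega>. x t \<omega> $ i * x t \<omega> $ j))"

text \<open>Kept as one expectation rather than as an entry of \<open>lyapunov_map\<close>, so that
  a pointwise inequality for the integrand can be integrated in
  \<open>lyapunov_second_moments_tendsto_zero\<close>.\<close>

definition second_moments_rate :: "real \<Rightarrow> 'n \<Rightarrow> 'n \<Rightarrow> real" where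
  "second_moments_rate t i j = expectation (\<lambda>\<omega>. (A *v x t \<omega>) $ i * x t \<omega> $ j + x t \<omega> $ i * (A *v x t \<omega>) $ j +
    (C *v x t \<omega>) $ i * (C *v x t \<omega>) $ j)"

lemma expectation_bilinear_x:
  assumes t: "0 \<le> t"
  shows "expectation (\<lambda>\<omega>. (B *v x t \<omega>) $ i * (E *v x t \<omega>) $ j) = (B ** second_moments t ** transpose E) $ i $ j"
proof -
  have "expectation (\<lambda>\<omega>. (B *v x t \<omega>) $ i * (E *v x t \<omega>) $ j) =
      (\<Sum>l\<in>UNIV. E $ j $ l * expectation (\<lambda>\<omega>. x t \<omega> $ l * (B *v x t \<omega>) $ i))"
    by (subst expectation_mult_matrix[OF t matrix_x_square_integrable[OF t]]) (simp add: mult.commute)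
  also have "\<dots> = (\<Sum>l\<in>UNIV. E $ j $ l * (\<Sum>k\<in>UNIV. B $ i $ k * expectation (\<lambda>\<omega>. x t \<omega> $ k * x t \<omega> $ l)))"
    by (simp add: expectation_mult_matrix[OF t x_square_integrable[OF t]] mult.commute)
  also have "\<dots> = (B ** second_moments t ** transpose E) $ i $ j"
    by (simp add: matrix_matrix_mult_def transpose_def second_moments_def mult.commute)
  finally show ?thesis .
qed

lemma second_moments_rate_eq:
  assumes t: "0 \<le> t"
  shows "second_moments_rate t i j = lyapunov_map A C (second_moments t) $ i $ j"
proof -
  note sq = square_integrable_mult[OF matrix_x_square_integrable[OF t] matrix_x_square_integrable[OF t]]
  have "second_moments_rate t i j = expectation (\<lambda>\<omega>. (A *v x t \<omega>) $ i * (mat 1 *v x t \<omega>) $ j) +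
      expectation (\<lambda>\<omega>. (mat 1 *v x t \<omega>) $ i * (A *v x t \<omega>) $ j) +
      expectation (\<lambda>\<omega>. (C *v x t \<omega>) $ i * (C *v x t \<omega>) $ j)"
    using sq[of A i "mat 1" j] sq[of "mat 1" i A j] sq[of C i C j] by (simp add: second_moments_rate_def)
  then show ?thesis
    unfolding expectation_bilinear_x[OF t] by (simp add: lyapunov_map_def transpose_mat)
qed

text \<open>Expanding a product of coordinates of \<open>ac_part + ito_part\<close> gives four
  terms: the pathwise product rule treats the first, the isometry the last, and the martingale
  identity the two mixed ones. Under the time integral the pieces reassemble into
  \<open>x\<close>.\<close>

lemma second_moments_integral:
  assumes t: "0 \<le> t"
  shows "((\<lambda>r. second_moments_rate r i j) has_integral (second_moments t - second_moments 0) $ i $ j) {0..t}"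
proof -
  interpret T: finite_measure "time_measure t" by (rule finite_time_measure)
  interpret P: pair_sigma_finite "time_measure t" M
    using sigma_finite_M T.sigma_finite_measure_axioms by (simp add: pair_sigma_finite_def)
  let ?h = "\<lambda>r. expectation (\<lambda>\<omega>. (A *v x r \<omega>) $ i * ac_part j r \<omega> + ac_part i r \<omega> * (A *v x r \<omega>) $ j)"
  let ?k = "\<lambda>i j r. expectation (\<lambda>\<omega>. ito_part t \<omega> $ j * (A *v x r \<omega>) $ i)"
  let ?c = "\<lambda>r. expectation (\<lambda>\<omega>. (C *v x r \<omega>) $ i * (C *v x r \<omega>) $ j)"
  note sqI = ito_part_square_integrable[OF t] and sqU = ac_part_square_integrable[OF t]
  note [measurable] = x_measurable[OF t] square_integrable_measurable[OF sqI] square_integrable_measurable[OF sqU]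
  \<comment> \<open>The initial value is orthogonal to the Ito part, so only the drift contributes;
    Fubini moves the expectation under the time integral, with \<open>ito_part\<close> still
    evaluated at the final time \<open>t\<close>.\<close>
  have cross: "expectation (\<lambda>\<omega>. ito_part t \<omega> $ j * ac_part i t \<omega>) = (\<integral>r. ?k i j r \<partial>time_measure t)" for i j
  proof -
    have "(\<lambda>\<omega>. \<xi> \<omega> $ i) \<in> borel_measurable (F 0)" using initial_adapted by measurable
    then have "expectation (\<lambda>\<omega>. ito_part t \<omega> $ j * \<xi> \<omega> $ i) = 0"
      using ito_integral_orthogonal_initial[OF ito_part_integral[OF t], of "\<lambda>\<omega>. \<xi> \<omega> $ i" j]
      by (simp add: initial_square_integrable mult.commute)
    moreover have "expectation (\<lambda>\<omega>. ito_part t \<omega> $ j * ac_part i t \<omega>) =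
        expectation (\<lambda>\<omega>. ito_part t \<omega> $ j * \<xi> \<omega> $ i) + expectation (\<lambda>\<omega>. ito_part t \<omega> $ j * drift i t \<omega>)"
      using square_integrable_mult[OF sqI initial_square_integrable] square_integrable_mult[OF sqI drift_square_integrable[OF t]]
      by (simp add: ac_part_def distrib_left)
    ultimately show ?thesis using expectation_mult_drift[OF t sqI] by simp
  qed
  have Cx: "square_integrable (time_measure t \<Otimes>\<^sub>M M) (\<lambda>p. (C *v x (fst p) (snd p)) $ i)" for i
    unfolding matrix_vector_mult_def vec_lambda_beta
    by (intro square_integrable_sum square_integrable_cmult x_process_square_integrable t)
  have cint: "integrable (time_measure t \<Otimes>\<^sub>M M) (\<lambda>(r, \<omega>). (C *v x r \<omega>) $ i * (C *v x r \<omega>) $ j)"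
    unfolding case_prod_beta' by (intro square_integrable_mult Cx)
  have cov: "expectation (\<lambda>\<omega>. ito_part t \<omega> $ i * ito_part t \<omega> $ j) = (\<integral>r. ?c r \<partial>time_measure t)"
    using ito_integral_covariance[OF ito_part_integral[OF t] ito_part_integral[OF t] order_refl, of i j]
      P.integral_fst[OF cint] by (simp add: case_prod_beta')
  have ints: "integrable (time_measure t) ?h" "integrable (time_measure t) (?k i j)"
    "integrable (time_measure t) (?k j i)" "integrable (time_measure t) ?c"
    using ac_part_product(2)[OF t] integrable_time_drift[OF t sqI] P.integrable_fst[OF cint] by auto
  have "expectation (\<lambda>\<omega>. x t \<omega> $ i * x t \<omega> $ j) =
      expectation (\<lambda>\<omega>. ac_part i t \<omega> * ac_part j t \<omega> + ito_part t \<omega> $ j * ac_part i t \<omega> +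
        ito_part t \<omega> $ i * ac_part j t \<omega> + ito_part t \<omega> $ i * ito_part t \<omega> $ j)"
  proof (rule integral_cong_AE)
    show "AE \<omega> in M. x t \<omega> $ i * x t \<omega> $ j = ac_part i t \<omega> * ac_part j t \<omega> + ito_part t \<omega> $ j * ac_part i t \<omega> +
        ito_part t \<omega> $ i * ac_part j t \<omega> + ito_part t \<omega> $ i * ito_part t \<omega> $ j"
      using x_decomposition[OF t, of i] x_decomposition[OF t, of j]
      by eventually_elim (simp add: algebra_simps)
  qed measurable
  also have "\<dots> = expectation (\<lambda>\<omega>. ac_part i t \<omega> * ac_part j t \<omega>) + expectation (\<lambda>\<omega>. ito_part t \<omega> $ j * ac_part i t \<omega>) +
        expectation (\<lambda>\<omega>. ito_part t \<omega> $ i * ac_part j t \<omega>) + expectation (\<lambda>\<omega>. ito_part t \<omega> $ i * ito_part t \<omega> $ j)"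
    using square_integrable_mult[OF sqU sqU, of i j] square_integrable_mult[OF sqI sqU, of j i]
      square_integrable_mult[OF sqI sqU, of i j] square_integrable_mult[OF sqI sqI, of i j] by simp
  also have "\<dots> = expectation (\<lambda>\<omega>. \<xi> \<omega> $ i * \<xi> \<omega> $ j) + (\<integral>r. ?h r + ?k i j r + ?k j i r + ?c r \<partial>time_measure t)"
    using ints by (simp add: cross cov ac_part_product(1)[OF t])
  also have "expectation (\<lambda>\<omega>. \<xi> \<omega> $ i * \<xi> \<omega> $ j) = second_moments 0 $ i $ j"
  proof -
    note [measurable] = x_measurable[of 0]
    have "AE \<omega> in M. \<xi> \<omega> = x 0 \<omega>" using solution by (auto simp: ito_solution_def)
    then show ?thesis unfolding second_moments_def vec_lambda_beta
      by (intro integral_cong_AE) auto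
  qed
  finally have eq: "(second_moments t - second_moments 0) $ i $ j =
     (\<integral>r. ?h r + ?k i j r + ?k j i r + ?c r \<partial>time_measure t)" by (simp add: second_moments_def)
  have "((\<lambda>r. ?h r + ?k i j r + ?k j i r + ?c r) has_integral (second_moments t - second_moments 0) $ i $ j) {0..t}"
    unfolding eq using ints by (intro time_integral_has_integral) simp
  then show ?thesis
  proof (rule has_integral_eq[rotated])
    fix r assume r: "r \<in> {0..t}"
    then have r0: "0 \<le> r" and rt: "r \<le> t" by auto
    note sqa = matrix_x_square_integrable[OF r0, of A] and sqc = matrix_x_square_integrable[OF r0, of C]
      and squ = ac_part_square_integrable[OF r0] and sqi = ito_part_square_integrable[OF r0] and sqx = x_square_integrable[OF r0]
    note [measurable] = x_measurable[OF r0] square_integrable_measurable[OF sqi] square_integrable_measurable[OF squ]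
      square_integrable_measurable[OF sqa] square_integrable_measurable[OF sqc]
    \<comment> \<open>The martingale identity replaces the final time \<open>t\<close> by the
      current time \<open>r\<close>.\<close>
    have k: "?k i j r = expectation (\<lambda>\<omega>. ito_part r \<omega> $ j * (A *v x r \<omega>) $ i)" for i j
      unfolding expectation_mult_matrix[OF r0 sqI] expectation_mult_matrix[OF r0 sqi] ito_part_martingale[OF r0 rt] ..
    \<comment> \<open>At equal times the Ito part and the absolutely continuous part add up to
      \<open>x r\<close>.\<close>
    have e: "?k i j r + expectation (\<lambda>\<omega>. (A *v x r \<omega>) $ i * ac_part j r \<omega>) = expectation (\<lambda>\<omega>. (A *v x r \<omega>) $ i * x r \<omega> $ j)" for i j
    proof -
      have "expectation (\<lambda>\<omega>. (A *v x r \<omega>) $ i * x r \<omega> $ j) =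
        expectation (\<lambda>\<omega>. ito_part r \<omega> $ j * (A *v x r \<omega>) $ i + (A *v x r \<omega>) $ i * ac_part j r \<omega>)"
      proof (rule integral_cong_AE)
        show "AE \<omega> in M. (A *v x r \<omega>) $ i * x r \<omega> $ j =
            ito_part r \<omega> $ j * (A *v x r \<omega>) $ i + (A *v x r \<omega>) $ i * ac_part j r \<omega>"
          using x_decomposition[OF r0, of j] by eventually_elim (simp add: algebra_simps)
      qed measurable
      then show ?thesis
        using square_integrable_mult[OF sqi sqa] square_integrable_mult[OF sqa squ] by (simp add: k)
    qed
    have "second_moments_rate r i j = expectation (\<lambda>\<omega>. (A *v x r \<omega>) $ i * x r \<omega> $ j) +
        expectation (\<lambda>\<omega>. (A *v x r \<omega>) $ j * x r \<omega> $ i) + ?c r"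
      using square_integrable_mult[OF sqa sqx] square_integrable_mult[OF sqx sqa] square_integrable_mult[OF sqc sqc]
      by (simp add: second_moments_rate_def mult.commute)
    also have "\<dots> = ?h r + ?k i j r + ?k j i r + ?c r"
    proof -
      have "?h r = expectation (\<lambda>\<omega>. (A *v x r \<omega>) $ i * ac_part j r \<omega>) + expectation (\<lambda>\<omega>. (A *v x r \<omega>) $ j * ac_part i r \<omega>)"
        using square_integrable_mult[OF sqa squ] square_integrable_mult[OF squ sqa] by (simp add: mult.commute)
      then show ?thesis using e[of i j] e[of j i] by linarith
    qed
    finally show "?h r + ?k i j r + ?k j i r + ?c r = second_moments_rate r i j" by simp
  qed
qed

lemma second_moments_derivative:
  assumes t: "0 \<le> t"
  shows "(second_moments has_vector_derivative lyapunov_map A C (second_moments t)) (at t within {0..})"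
proof -
  \<comment> \<open>The Volterra argument works on a bounded interval; ending it at
    \<open>t + 1\<close> keeps \<open>t\<close> away from the right endpoint.\<close>
  have "(second_moments has_vector_derivative lyapunov_map A C (second_moments t)) (at t within {0..t+1})"
  proof (rule volterra_has_vector_derivative[OF bounded_linear_lyapunov_map])
    fix s b assume s: "0 \<le> s" "s \<le> t + 1" and "b \<in> (Basis :: (real^'n^'n) set)"
    then obtain i j where b: "b = axis i (axis j 1)" by (auto simp: Basis_vec_def)
    have "((\<lambda>r. lyapunov_map A C (second_moments r) $ i $ j) has_integral (second_moments s - second_moments 0) $ i $ j) {0..s}"
      by (rule has_integral_eq[OF _ second_moments_integral[OF s(1)]]) (simp add: second_moments_rate_eq)
    then show "((\<lambda>r. inner (lyapunov_map A C (second_moments r)) b) has_integral inner (second_moments s - second_moments 0) b) {0..s}"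
      by (simp add: b inner_axis)
  qed (use t in auto)
  moreover have "at t within {0..t+1} = at t within {0..}"
    by (rule at_within_nhd[of _ "{t - 1<..<t + 1}"]) (use t in auto)
  ultimately show ?thesis by simp
qed

end

section \<open>Mean-square decay and transport of solutions\<close>

context linear_sde
begin

lemma norm_sq_x_integrable:
  assumes t: "0 \<le> t"
  shows "integrable M (\<lambda>\<omega>. (norm (x t \<omega>))\<^sup>2)"
    and "expectation (\<lambda>\<omega>. (norm (x t \<omega>))\<^sup>2) = (\<Sum>i\<in>UNIV. second_moments t $ i $ i)"
proof -
  have n: "(norm v)\<^sup>2 = (\<Sum>i\<in>UNIV. v $ i * v $ i)" for v :: "real ^ 'n"
    by (simp add: power2_norm_eq_inner inner_vec_def)
  note sq = square_integrable_mult[OF x_square_integrable[OF t] x_square_integrable[OF t]]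
  show "integrable M (\<lambda>\<omega>. (norm (x t \<omega>))\<^sup>2)" unfolding n using sq by (intro Bochner_Integration.integrable_sum)
  show "expectation (\<lambda>\<omega>. (norm (x t \<omega>))\<^sup>2) = (\<Sum>i\<in>UNIV. second_moments t $ i $ i)"
    unfolding n using sq by (simp add: second_moments_def Bochner_Integration.integral_sum)
qed

definition mean_square :: "real \<Rightarrow> real" where
  "mean_square t = expectation (\<lambda>\<omega>. (norm (x t \<omega>))\<^sup>2)"

lemma mean_square_nonneg: "0 \<le> mean_square t"
  by (simp add: mean_square_def)

lemma second_moment_eq_mean_square: "0 \<le> t \<Longrightarrow> second_moment M (x t) = ennreal (mean_square t)"
  unfolding second_moment_def mean_square_def
  by (intro nn_integral_eq_integral norm_sq_x_integrable) auto

lemma mean_square_le_norm: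
  assumes "0 \<le> t"
  shows "mean_square t \<le> real CARD('n) * norm (second_moments t)"
proof -
  have "mean_square t \<le> (\<Sum>i\<in>(UNIV::'n set). norm (second_moments t))"
    unfolding mean_square_def norm_sq_x_integrable(2)[OF assms]
  proof (rule sum_mono)
    fix i :: 'n
    have "\<bar>second_moments t $ i $ i\<bar> \<le> norm (second_moments t $ i)" by (rule component_le_norm_cart)
    also have "\<dots> \<le> norm (second_moments t)" by (rule Finite_Cartesian_Product.norm_nth_le)
    finally show "second_moments t $ i $ i \<le> norm (second_moments t)" by simp
  qed
  then show ?thesis by simp
qed

text \<open>Each mixed moment is dominated by the squared norm. Together with
  \<open>mean_square_le_norm\<close> this makes trace and norm comparable along the trajectory, so
  decay and integrability pass from one to the other.\<close>

lemma norm_le_mean_square: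
  assumes t: "0 \<le> t"
  shows "norm (second_moments t) \<le> (real CARD('n))\<^sup>2 * mean_square t"
proof -
  have e: "\<bar>second_moments t $ i $ j\<bar> \<le> mean_square t" for i j
  proof -
    note sq = square_integrable_mult[OF x_square_integrable[OF t] x_square_integrable[OF t], of i j]
    have "\<bar>second_moments t $ i $ j\<bar> \<le> expectation (\<lambda>\<omega>. \<bar>x t \<omega> $ i * x t \<omega> $ j\<bar>)"
      by (simp add: second_moments_def integral_abs_bound)
    also have "\<dots> \<le> mean_square t"
      unfolding mean_square_def
    proof (rule integral_mono)
      show "\<bar>x t \<omega> $ i * x t \<omega> $ j\<bar> \<le> (norm (x t \<omega>))\<^sup>2" for \<omega>
        using mult_mono[OF component_le_norm_cart[of "x t \<omega>" i] component_le_norm_cart[of "x t \<omega>" j]]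
        by (simp add: abs_mult power2_eq_square)
    qed (use sq norm_sq_x_integrable[OF t] in auto)
    finally show ?thesis .
  qed
  have "norm (second_moments t) \<le> (\<Sum>i\<in>UNIV. norm (second_moments t $ i))"
    unfolding norm_vec_def by (rule L2_set_le_sum) simp
  also have "\<dots> \<le> (\<Sum>i\<in>(UNIV::'n set). \<Sum>j\<in>(UNIV::'n set). \<bar>second_moments t $ i $ j\<bar>)"
    by (intro sum_mono norm_le_l1_cart)
  also have "\<dots> \<le> (\<Sum>i\<in>(UNIV::'n set). \<Sum>j\<in>(UNIV::'n set). mean_square t)"
    by (intro sum_mono e)
  also have "\<dots> = (real CARD('n))\<^sup>2 * mean_square t" by (simp add: power2_eq_square)
  finally show ?thesis .
qed

lemma second_moments_continuous: "continuous_on {0..} second_moments"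
  unfolding continuous_on_eq_continuous_within
  using second_moments_derivative has_vector_derivative_continuous by fastforce

lemma mean_square_continuous: "continuous_on {0..} mean_square"
proof -
  have "continuous_on {0..} (\<lambda>t. \<Sum>i\<in>UNIV. second_moments t $ i $ i)"
    by (intro continuous_intros second_moments_continuous)
  then show ?thesis
    by (rule continuous_on_eq) (simp add: mean_square_def norm_sq_x_integrable(2))
qed

lemma mean_square_tendsto_iff:
  "((\<lambda>t. second_moment M (x t)) \<longlongrightarrow> 0) at_top \<longleftrightarrow> (second_moments \<longlongrightarrow> 0) at_top"
proof -
  have ev: "\<forall>\<^sub>F t::real in at_top. 0 \<le> t" by (rule eventually_ge_at_top)
  have "((\<lambda>t. second_moment M (x t)) \<longlongrightarrow> 0) at_top \<longleftrightarrow> ((\<lambda>t. ennreal (mean_square t)) \<longlongrightarrow> ennreal 0) at_top"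
    by (simp, rule tendsto_cong) (use ev in eventually_elim, simp add: second_moment_eq_mean_square)
  also have "\<dots> \<longleftrightarrow> (mean_square \<longlongrightarrow> 0) at_top"
    by (rule tendsto_ennreal_iff) (auto simp: mean_square_nonneg)
  also have "\<dots> \<longleftrightarrow> (second_moments \<longlongrightarrow> 0) at_top"
  proof
    assume *: "(mean_square \<longlongrightarrow> 0) at_top"
    show "(second_moments \<longlongrightarrow> 0) at_top"
    proof (rule Lim_null_comparison)
      show "\<forall>\<^sub>F t in at_top. norm (second_moments t) \<le> (real CARD('n))\<^sup>2 * mean_square t"
        using ev by eventually_elim (rule norm_le_mean_square)
      show "((\<lambda>t. (real CARD('n))\<^sup>2 * mean_square t) \<longlongrightarrow> 0) at_top"
        using tendsto_mult_right_zero[OF *] .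
    qed
  next
    assume *: "(second_moments \<longlongrightarrow> 0) at_top"
    show "(mean_square \<longlongrightarrow> 0) at_top"
    proof (rule Lim_null_comparison)
      show "\<forall>\<^sub>F t in at_top. norm (mean_square t) \<le> real CARD('n) * norm (second_moments t)"
        using ev by eventually_elim (simp add: mean_square_nonneg mean_square_le_norm)
      show "((\<lambda>t. real CARD('n) * norm (second_moments t)) \<longlongrightarrow> 0) at_top"
        using tendsto_mult_right_zero[OF tendsto_norm_zero[OF *]] .
    qed
  qed
  finally show ?thesis .
qed

lemma time_integral_mean_square:
  assumes T: "0 \<le> T"
  shows "(\<integral>\<^sup>+ \<omega>. (\<integral>\<^sup>+ t\<in>{0..T}. ennreal ((norm (x t \<omega>))\<^sup>2) \<partial>lborel) \<partial>M) = ennreal (integral {0..T} mean_square)"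
proof -
  interpret T: finite_measure "time_measure T" by (rule finite_time_measure)
  interpret P: pair_sigma_finite "time_measure T" M
    using sigma_finite_M T.sigma_finite_measure_axioms by (simp add: pair_sigma_finite_def)
  have n: "(norm v)\<^sup>2 = (\<Sum>i\<in>UNIV. v $ i * v $ i)" for v :: "real ^ 'n"
    by (simp add: power2_norm_eq_inner inner_vec_def)
  have int: "integrable (time_measure T \<Otimes>\<^sub>M M) (\<lambda>(r, \<omega>). (norm (x r \<omega>))\<^sup>2)"
    unfolding n case_prod_beta'
    by (intro Bochner_Integration.integrable_sum square_integrable_mult x_process_square_integrable T)
  have "(\<integral>\<^sup>+ \<omega>. (\<integral>\<^sup>+ t\<in>{0..T}. ennreal ((norm (x t \<omega>))\<^sup>2) \<partial>lborel) \<partial>M) =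
      (\<integral>\<^sup>+p. ennreal ((norm (x (fst p) (snd p)))\<^sup>2) \<partial>(time_measure T \<Otimes>\<^sub>M M))"
    using nn_integral_time_pair[OF sigma_finite_M, of "\<lambda>p. ennreal ((norm (x (fst p) (snd p)))\<^sup>2)" T]
      borel_measurable_integrable[OF int] by (simp add: case_prod_beta')
  also have "\<dots> = ennreal (\<integral>p. (norm (x (fst p) (snd p)))\<^sup>2 \<partial>(time_measure T \<Otimes>\<^sub>M M))"
    using int by (intro nn_integral_eq_integral) (auto simp: case_prod_beta')
  also have "(\<integral>p. (norm (x (fst p) (snd p)))\<^sup>2 \<partial>(time_measure T \<Otimes>\<^sub>M M)) = (\<integral>r. mean_square r \<partial>time_measure T)"
    using P.integral_fst[OF int] by (simp add: mean_square_def case_prod_beta')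
  also have "\<dots> = integral {0..T} mean_square"
    by (rule time_integral_continuous) (rule continuous_on_subset[OF mean_square_continuous], auto)
  finally show ?thesis .
qed

text \<open>Joint measurability of the solution is given over bounded horizons; monotone
  convergence, first in time and then over the sample space, leads from these to the
  half-line.\<close>

lemma infinite_horizon_integral:
  "(\<integral>\<^sup>+ \<omega>. (\<integral>\<^sup>+ t\<in>{0..}. ennreal ((norm (x t \<omega>))\<^sup>2) \<partial>lborel) \<partial>M) =
    (SUP n. \<integral>\<^sup>+ \<omega>. (\<integral>\<^sup>+ t\<in>{0..real n}. ennreal ((norm (x t \<omega>))\<^sup>2) \<partial>lborel) \<partial>M)"
proof -
  let ?f = "\<lambda>n \<omega>. \<integral>\<^sup>+ t\<in>{0..real n}. ennreal ((norm (x t \<omega>))\<^sup>2) \<partial>lborel"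
  have jm[measurable]: "(\<lambda>p. x (fst p) (snd p)) \<in> borel_measurable (time_measure (real n) \<Otimes>\<^sub>M M)" for n
    using x_L2[of "real n"] by (simp add: L2_adapted_def case_prod_beta')
  have fm: "?f n \<in> borel_measurable M" for n
  proof -
    interpret T: finite_measure "time_measure (real n)" by (rule finite_time_measure)
    have "(\<lambda>q. x (snd q) (fst q)) \<in> borel_measurable (M \<Otimes>\<^sub>M time_measure (real n))"
      using measurable_compose[OF measurable_pair_swap' jm[of n]] by (simp add: case_prod_beta')
    then have "(\<lambda>\<omega>. \<integral>\<^sup>+ t. ennreal ((norm (x t \<omega>))\<^sup>2) \<partial>time_measure (real n)) \<in> borel_measurable M"
      by (intro T.borel_measurable_nn_integral) (simp add: case_prod_beta')
    then show ?thesis by (simp add: nn_integral_restrict_space)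
  qed
  have sm: "(\<lambda>t. ennreal ((norm (x t \<omega>))\<^sup>2) * indicator {0..real n} t) \<in> borel_measurable lborel"
    if "\<omega> \<in> space M" for \<omega> n
  proof -
    have "(\<lambda>t. x t \<omega>) \<in> borel_measurable (time_measure (real n))"
      using measurable_compose[OF measurable_Pair2'[OF that] jm] by simp
    then have "(\<lambda>t. ennreal ((norm (x t \<omega>))\<^sup>2)) \<in> borel_measurable (time_measure (real n))" by measurable
    then show ?thesis
      by (subst (asm) borel_measurable_restrict_space_iff_ennreal) auto
  qed
  have inner: "(\<integral>\<^sup>+ t\<in>{0..}. ennreal ((norm (x t \<omega>))\<^sup>2) \<partial>lborel) = (SUP n. ?f n \<omega>)" if "\<omega> \<in> space M" for \<omega>
  proof -
    have "(\<integral>\<^sup>+ t\<in>{0..}. ennreal ((norm (x t \<omega>))\<^sup>2) \<partial>lborel) =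
        (\<integral>\<^sup>+ t. (SUP n. ennreal ((norm (x t \<omega>))\<^sup>2) * indicator {0..real n} t) \<partial>lborel)"
    proof (rule nn_integral_cong)
      fix t :: real
      show "ennreal ((norm (x t \<omega>))\<^sup>2) * indicator {0..} t = (SUP n. ennreal ((norm (x t \<omega>))\<^sup>2) * indicator {0..real n} t)"
      proof (cases "t \<ge> 0")
        case True
        obtain m where "t \<le> real m" using real_arch_simple by blast
        with True have "(SUP n. ennreal ((norm (x t \<omega>))\<^sup>2) * indicator {0..real n} t) = ennreal ((norm (x t \<omega>))\<^sup>2)"
          by (intro antisym SUP_least SUP_upper2[of m]) (auto simp: indicator_def)
        with True show ?thesis by simp
      qed simp
    qed
    also have "\<dots> = (SUP n. ?f n \<omega>)"
      using sm[OF that]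
      by (intro nn_integral_monotone_convergence_SUP) (auto simp: incseq_def le_fun_def indicator_def)
    finally show ?thesis .
  qed
  have "(\<integral>\<^sup>+ \<omega>. (\<integral>\<^sup>+ t\<in>{0..}. ennreal ((norm (x t \<omega>))\<^sup>2) \<partial>lborel) \<partial>M) = (\<integral>\<^sup>+ \<omega>. (SUP n. ?f n \<omega>) \<partial>M)"
    by (intro nn_integral_cong inner)
  also have "\<dots> = (SUP n. \<integral>\<^sup>+ \<omega>. ?f n \<omega> \<partial>M)"
    by (intro nn_integral_monotone_convergence_SUP fm)
       (auto simp: incseq_def le_fun_def indicator_def intro!: nn_integral_mono)
  finally show ?thesis .
qed

lemma second_moments_tendsto_zeroI:
  assumes "\<And>T. 0 \<le> T \<Longrightarrow> integral {0..T} mean_square \<le> K"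
  shows "(second_moments \<longlongrightarrow> 0) at_top"
proof (rule linear_ode_integral_bounded_imp_tendsto_zero[OF bounded_linear_lyapunov_map second_moments_derivative])
  fix T :: real assume T: "0 \<le> T"
  have "integral {0..T} (\<lambda>t. norm (second_moments t)) \<le> integral {0..T} (\<lambda>t. (real CARD('n))\<^sup>2 * mean_square t)"
    by (intro integral_le integrable_continuous_interval continuous_intros norm_le_mean_square
        continuous_on_subset[OF second_moments_continuous] continuous_on_subset[OF mean_square_continuous]) auto
  also have "\<dots> = (real CARD('n))\<^sup>2 * integral {0..T} mean_square" by simp
  also have "\<dots> \<le> (real CARD('n))\<^sup>2 * K" using assms[OF T] by (intro mult_left_mono) auto
  finally show "integral {0..T} (\<lambda>t. norm (second_moments t)) \<le> (real CARD('n))\<^sup>2 * K" .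
qed simp

theorem mean_square_decay_iff_integrable:
  "((\<lambda>t. second_moment M (x t)) \<longlongrightarrow> 0) at_top \<longleftrightarrow>
    (\<integral>\<^sup>+ \<omega>. (\<integral>\<^sup>+ t\<in>{0..}. ennreal ((norm (x t \<omega>))\<^sup>2) \<partial>lborel) \<partial>M) < \<infinity>"
proof
  assume "((\<lambda>t. second_moment M (x t)) \<longlongrightarrow> 0) at_top"
  then have "(second_moments \<longlongrightarrow> 0) at_top" by (simp add: mean_square_tendsto_iff)
  from linear_ode_tendsto_zero_imp_integral_bounded[OF bounded_linear_lyapunov_map second_moments_derivative this]
  obtain K where K: "\<And>T. 0 \<le> T \<Longrightarrow> integral {0..T} (\<lambda>t. norm (second_moments t)) \<le> K" by auto
  have "integral {0..T} mean_square \<le> real CARD('n) * K" if T: "0 \<le> T" for T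
  proof -
    have "integral {0..T} mean_square \<le> integral {0..T} (\<lambda>t. real CARD('n) * norm (second_moments t))"
      by (intro integral_le integrable_continuous_interval continuous_intros mean_square_le_norm
          continuous_on_subset[OF second_moments_continuous] continuous_on_subset[OF mean_square_continuous]) auto
    also have "\<dots> = real CARD('n) * integral {0..T} (\<lambda>t. norm (second_moments t))" by simp
    also have "\<dots> \<le> real CARD('n) * K" using K[OF T] by (intro mult_left_mono) auto
    finally show ?thesis .
  qed
  then have "(\<integral>\<^sup>+ \<omega>. (\<integral>\<^sup>+ t\<in>{0..}. ennreal ((norm (x t \<omega>))\<^sup>2) \<partial>lborel) \<partial>M) \<le> ennreal (real CARD('n) * K)"
    unfolding infinite_horizon_integral by (intro SUP_least) (simp add: time_integral_mean_square ennreal_leI)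
  then show "(\<integral>\<^sup>+ \<omega>. (\<integral>\<^sup>+ t\<in>{0..}. ennreal ((norm (x t \<omega>))\<^sup>2) \<partial>lborel) \<partial>M) < \<infinity>"
    by (simp add: order_le_less_trans)
next
  let ?S = "\<integral>\<^sup>+ \<omega>. (\<integral>\<^sup>+ t\<in>{0..}. ennreal ((norm (x t \<omega>))\<^sup>2) \<partial>lborel) \<partial>M"
  assume fin: "?S < \<infinity>"
  have "integral {0..T} mean_square \<le> enn2real ?S" if T: "0 \<le> T" for T
  proof -
    have "ennreal (integral {0..T} mean_square) \<le> ?S"
      unfolding time_integral_mean_square[OF T, symmetric]
      by (intro nn_integral_mono) (auto simp: indicator_def)
    then have "enn2real (ennreal (integral {0..T} mean_square)) \<le> enn2real ?S"
      using fin by (intro enn2real_mono) auto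
    moreover have "0 \<le> integral {0..T} mean_square"
      by (intro integral_nonneg integrable_continuous_interval continuous_on_subset[OF mean_square_continuous])
         (auto simp: mean_square_nonneg)
    ultimately show ?thesis by simp
  qed
  then show "((\<lambda>t. second_moment M (x t)) \<longlongrightarrow> 0) at_top"
    unfolding mean_square_tendsto_iff by (rule second_moments_tendsto_zeroI)
qed

text \<open>The matrix of second moments starts at zero and solves a linear equation, so it stays
  zero.\<close>

lemma zero_initial_imp_zero:
  assumes "AE \<omega> in M. \<xi> \<omega> = 0" and t: "0 \<le> t"
  shows "second_moment M (x t) = 0"
proof -
  have "AE \<omega> in M. x 0 \<omega> = 0" using assms(1) solution by (auto simp: ito_solution_def)
  then have "expectation (\<lambda>\<omega>. x 0 \<omega> $ i * x 0 \<omega> $ j) = 0" for i j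
    by (subst integral_cong_AE[of _ M "\<lambda>_. 0"])
       (use x_measurable[of 0] in \<open>auto intro!: borel_measurable_times borel_measurable_vec_component\<close>)
  then have "second_moments 0 = 0" by (simp add: second_moments_def vec_eq_iff)
  moreover have "(second_moments has_vector_derivative lyapunov_map A C (second_moments r)) (at r within {0..t})"
    if "r \<in> {0..t}" for r
    using that by (intro has_vector_derivative_within_subset[OF second_moments_derivative]) auto
  moreover have "lyapunov_map A C 0 = 0" by (rule linear_0[OF bounded_linear.linear[OF bounded_linear_lyapunov_map]])
  ultimately have "second_moments t = (\<lambda>_. 0) t"
    by (intro linear_ode_unique[OF bounded_linear_lyapunov_map t, of second_moments A C]) auto
  then have "mean_square t \<le> 0" using mean_square_le_norm[OF t] by simp
  then show ?thesis by (simp add: second_moment_eq_mean_square[OF t] ennreal_neg)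
qed

end

text \<open>Only the trace of \<open>F\<close> on \<open>\<theta> \<noteq> 0\<close> has to be visible in \<open>F'\<close>, because the transported process
  vanishes elsewhere.\<close>

locale solution_transfer = brownian_filtration M F W
  for M :: "'w measure" and F and W +
  fixes M' :: "'v measure" and F' :: "real \<Rightarrow> 'v measure" and \<phi> :: "'v \<Rightarrow> 'w" and \<theta> :: "'v \<Rightarrow> real"
  assumes \<phi>_measurable: "\<phi> \<in> measurable M' M" and \<phi>_distr: "distr M' M \<phi> = M"
    and \<theta>_bound: "\<And>\<omega>. \<bar>\<theta> \<omega>\<bar> \<le> 1"
    and \<theta>_measurable: "\<And>s. 0 \<le> s \<Longrightarrow> \<theta> \<in> borel_measurable (F' s)"
    and space_F': "\<And>s. 0 \<le> s \<Longrightarrow> space (F' s) = space M'"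
    and sets_F': "\<And>s. 0 \<le> s \<Longrightarrow> sets (F' s) \<subseteq> sets M'"
    and transfer_sets: "\<And>s A. 0 \<le> s \<Longrightarrow> A \<in> sets (F s) \<Longrightarrow> \<phi> -` A \<inter> {\<omega> \<in> space M'. \<theta> \<omega> \<noteq> 0} \<in> sets (F' s)"
begin

lemma \<theta>_measurable_M': "\<theta> \<in> borel_measurable M'"
  using \<theta>_measurable[of 0] space_F'[of 0] sets_F'[of 0] by (auto simp: measurable_def)

text \<open>Setting the transported function to zero where \<open>\<theta>\<close> vanishes does not
  change the product, and its preimages then involve only the trace of the filtration on the
  complement.\<close>

lemma transfer_measurable:
  fixes f :: "'w \<Rightarrow> real ^ 'n"
  assumes s: "0 \<le> s" and f: "f \<in> borel_measurable (F s)"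
  shows "(\<lambda>\<omega>. \<theta> \<omega> *\<^sub>R f (\<phi> \<omega>)) \<in> borel_measurable (F' s)"
proof -
  let ?h = "\<lambda>\<omega>. if \<theta> \<omega> \<noteq> 0 then f (\<phi> \<omega>) else 0"
  have "?h \<in> borel_measurable (F' s)"
  proof (rule measurableI)
    fix B :: "(real ^ 'n) set" assume B: "B \<in> sets borel"
    have "f -` B \<inter> space M \<in> sets (F s)" using measurable_sets[OF f B] space_F[OF s] by simp
    from transfer_sets[OF s this]
    have 1: "\<phi> -` (f -` B \<inter> space M) \<inter> {\<omega> \<in> space M'. \<theta> \<omega> \<noteq> 0} \<in> sets (F' s)" .
    have 2: "\<theta> -` {0} \<inter> space (F' s) \<in> sets (F' s)" by (rule measurable_sets[OF \<theta>_measurable[OF s]]) simp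
    have "?h -` B \<inter> space (F' s) = (\<phi> -` (f -` B \<inter> space M) \<inter> {\<omega> \<in> space M'. \<theta> \<omega> \<noteq> 0}) \<union>
        (if 0 \<in> B then \<theta> -` {0} \<inter> space (F' s) else {})"
      using measurable_space[OF \<phi>_measurable] space_F'[OF s] by (auto split: if_splits)
    then show "?h -` B \<inter> space (F' s) \<in> sets (F' s)" using 1 2 by auto
  qed simp
  then have "(\<lambda>\<omega>. \<theta> \<omega> *\<^sub>R ?h \<omega>) \<in> borel_measurable (F' s)"
    by (intro borel_measurable_scaleR \<theta>_measurable s)
  then show ?thesis by (rule measurable_cong[THEN iffD1, rotated]) auto
qed

lemma transfer_nn_integral:
  assumes "f \<in> borel_measurable M"
  shows "(\<integral>\<^sup>+\<omega>. f (\<phi> \<omega>) \<partial>M') = (\<integral>\<^sup>+\<omega>. f \<omega> \<partial>M)"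
  using nn_integral_distr[OF \<phi>_measurable, of f] assms \<phi>_distr by simp

lemma norm_\<theta>_le: "ennreal ((norm (\<theta> \<omega> *\<^sub>R v))\<^sup>2) \<le> ennreal ((norm v)\<^sup>2)"
  using \<theta>_bound[of \<omega>] by (intro ennreal_leI power_mono) (auto intro: mult_left_le_one_le)

lemma transfer_second_moment_le:
  assumes "X \<in> borel_measurable M"
  shows "second_moment M' (\<lambda>\<omega>. \<theta> \<omega> *\<^sub>R X (\<phi> \<omega>)) \<le> second_moment M X"
proof -
  have "second_moment M' (\<lambda>\<omega>. \<theta> \<omega> *\<^sub>R X (\<phi> \<omega>)) \<le> (\<integral>\<^sup>+\<omega>. ennreal ((norm (X (\<phi> \<omega>)))\<^sup>2) \<partial>M')"
    unfolding second_moment_def by (intro nn_integral_mono norm_\<theta>_le)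
  also have "\<dots> = second_moment M X"
    unfolding second_moment_def using assms by (intro transfer_nn_integral) measurable
  finally show ?thesis .
qed

lemma transfer_process_integral_le:
  assumes H: "(\<lambda>p. H (fst p) (snd p)) \<in> borel_measurable (time_measure T \<Otimes>\<^sub>M M)"
  shows "(\<integral>\<^sup>+ \<omega>. (\<integral>\<^sup>+ s\<in>{0..T}. ennreal ((norm (\<theta> \<omega> *\<^sub>R H s (\<phi> \<omega>)))\<^sup>2) \<partial>lborel) \<partial>M') \<le>
    (\<integral>\<^sup>+ \<omega>. (\<integral>\<^sup>+ s\<in>{0..T}. ennreal ((norm (H s \<omega>))\<^sup>2) \<partial>lborel) \<partial>M)"
proof -
  interpret T: finite_measure "time_measure T" by (rule finite_time_measure)
  have "(\<lambda>q. H (snd q) (fst q)) \<in> borel_measurable (M \<Otimes>\<^sub>M time_measure T)"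
    using measurable_compose[OF measurable_pair_swap' H] by (simp add: case_prod_beta')
  then have "(\<lambda>\<omega>. \<integral>\<^sup>+ t. ennreal ((norm (H t \<omega>))\<^sup>2) \<partial>time_measure T) \<in> borel_measurable M"
    by (intro T.borel_measurable_nn_integral) (simp add: case_prod_beta')
  then have m: "(\<lambda>\<omega>. \<integral>\<^sup>+ s\<in>{0..T}. ennreal ((norm (H s \<omega>))\<^sup>2) \<partial>lborel) \<in> borel_measurable M"
    by (simp add: nn_integral_restrict_space)
  have "(\<integral>\<^sup>+ \<omega>. (\<integral>\<^sup>+ s\<in>{0..T}. ennreal ((norm (\<theta> \<omega> *\<^sub>R H s (\<phi> \<omega>)))\<^sup>2) \<partial>lborel) \<partial>M') \<le>
      (\<integral>\<^sup>+ \<omega>. (\<integral>\<^sup>+ s\<in>{0..T}. ennreal ((norm (H s (\<phi> \<omega>)))\<^sup>2) \<partial>lborel) \<partial>M')"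
    by (intro nn_integral_mono mult_right_mono norm_\<theta>_le) simp
  also have "\<dots> = (\<integral>\<^sup>+ \<omega>. (\<integral>\<^sup>+ s\<in>{0..T}. ennreal ((norm (H s \<omega>))\<^sup>2) \<partial>lborel) \<partial>M)"
    by (rule transfer_nn_integral[OF m])
  finally show ?thesis .
qed

lemma transfer_process_measurable:
  fixes H :: "real \<Rightarrow> 'w \<Rightarrow> real ^ 'n"
  assumes H: "(\<lambda>p. H (fst p) (snd p)) \<in> borel_measurable (time_measure T \<Otimes>\<^sub>M M)"
  shows "(\<lambda>p. \<theta> (snd p) *\<^sub>R H (fst p) (\<phi> (snd p))) \<in> borel_measurable (time_measure T \<Otimes>\<^sub>M M')"
proof -
  have "(\<lambda>p. (fst p, \<phi> (snd p))) \<in> measurable (time_measure T \<Otimes>\<^sub>M M') (time_measure T \<Otimes>\<^sub>M M)"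
    using \<phi>_measurable by measurable
  from measurable_compose[OF this H]
  have [measurable]: "(\<lambda>p. H (fst p) (\<phi> (snd p))) \<in> borel_measurable (time_measure T \<Otimes>\<^sub>M M')" by simp
  note [measurable] = \<theta>_measurable_M'
  show ?thesis by measurable
qed

lemma transfer_L2_adapted:
  assumes "L2_adapted M F T H"
  shows "L2_adapted M' F' T (\<lambda>s \<omega>. \<theta> \<omega> *\<^sub>R H s (\<phi> \<omega>))"
proof -
  have H: "(\<lambda>p. H (fst p) (snd p)) \<in> borel_measurable (time_measure T \<Otimes>\<^sub>M M)"
    using assms by (simp add: L2_adapted_def case_prod_beta')
  show ?thesis
    using assms transfer_process_measurable[OF H] transfer_process_integral_le[OF H]
    by (auto simp: L2_adapted_def case_prod_beta' intro!: transfer_measurable elim: le_less_trans)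
qed

lemma transfer_elementary_data:
  assumes e: "elementary_data M F T k \<tau> e"
  shows "elementary_data M' F' T k \<tau> (\<lambda>j \<omega>. \<theta> \<omega> *\<^sub>R e j (\<phi> \<omega>))"
proof -
  have "(\<lambda>\<omega>. \<theta> \<omega> *\<^sub>R e j (\<phi> \<omega>)) \<in> borel_measurable (F' (\<tau> j)) \<and>
      second_moment M' (\<lambda>\<omega>. \<theta> \<omega> *\<^sub>R e j (\<phi> \<omega>)) < \<infinity>" if "j < k" for j
    using transfer_measurable[OF elementary_data_partition(1)[OF e that], of "e j"]
      transfer_second_moment_le[OF elementary_data_value(2)[OF e that]] e that
    by (auto simp: elementary_data_def elim: le_less_trans)
  then show ?thesis using e by (simp add: elementary_data_def)
qed

lemma transfer_elementary_process:
  "elementary_process k \<tau> (\<lambda>j \<omega>. \<theta> \<omega> *\<^sub>R e j (\<phi> \<omega>)) s \<omega> = \<theta> \<omega> *\<^sub>R elementary_process k \<tau> e s (\<phi> \<omega>)"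
  unfolding elementary_process_def scaleR_sum_right by (intro sum.cong refl scaleR_left_commute)

lemma transfer_elementary_integral:
  "elementary_integral (\<lambda>t \<omega>. W t (\<phi> \<omega>)) k \<tau> (\<lambda>j \<omega>. \<theta> \<omega> *\<^sub>R e j (\<phi> \<omega>)) \<omega> = \<theta> \<omega> *\<^sub>R elementary_integral W k \<tau> e (\<phi> \<omega>)"
  unfolding elementary_integral_def scaleR_sum_right by (intro sum.cong refl scaleR_left_commute)

text \<open>Since \<open>\<theta>\<close> is known from time 0 on, it can be multiplied into the
  coefficients of every elementary process and factors out of the integral. As \<open>\<phi>\<close>
  preserves the measure and \<open>\<theta>\<close> is bounded by 1, no approximation error
  grows.\<close>

lemma transfer_ito_integral:
  assumes "is_ito_integral M F W T H I"
  shows "is_ito_integral M' F' (\<lambda>t \<omega>. W t (\<phi> \<omega>)) T (\<lambda>s \<omega>. \<theta> \<omega> *\<^sub>R H s (\<phi> \<omega>)) (\<lambda>\<omega>. \<theta> \<omega> *\<^sub>R I (\<phi> \<omega>))"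
proof -
  from assms obtain k \<tau> e where e: "\<And>m. elementary_data M F T (k m) (\<tau> m) (e m)"
    and eH: "(\<lambda>m. \<integral>\<^sup>+ \<omega>. (\<integral>\<^sup>+ s\<in>{0..T}.
            ennreal ((norm (H s \<omega> - elementary_process (k m) (\<tau> m) (e m) s \<omega>))\<^sup>2) \<partial>lborel) \<partial>M) \<longlonglongrightarrow> 0"
    and eI: "(\<lambda>m. second_moment M (\<lambda>\<omega>. I \<omega> - elementary_integral W (k m) (\<tau> m) (e m) \<omega>)) \<longlonglongrightarrow> 0"
    and HL: "L2_adapted M F T H" and I: "I \<in> borel_measurable M"
    unfolding is_ito_integral_def by blast
  have Hm: "(\<lambda>p. H (fst p) (snd p)) \<in> borel_measurable (time_measure T \<Otimes>\<^sub>M M)"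
    using HL by (simp add: L2_adapted_def case_prod_beta')
  let ?e = "\<lambda>m j \<omega>. \<theta> \<omega> *\<^sub>R e m j (\<phi> \<omega>)"
  have 1: "elementary_data M' F' T (k m) (\<tau> m) (?e m)" for m by (rule transfer_elementary_data[OF e])
  have 2: "(\<lambda>m. \<integral>\<^sup>+ \<omega>. (\<integral>\<^sup>+ s\<in>{0..T}.
            ennreal ((norm (\<theta> \<omega> *\<^sub>R H s (\<phi> \<omega>) - elementary_process (k m) (\<tau> m) (?e m) s \<omega>))\<^sup>2) \<partial>lborel) \<partial>M') \<longlonglongrightarrow> 0"
  proof (rule ennreal_tendsto_zero_mono[OF eH])
    show "(\<integral>\<^sup>+ \<omega>. (\<integral>\<^sup>+ s\<in>{0..T}.
            ennreal ((norm (\<theta> \<omega> *\<^sub>R H s (\<phi> \<omega>) - elementary_process (k m) (\<tau> m) (?e m) s \<omega>))\<^sup>2) \<partial>lborel) \<partial>M') \<le>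
         (\<integral>\<^sup>+ \<omega>. (\<integral>\<^sup>+ s\<in>{0..T}.
            ennreal ((norm (H s \<omega> - elementary_process (k m) (\<tau> m) (e m) s \<omega>))\<^sup>2) \<partial>lborel) \<partial>M)" for m
      unfolding transfer_elementary_process scaleR_diff_right[symmetric]
      by (rule transfer_process_integral_le) (intro borel_measurable_diff Hm elementary_data_measurable[OF e])
  qed
  have 3: "(\<lambda>m. second_moment M' (\<lambda>\<omega>. \<theta> \<omega> *\<^sub>R I (\<phi> \<omega>) - elementary_integral (\<lambda>t \<omega>. W t (\<phi> \<omega>)) (k m) (\<tau> m) (?e m) \<omega>)) \<longlonglongrightarrow> 0"
  proof (rule ennreal_tendsto_zero_mono[OF eI])
    show "second_moment M' (\<lambda>\<omega>. \<theta> \<omega> *\<^sub>R I (\<phi> \<omega>) - elementary_integral (\<lambda>t \<omega>. W t (\<phi> \<omega>)) (k m) (\<tau> m) (?e m) \<omega>) \<le>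
        second_moment M (\<lambda>\<omega>. I \<omega> - elementary_integral W (k m) (\<tau> m) (e m) \<omega>)" for m
      unfolding transfer_elementary_integral scaleR_diff_right[symmetric]
      by (rule transfer_second_moment_le) (intro borel_measurable_diff I elementary_data_measurable[OF e])
  qed
  have 4: "(\<lambda>\<omega>. \<theta> \<omega> *\<^sub>R I (\<phi> \<omega>)) \<in> borel_measurable M'"
    by (intro borel_measurable_scaleR \<theta>_measurable_M' measurable_compose[OF \<phi>_measurable I])
  show ?thesis
    unfolding is_ito_integral_def using transfer_L2_adapted[OF HL] 1 2 3 4
    by (intro conjI exI[of _ k] exI[of _ \<tau>] exI[of _ ?e]) auto
qed

lemma transfer_AE:
  assumes "AE \<omega> in M. P \<omega>"
  shows "AE \<omega> in M'. P (\<phi> \<omega>)"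
proof -
  have "AE \<omega> in distr M' M \<phi>. P \<omega>" unfolding \<phi>_distr by (rule assms)
  then show ?thesis by (rule AE_distrD[OF \<phi>_measurable])
qed

lemma transfer_ito_solution:
  assumes "ito_solution M F W \<xi> (\<lambda>y. A *v y) (\<lambda>y. C *v y) x"
  shows "ito_solution M' F' (\<lambda>t \<omega>. W t (\<phi> \<omega>)) (\<lambda>\<omega>. \<theta> \<omega> *\<^sub>R \<xi> (\<phi> \<omega>)) (\<lambda>y. A *v y) (\<lambda>y. C *v y)
    (\<lambda>t \<omega>. \<theta> \<omega> *\<^sub>R x t (\<phi> \<omega>))"
proof -
  have "AE \<omega> in M'. continuous_on {0..} (\<lambda>t. \<theta> \<omega> *\<^sub>R x t (\<phi> \<omega>))"
    using transfer_AE[of "\<lambda>\<omega>. continuous_on {0..} (\<lambda>t. x t \<omega>)"] assms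
    by (auto simp: ito_solution_def elim!: eventually_mono intro!: continuous_intros)
  moreover have "AE \<omega> in M'. \<theta> \<omega> *\<^sub>R x 0 (\<phi> \<omega>) = \<theta> \<omega> *\<^sub>R \<xi> (\<phi> \<omega>)"
    using transfer_AE[of "\<lambda>\<omega>. x 0 \<omega> = \<xi> \<omega>"] assms
    by (auto simp: ito_solution_def elim!: eventually_mono)
  moreover have "L2_adapted M' F' t (\<lambda>t \<omega>. \<theta> \<omega> *\<^sub>R x t (\<phi> \<omega>))" if "0 \<le> t" for t
    using assms that by (intro transfer_L2_adapted) (simp add: ito_solution_def)
  moreover have "is_ito_integral M' F' (\<lambda>t \<omega>. W t (\<phi> \<omega>)) t (\<lambda>s \<omega>. C *v (\<theta> \<omega> *\<^sub>R x s (\<phi> \<omega>)))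
      (\<lambda>\<omega>. \<theta> \<omega> *\<^sub>R x t (\<phi> \<omega>) - \<theta> \<omega> *\<^sub>R \<xi> (\<phi> \<omega>) - (LINT s:{0..t}|lborel. A *v (\<theta> \<omega> *\<^sub>R x s (\<phi> \<omega>))))"
    if "0 \<le> t" for t
  proof -
    have "is_ito_integral M F W t (\<lambda>s \<omega>. C *v x s \<omega>) (\<lambda>\<omega>. x t \<omega> - \<xi> \<omega> - (LINT s:{0..t}|lborel. A *v x s \<omega>))"
      using assms that by (simp add: ito_solution_def)
    from transfer_ito_integral[OF this] show ?thesis
      by (simp add: matrix_vector_mult_scaleR scaleR_diff_right)
  qed
  ultimately show ?thesis by (simp add: ito_solution_def)
qed

end

section \<open>Translation of solutions by a constant state\<close>

lemma augmented_filtration_shift: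
  "augmented_filtration M W (\<lambda>\<omega>. \<xi> \<omega> + c) t = augmented_filtration M W \<xi> t"
proof -
  have "{(\<lambda>\<omega>. \<xi> \<omega> + c) -` A \<inter> space M | A. A \<in> sets borel} \<subseteq> {\<xi> -` A \<inter> space M | A. A \<in> sets borel}"
    for \<xi> :: "'a \<Rightarrow> real ^ 'n" and c
  proof safe
    fix A :: "(real ^ 'n) set" assume "A \<in> sets borel"
    moreover have "(\<lambda>y. y + c) \<in> borel_measurable (borel :: (real ^ 'n) measure)" by measurable
    ultimately have "(\<lambda>y. y + c) -` A \<inter> space borel \<in> sets borel" by (intro measurable_sets)
    then show "\<exists>B. (\<lambda>\<omega>. \<xi> \<omega> + c) -` A \<inter> space M = \<xi> -` B \<inter> space M \<and> B \<in> sets borel"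
      by (intro exI[of _ "(\<lambda>y. y + c) -` A"]) auto
  qed
  \<comment> \<open>The inclusion is applied to the translation and to its inverse.\<close>
  from this[of \<xi> c] this[of "\<lambda>\<omega>. \<xi> \<omega> + c" "- c"]
  have "{(\<lambda>\<omega>. \<xi> \<omega> + c) -` A \<inter> space M | A. A \<in> sets borel} = {\<xi> -` A \<inter> space M | A. A \<in> sets borel}"
    by simp
  then show ?thesis unfolding augmented_filtration_def by simp
qed

lemma norm_add_sq_le:
  fixes v c :: "'a::real_normed_vector"
  shows "ennreal ((norm (v + c))\<^sup>2) \<le> 2 * ennreal ((norm v)\<^sup>2) + ennreal (2 * (norm c)\<^sup>2)"
proof -
  have "(norm (v + c))\<^sup>2 \<le> (norm v + norm c)\<^sup>2" by (intro power_mono norm_triangle_ineq) simp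
  also have "\<dots> \<le> 2 * (norm v)\<^sup>2 + 2 * (norm c)\<^sup>2"
    using sum_squares_bound[of "norm v" "norm c"] by (simp add: power2_sum)
  finally show ?thesis
    by (subst ennreal_numeral[symmetric], subst ennreal_mult[symmetric])
       (auto simp: ennreal_plus[symmetric] simp del: ennreal_plus ennreal_numeral intro!: ennreal_leI)
qed

lemma second_moment_shift_finite:
  assumes "prob_space M" and [measurable]: "X \<in> borel_measurable M" and "second_moment M X < \<infinity>"
  shows "second_moment M (\<lambda>\<omega>. X \<omega> + c) < \<infinity>"
proof -
  interpret prob_space M by fact
  have "second_moment M (\<lambda>\<omega>. X \<omega> + c) \<le> (\<integral>\<^sup>+\<omega>. 2 * ennreal ((norm (X \<omega>))\<^sup>2) + ennreal (2 * (norm c)\<^sup>2) \<partial>M)"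
    unfolding second_moment_def by (intro nn_integral_mono norm_add_sq_le)
  also have "\<dots> = 2 * second_moment M X + ennreal (2 * (norm c)\<^sup>2)"
    by (simp add: second_moment_def nn_integral_add nn_integral_cmult emeasure_space_1)
  also have "\<dots> < \<infinity>" using assms(3) by (auto simp: ennreal_mult_eq_top_iff less_top[symmetric])
  finally show ?thesis .
qed

text \<open>Centring at \<open>xbar\<close> will turn the affine closed loop into the linear
  equation. The filtration is unchanged by the shift, so the work lies in square integrability,
  which survives because the time interval and the probability space are finite.\<close>

lemma strong_solution_shift:
  fixes x :: "real \<Rightarrow> 'w \<Rightarrow> real ^ 'n"
  assumes M: "prob_space M" and sol: "strong_solution M W \<xi> b g x"
  shows "strong_solution M W (\<lambda>\<omega>. \<xi> \<omega> + c) (\<lambda>y. b (y - c)) (\<lambda>y. g (y - c)) (\<lambda>t \<omega>. x t \<omega> + c)"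
proof -
  interpret prob_space M by fact
  have "L2_adapted M F t (\<lambda>s \<omega>. x s \<omega> + c)" if "L2_adapted M F t x" for F t
  proof -
    have Hm[measurable]: "(\<lambda>p. x (fst p) (snd p)) \<in> borel_measurable (time_measure t \<Otimes>\<^sub>M M)"
      using that by (simp add: L2_adapted_def case_prod_beta')
    note b = norm_add_sq_le[of _ c]
    have "(\<integral>\<^sup>+ \<omega>. (\<integral>\<^sup>+ s\<in>{0..t}. ennreal ((norm (x s \<omega> + c))\<^sup>2) \<partial>lborel) \<partial>M) =
        (\<integral>\<^sup>+p. ennreal ((norm (x (fst p) (snd p) + c))\<^sup>2) \<partial>(time_measure t \<Otimes>\<^sub>M M))"
      using nn_integral_time_pair[OF sigma_finite_measure_axioms, of "\<lambda>p. ennreal ((norm (x (fst p) (snd p) + c))\<^sup>2)" t] by simp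
    also have "\<dots> \<le> (\<integral>\<^sup>+p. 2 * ennreal ((norm (x (fst p) (snd p)))\<^sup>2) + ennreal (2 * (norm c)\<^sup>2) \<partial>(time_measure t \<Otimes>\<^sub>M M))"
      by (intro nn_integral_mono b)
    also have "\<dots> = 2 * (\<integral>\<^sup>+p. ennreal ((norm (x (fst p) (snd p)))\<^sup>2) \<partial>(time_measure t \<Otimes>\<^sub>M M)) +
        ennreal (2 * (norm c)\<^sup>2) * emeasure (time_measure t \<Otimes>\<^sub>M M) (space (time_measure t \<Otimes>\<^sub>M M))"
      by (simp add: nn_integral_add nn_integral_cmult)
    also have "(\<integral>\<^sup>+p. ennreal ((norm (x (fst p) (snd p)))\<^sup>2) \<partial>(time_measure t \<Otimes>\<^sub>M M)) =
       (\<integral>\<^sup>+ \<omega>. (\<integral>\<^sup>+ s\<in>{0..t}. ennreal ((norm (x s \<omega>))\<^sup>2) \<partial>lborel) \<partial>M)"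
      using nn_integral_time_pair[OF sigma_finite_measure_axioms, of "\<lambda>p. ennreal ((norm (x (fst p) (snd p)))\<^sup>2)" t] by simp
    also have "2 * \<dots> + ennreal (2 * (norm c)\<^sup>2) * emeasure (time_measure t \<Otimes>\<^sub>M M) (space (time_measure t \<Otimes>\<^sub>M M)) < \<infinity>"
      using that finite_measure.emeasure_finite[OF finite_measure_pair_measure[OF finite_measure_axioms finite_time_measure[of t]]]
      by (auto simp: L2_adapted_def ennreal_mult_eq_top_iff less_top[symmetric])
    finally show ?thesis using that by (auto simp: L2_adapted_def)
  qed
  then show ?thesis
    using sol unfolding strong_solution_def augmented_filtration_shift[abs_def]
    by (auto elim!: eventually_mono intro!: continuous_intros)
qed

section \<open>Sufficiency\<close>

lemma independent_rv_compose:
  assumes ind: "independent_rv M S X T Y" and M: "prob_space M"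
    and f: "f \<in> measurable S S'" and g: "g \<in> measurable T T'"
  shows "independent_rv M S' (\<lambda>\<omega>. f (X \<omega>)) T' (\<lambda>\<omega>. g (Y \<omega>))"
proof -
  interpret prob_space M by fact
  have X: "X \<in> measurable M S" and Y: "Y \<in> measurable M T"
    and i: "indep_set {X -` A \<inter> space M | A. A \<in> sets S} {Y -` A \<inter> space M | A. A \<in> sets T}"
    using ind by (auto simp: independent_rv_def)
  have fX: "(\<lambda>\<omega>. f (X \<omega>)) \<in> measurable M S'" and gY: "(\<lambda>\<omega>. g (Y \<omega>)) \<in> measurable M T'"
    using measurable_compose[OF X f] measurable_compose[OF Y g] by auto
  have "indep_set {(\<lambda>\<omega>. f (X \<omega>)) -` A \<inter> space M | A. A \<in> sets S'} {(\<lambda>\<omega>. g (Y \<omega>)) -` A \<inter> space M | A. A \<in> sets T'}"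
  proof (rule indep_setI)
    fix a b assume "a \<in> {(\<lambda>\<omega>. f (X \<omega>)) -` A \<inter> space M | A. A \<in> sets S'}"
      and "b \<in> {(\<lambda>\<omega>. g (Y \<omega>)) -` A \<inter> space M | A. A \<in> sets T'}"
    then obtain A B where AB: "A \<in> sets S'" "a = (\<lambda>\<omega>. f (X \<omega>)) -` A \<inter> space M"
      "B \<in> sets T'" "b = (\<lambda>\<omega>. g (Y \<omega>)) -` B \<inter> space M" by auto
    have "a = X -` (f -` A \<inter> space S) \<inter> space M" "b = Y -` (g -` B \<inter> space T) \<inter> space M"
      using AB measurable_space[OF X] measurable_space[OF Y] by auto
    then show "prob (a \<inter> b) = prob a * prob b"
      using AB measurable_sets[OF f AB(1)] measurable_sets[OF g AB(3)]
      by (intro indep_setD[OF i]) blast+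
  qed (use measurable_sets[OF fX] measurable_sets[OF gY] in auto)
  then show ?thesis using fX gY by (simp add: independent_rv_def)
qed

lemma linear_sde_strong_solution:
  assumes "standard_brownian_motion M W" "second_moment M \<xi> < \<infinity>"
    and "independent_rv M borel \<xi> (PiM {0..} (\<lambda>_. borel)) (\<lambda>\<omega>. \<lambda>t\<in>{0..}. W t \<omega>)"
    and "strong_solution M W \<xi> (\<lambda>y. A *v y) (\<lambda>y. C *v y) x"
  shows "linear_sde M (augmented_filtration M W \<xi>) W \<xi> A C x"
  using brownian_filtration_augmented[OF assms(1,3)] assms(2,4)
  by (simp add: linear_sde_def linear_sde_axioms_def augmented_filtration_initial_measurable
      strong_solution_iff_ito_solution)

text \<open>Joint independence of all initial states from all noises is projected to a single agent,
  whose centred state then meets the requirements of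
  \<open>linear_sde_strong_solution\<close>.\<close>

lemma multi_agent_data_agent:
  assumes data: "multi_agent_data N xbar M W x0" and i: "i \<in> {1..N}"
  shows "standard_brownian_motion M (W i)"
    and "second_moment M (\<lambda>\<omega>. x0 i \<omega> - xbar) < \<infinity>"
    and "independent_rv M borel (\<lambda>\<omega>. x0 i \<omega> - xbar) (PiM {0..} (\<lambda>_. borel)) (\<lambda>\<omega>. \<lambda>t\<in>{0..}. W i t \<omega>)"
proof -
  have M: "prob_space M" using data by (simp add: multi_agent_data_def)
  show "standard_brownian_motion M (W i)" using data i by (simp add: multi_agent_data_def)
  obtain c where c: "second_moment M (x0 i) \<le> ennreal c"
    using data i unfolding multi_agent_data_def by blast
  have "integrable M (x0 i)" using data i unfolding multi_agent_data_def by blast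
  then have m: "x0 i \<in> borel_measurable M" by (rule borel_measurable_integrable)
  show "second_moment M (\<lambda>\<omega>. x0 i \<omega> - xbar) < \<infinity>"
    using second_moment_shift_finite[OF M m, of "- xbar"] le_less_trans[OF c] by simp
  have "independent_rv M (PiM {1..N} (\<lambda>_. borel)) (\<lambda>\<omega>. \<lambda>i\<in>{1..N}. x0 i \<omega>)
       (PiM ({1..N} \<times> {0..}) (\<lambda>_. borel)) (\<lambda>\<omega>. \<lambda>p\<in>{1..N} \<times> {0..}. W (fst p) (snd p) \<omega>)"
    using data by (simp add: multi_agent_data_def)
  from independent_rv_compose[OF this M, of "\<lambda>f. f i - xbar" borel "\<lambda>f. \<lambda>t\<in>{0..}. f (i, t)" "PiM {0..} (\<lambda>_. borel)"]
  have "independent_rv M borel (\<lambda>\<omega>. (\<lambda>i\<in>{1..N}. x0 i \<omega>) i - xbar) (PiM {0..} (\<lambda>_. borel))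
      (\<lambda>\<omega>. \<lambda>t\<in>{0..}. (\<lambda>p\<in>{1..N} \<times> {0..}. W (fst p) (snd p) \<omega>) (i, t))"
    using i by (auto intro!: borel_measurable_diff measurable_component_singleton measurable_restrict)
  moreover have "(\<lambda>\<omega>. (\<lambda>i\<in>{1..N}. x0 i \<omega>) i - xbar) = (\<lambda>\<omega>. x0 i \<omega> - xbar)" using i by auto
  moreover have "(\<lambda>\<omega>. \<lambda>t\<in>{0..}. (\<lambda>p\<in>{1..N} \<times> {0..}. W (fst p) (snd p) \<omega>) (i, t)) = (\<lambda>\<omega>. \<lambda>t\<in>{0..}. W i t \<omega>)"
    using i by (auto simp: fun_eq_iff restrict_def)
  ultimately show "independent_rv M borel (\<lambda>\<omega>. x0 i \<omega> - xbar) (PiM {0..} (\<lambda>_. borel)) (\<lambda>\<omega>. \<lambda>t\<in>{0..}. W i t \<omega>)"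
    by simp
qed

lemma closed_loop_deviation:
  assumes data: "multi_agent_data N xbar M W x0" and cl: "closed_loop_agents B D R P N xbar M W x0 x"
    and i: "i \<in> {1..N}"
  shows "strong_solution M (W i) (\<lambda>\<omega>. x0 i \<omega> - xbar) (\<lambda>y. - (B ** fb_gain B D R P) *v y)
    (\<lambda>y. - (D ** fb_gain B D R P) *v y) (\<lambda>t \<omega>. x i t \<omega> - xbar)"
proof -
  have M: "prob_space M" using data by (simp add: multi_agent_data_def)
  have "strong_solution M (W i) (x0 i) (\<lambda>y. - (B ** fb_gain B D R P) *v (y - xbar))
    (\<lambda>y. - (D ** fb_gain B D R P) *v (y - xbar)) (x i)"
    using cl i by (simp add: closed_loop_agents_def)
  from strong_solution_shift[OF M this, of "- xbar"] show ?thesis by simp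
qed

lemma mean_square_consensusI:
  assumes "\<And>i. i \<in> {1..N} \<Longrightarrow> ((\<lambda>t. second_moment M (\<lambda>\<omega>. x i t \<omega> - xbar)) \<longlongrightarrow> 0) at_top"
  shows "mean_square_consensus M N x"
  unfolding mean_square_consensus_def using assms by (intro bexI[of _ "\<lambda>_. xbar"]) auto

lemma ms_stable_imp_consensus:
  assumes "ms_stable TYPE('w) (- (B ** fb_gain B D R P)) (- (D ** fb_gain B D R P))"
  shows "closed_loop_reaches_consensus TYPE('w) B D R P N xbar"
  unfolding closed_loop_reaches_consensus_def
proof (intro allI impI, elim conjE, rule mean_square_consensusI)
  fix M :: "'w measure" and W x0 x i
  assume data: "multi_agent_data N xbar M W x0" and cl: "closed_loop_agents B D R P N xbar M W x0 x"
    and i: "i \<in> {1..N}"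
  note agent = multi_agent_data_agent[OF data i] and sol = closed_loop_deviation[OF data cl i]
  interpret linear_sde M "augmented_filtration M (W i) (\<lambda>\<omega>. x0 i \<omega> - xbar)" "W i" "\<lambda>\<omega>. x0 i \<omega> - xbar"
    "- (B ** fb_gain B D R P)" "- (D ** fb_gain B D R P)" "\<lambda>t \<omega>. x i t \<omega> - xbar"
    using linear_sde_strong_solution[OF agent sol] .
  have "(\<integral>\<^sup>+ \<omega>. (\<integral>\<^sup>+ t\<in>{0..}. ennreal ((norm (x i t \<omega> - xbar))\<^sup>2) \<partial>lborel) \<partial>M) < \<infinity>"
    using assms[unfolded ms_stable_def, rule_format, of M "W i" "\<lambda>\<omega>. x0 i \<omega> - xbar" "\<lambda>t \<omega>. x i t \<omega> - xbar"] agent sol by blast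
  then show "((\<lambda>t. second_moment M (\<lambda>\<omega>. x i t \<omega> - xbar)) \<longlongrightarrow> 0) at_top"
    unfolding mean_square_decay_iff_integrable .
qed

section \<open>The Riccati equation as a Lyapunov inequality\<close>

lemma inner_matrix_vector_sum:
  fixes P :: "real ^ 'n ^ 'n"
  shows "inner a (P *v b) = (\<Sum>i\<in>UNIV. \<Sum>j\<in>UNIV. P $ i $ j * (a $ i * b $ j))"
  by (simp add: inner_vec_def matrix_vector_mult_def sum_distrib_left algebra_simps)

lemma symmetric_inner:
  fixes P :: "real ^ 'n ^ 'n"
  assumes "transpose P = P"
  shows "inner (P *v a) b = inner a (P *v b)"
  using dot_lmul_matrix[of a P b] assms by (metis vector_transpose_matrix transpose_transpose)

text \<open>A minimiser of the quadratic form on the unit sphere is an eigenvector: otherwise moving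
  against the residual \<open>w\<close> would lower the Rayleigh quotient to first order.\<close>

lemma symmetric_min_eigenvector:
  fixes P :: "real ^ 'n ^ 'n"
  assumes sym: "transpose P = P"
  obtains l v where "v \<noteq> 0" "P *v v = l *\<^sub>R v" "\<And>u. inner u (P *v u) \<ge> l * (norm u)\<^sup>2"
proof -
  have cont: "continuous_on (sphere 0 1) (\<lambda>u :: real ^ 'n. inner u (P *v u))"
    by (intro continuous_intros bounded_linear.continuous_on[OF matrix_vector_mul_bounded_linear])
  have "sphere 0 1 \<noteq> ({} :: (real ^ 'n) set)" by simp
  from continuous_attains_inf[OF compact_sphere this cont]
  obtain v :: "real ^ 'n" where v: "norm v = 1" "\<And>u. norm u = 1 \<Longrightarrow> inner v (P *v v) \<le> inner u (P *v u)"
    by auto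
  define l where "l = inner v (P *v v)"
  have q: "inner u (P *v u) \<ge> l * (norm u)\<^sup>2" for u
  proof (cases "u = 0")
    case False
    then have "l \<le> inner ((1 / norm u) *\<^sub>R u) (P *v ((1 / norm u) *\<^sub>R u))"
      unfolding l_def by (intro v(2)) simp
    also have "\<dots> = inner u (P *v u) / (norm u)\<^sup>2"
      by (simp add: matrix_vector_mult_scaleR power2_eq_square)
    finally show ?thesis using False by (simp add: field_simps)
  qed simp
  define w where "w = P *v v - l *\<^sub>R v"
  have "inner w w = 0"
  proof (rule ccontr)
    assume "inner w w \<noteq> 0"
    then have ww: "inner w w > 0" by simp
    define K where "K = inner w (P *v w) - l * (norm w)\<^sup>2"
    \<comment> \<open>The form minus \<open>l\<close> times the squared norm, expanded at
      \<open>v\<close> plus \<open>t\<close> times \<open>w\<close>; its constant term vanishes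
      because \<open>v\<close> attains the minimum \<open>l\<close>.\<close>
    have ineq: "0 \<le> 2 * t * inner w w + t\<^sup>2 * K" for t
    proof -
      have "inner w (P *v v) = inner w w + l * inner v w"
        by (simp add: w_def inner_diff_right inner_diff_left inner_commute algebra_simps)
      moreover have "inner v (P *v w) = inner w (P *v v)"
        using symmetric_inner[OF sym, of v w] by (simp add: inner_commute)
      moreover have "(norm v)\<^sup>2 = 1" using v(1) by simp
      ultimately have "inner (v + t *\<^sub>R w) (P *v (v + t *\<^sub>R w)) - l * (norm (v + t *\<^sub>R w))\<^sup>2 =
          2 * t * inner w w + t\<^sup>2 * K"
        unfolding K_def power2_norm_eq_inner
        by (simp add: matrix_vector_right_distrib matrix_vector_mult_scaleR inner_add_left inner_add_right
            l_def[symmetric] inner_commute[of w v] algebra_simps power2_eq_square)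
      then show ?thesis using q[of "v + t *\<^sub>R w"] by linarith
    qed
    have "K \<ge> 0" using q[of w] by (simp add: K_def)
    show False
    proof (cases "K = 0")
      case True
      then show False using ineq[of "-1"] ww by simp
    next
      case False
      then have "K > 0" using \<open>K \<ge> 0\<close> by simp
      \<comment> \<open>The minimiser in \<open>t\<close>, where the quadratic is negative.\<close>
      have "2 * (- inner w w / K) * inner w w + (- inner w w / K)\<^sup>2 * K = - (inner w w)\<^sup>2 / K"
        using \<open>K > 0\<close> by (simp add: field_simps power2_eq_square)
      moreover have "- (inner w w)\<^sup>2 / K < 0" using \<open>K > 0\<close> ww by (simp add: divide_neg_pos)
      ultimately show False using ineq[of "- inner w w / K"] by linarith
    qed
  qed
  then have "P *v v = l *\<^sub>R v" by (simp add: w_def)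
  moreover have "v \<noteq> 0" using v(1) by auto
  ultimately show ?thesis using q by (intro that[of v l])
qed

lemma hurwitz_real_eigenvalue:
  fixes A :: "real ^ 'n ^ 'n"
  assumes "hurwitz A" "v \<noteq> 0" "A *v v = l *\<^sub>R v"
  shows "l < 0"
proof -
  define u :: "complex ^ 'n" where "u = (\<chi> i. complex_of_real (v $ i))"
  have "u \<noteq> 0" using assms(2) by (auto simp: u_def vec_eq_iff)
  moreover have "map_matrix complex_of_real A *v u = complex_of_real l *s u"
  proof -
    have "(\<Sum>j\<in>UNIV. complex_of_real (A $ i $ j) * complex_of_real (v $ j)) = complex_of_real ((A *v v) $ i)" for i
      by (simp add: matrix_vector_mult_def)
    then show ?thesis by (simp add: vec_eq_iff u_def matrix_vector_mult_def map_matrix_def assms(3)[unfolded matrix_vector_mult_def])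
  qed
  ultimately have "Re (complex_of_real l) < 0" using assms(1) unfolding hurwitz_def by blast
  then show ?thesis by simp
qed

text \<open>With discount zero the Riccati equation says that the closed-loop drift matrix is minus
  the inverse of \<open>P\<close>. An eigenvector of \<open>P\<close> for its smallest eigenvalue
  \<open>l\<close> is thus one of the drift matrix for \<open>- 1 / l\<close>, and the Hurwitz
  property forces \<open>l > 0\<close>.\<close>

lemma stabilizing_solution_positive:
  fixes P :: "real ^ 'n ^ 'n"
  assumes "stabilizing_solution 0 B D R P"
  shows "P ** (B ** fb_gain B D R P) = mat 1" "0 \<le> inner v (P *v v)"
proof -
  have sym: "transpose P = P" and hur: "hurwitz (- (B ** fb_gain B D R P))"
    and "0 = mat 1 - P ** B ** matrix_inv (R + transpose D ** P ** D) ** transpose B ** P"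
    using assms by (auto simp: stabilizing_solution_def)
  then show PB: "P ** (B ** fb_gain B D R P) = mat 1"
    by (simp add: fb_gain_def matrix_mul_assoc)
  then have BP: "(B ** fb_gain B D R P) ** P = mat 1" by (rule matrix_left_right_inverse[THEN iffD1])
  obtain l w where
    w: "w \<noteq> 0" "P *v w = l *\<^sub>R w" "\<And>u. inner u (P *v u) \<ge> l * (norm u)\<^sup>2"
    by (rule symmetric_min_eigenvector[OF sym]) (rule that)
  have e: "w = l *\<^sub>R ((B ** fb_gain B D R P) *v w)"
  proof -
    have "w = ((B ** fb_gain B D R P) ** P) *v w" by (simp only: BP matrix_vector_mul_lid)
    also have "\<dots> = (B ** fb_gain B D R P) *v (P *v w)" by (simp only: matrix_vector_mul_assoc)
    finally show ?thesis by (simp add: w(2) matrix_vector_mult_scaleR)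
  qed
  then have "l \<noteq> 0" using w(1) by auto
  have "- (B ** fb_gain B D R P) *v w = (- 1 / l) *\<^sub>R w"
  proof -
    have "(1 / l) *\<^sub>R w = (B ** fb_gain B D R P) *v w"
      by (subst e) (simp add: \<open>l \<noteq> 0\<close>)
    then show ?thesis by (simp add: matrix_vector_mult_def vec_eq_iff sum_negf)
  qed
  from hurwitz_real_eigenvalue[OF hur w(1) this] have "l > 0"
    using \<open>l \<noteq> 0\<close> by (simp add: divide_less_0_iff)
  have "0 \<le> l * (norm v)\<^sup>2" using \<open>l > 0\<close> by simp
  also have "\<dots> \<le> inner v (P *v v)" by (rule w(3))
  finally show "0 \<le> inner v (P *v v)" .
qed

text \<open>Let \<open>w\<close> be the gain applied to \<open>v\<close>. From
  \<open>P B w = v\<close> each of the two drift terms is minus the squared norm of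
  \<open>v\<close>. From \<open>D^T P D = S - R\<close> and \<open>S w = B^T P v\<close> the noise
  term is that squared norm minus the value of the form \<open>R\<close> at \<open>w\<close>, so one
  of the two copies cancels and a nonpositive remainder is left.\<close>

lemma riccati_lyapunov_decrease:
  fixes P :: "real ^ 'n ^ 'n" and B D :: "real ^ 'm ^ 'n"
  assumes st: "stabilizing_solution 0 B D R P" and R: "positive_definite R"
  defines "A \<equiv> - (B ** fb_gain B D R P)" and "C \<equiv> - (D ** fb_gain B D R P)"
  shows "inner (A *v v) (P *v v) + inner v (P *v (A *v v)) + inner (C *v v) (P *v (C *v v)) \<le> - (norm v)\<^sup>2"
proof -
  define S where "S = R + transpose D ** P ** D"
  define w where "w = fb_gain B D R P *v v"
  have sym: "transpose P = P" and S: "invertible S"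
    using st by (auto simp: stabilizing_solution_def S_def)
  have neg: "- X *v y = - (X *v y)" for X :: "real ^ 'n ^ 'n" and y
    by (simp add: matrix_vector_mult_def vec_eq_iff sum_negf)
  have Av: "A *v v = - (B *v w)" and Cv: "C *v v = - (D *v w)"
    by (simp_all add: A_def C_def w_def neg matrix_vector_mul_assoc)
  have PBw: "P *v (B *v w) = v"
    using stabilizing_solution_positive(1)[OF st] by (simp add: w_def matrix_vector_mul_assoc)
  have Sw: "S *v w = transpose B *v (P *v v)"
  proof -
    have "S ** matrix_inv S = mat 1" using someI_ex[OF S[unfolded invertible_def]] unfolding matrix_inv_def by blast
    then have "S ** (matrix_inv S ** transpose B ** P) = transpose B ** P"
      by (metis matrix_mul_assoc matrix_mul_lid)
    then show ?thesis
      unfolding w_def fb_gain_def S_def[symmetric] matrix_vector_mul_assoc by simp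
  qed
  have PBv: "inner (B *v w) (P *v v) = (norm v)\<^sup>2"
    using symmetric_inner[OF sym, of "B *v w" v] PBw by (simp add: power2_norm_eq_inner)
  have tr: "inner (X *v a) b = inner a (transpose X *v b)" for X :: "real ^ 'm ^ 'n" and a b
    by (metis dot_lmul_matrix vector_transpose_matrix inner_commute transpose_transpose)
  have "inner (D *v w) (P *v (D *v w)) = inner w ((transpose D ** P ** D) *v w)"
    by (simp add: tr matrix_vector_mul_assoc matrix_mul_assoc)
  also have "\<dots> = inner w (S *v w) - inner w (R *v w)"
    by (simp add: S_def matrix_vector_mult_add_rdistrib inner_add_right)
  also have "inner w (S *v w) = inner (B *v w) (P *v v)" by (simp add: Sw tr)
  finally have D: "inner (D *v w) (P *v (D *v w)) = (norm v)\<^sup>2 - inner w (R *v w)" by (simp add: PBv)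
  have "inner w (R *v w) \<ge> 0" using R by (cases "w = 0") (auto simp: positive_definite_def less_imp_le)
  moreover have m: "P *v (- y) = - (P *v y)" for y
    by (simp add: matrix_vector_mult_def vec_eq_iff sum_negf)
  have "inner v (P *v (A *v v)) = - (norm v)\<^sup>2"
    by (simp add: Av m PBw power2_norm_eq_inner)
  moreover have "inner (A *v v) (P *v v) = - (norm v)\<^sup>2" by (simp add: Av PBv)
  moreover have "inner (C *v v) (P *v (C *v v)) = (norm v)\<^sup>2 - inner w (R *v w)"
    by (simp add: Cv m D)
  ultimately show ?thesis by linarith
qed

context linear_sde
begin

text \<open>\<open>V\<close>, the expectation of the quadratic form along the solution, stays
  nonnegative and loses at least the time integral of \<open>mean_square\<close>; hence that
  integral never exceeds \<open>V 0\<close>.\<close>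

lemma lyapunov_second_moments_tendsto_zero:
  fixes P :: "real ^ 'n ^ 'n"
  assumes psd: "\<And>v. 0 \<le> inner v (P *v v)"
    and dec: "\<And>v. inner (A *v v) (P *v v) + inner v (P *v (A *v v)) + inner (C *v v) (P *v (C *v v)) \<le> - (norm v)\<^sup>2"
  shows "(second_moments \<longlongrightarrow> 0) at_top"
proof -
  define V where "V t = (\<Sum>i\<in>UNIV. \<Sum>j\<in>UNIV. P $ i $ j * second_moments t $ i $ j)" for t
  have V: "V t = expectation (\<lambda>\<omega>. inner (x t \<omega>) (P *v x t \<omega>))" if t: "0 \<le> t" for t
    unfolding inner_matrix_vector_sum V_def second_moments_def
    using square_integrable_mult[OF x_square_integrable[OF t] x_square_integrable[OF t]]
    by (simp add: Bochner_Integration.integral_sum)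
  have rate: "(\<Sum>i\<in>UNIV. \<Sum>j\<in>UNIV. P $ i $ j * second_moments_rate t i j) \<le> - mean_square t" if t: "0 \<le> t" for t
  proof -
    note sq = square_integrable_mult[OF matrix_x_square_integrable[OF t] x_square_integrable[OF t]]
      square_integrable_mult[OF x_square_integrable[OF t] matrix_x_square_integrable[OF t]]
      square_integrable_mult[OF matrix_x_square_integrable[OF t] matrix_x_square_integrable[OF t]]
    let ?f = "\<lambda>i j \<omega>. P $ i $ j * ((A *v x t \<omega>) $ i * x t \<omega> $ j + x t \<omega> $ i * (A *v x t \<omega>) $ j +
            (C *v x t \<omega>) $ i * (C *v x t \<omega>) $ j)"
    have int: "integrable M (?f i j)" for i j
      using sq by (intro Bochner_Integration.integrable_mult_right Bochner_Integration.integrable_add)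
    have "(\<Sum>i\<in>UNIV. \<Sum>j\<in>UNIV. P $ i $ j * second_moments_rate t i j) =
        expectation (\<lambda>\<omega>. \<Sum>i\<in>UNIV. \<Sum>j\<in>UNIV. ?f i j \<omega>)"
      using int by (simp add: Bochner_Integration.integral_sum second_moments_rate_def)
    also have "\<dots> \<le> expectation (\<lambda>\<omega>. - (norm (x t \<omega>))\<^sup>2)"
    proof (rule integral_mono)
      show "integrable M (\<lambda>\<omega>. \<Sum>i\<in>UNIV. \<Sum>j\<in>UNIV. ?f i j \<omega>)"
        using int by (intro Bochner_Integration.integrable_sum)
      show "integrable M (\<lambda>\<omega>. - (norm (x t \<omega>))\<^sup>2)" using norm_sq_x_integrable(1)[OF t] by simp
      fix \<omega>
      have "(\<Sum>i\<in>UNIV. \<Sum>j\<in>UNIV. ?f i j \<omega>) = inner (A *v x t \<omega>) (P *v x t \<omega>) +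
          inner (x t \<omega>) (P *v (A *v x t \<omega>)) + inner (C *v x t \<omega>) (P *v (C *v x t \<omega>))"
        unfolding inner_matrix_vector_sum by (simp add: distrib_left sum.distrib)
      then show "(\<Sum>i\<in>UNIV. \<Sum>j\<in>UNIV. ?f i j \<omega>) \<le> - (norm (x t \<omega>))\<^sup>2" using dec by simp
    qed
    finally show ?thesis by (simp add: mean_square_def)
  qed
  show ?thesis
  proof (rule second_moments_tendsto_zeroI)
    fix T :: real assume T: "0 \<le> T"
    have "((\<lambda>r. \<Sum>i\<in>UNIV. \<Sum>j\<in>UNIV. P $ i $ j * second_moments_rate r i j) has_integral
        (\<Sum>i\<in>UNIV. \<Sum>j\<in>UNIV. P $ i $ j * (second_moments T - second_moments 0) $ i $ j)) {0..T}"
      by (intro has_integral_sum has_integral_mult_right second_moments_integral T) auto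
    moreover have "(\<Sum>i\<in>UNIV. \<Sum>j\<in>UNIV. P $ i $ j * (second_moments T - second_moments 0) $ i $ j) = V T - V 0"
      by (simp add: V_def right_diff_distrib sum_subtractf)
    ultimately have I: "((\<lambda>r. \<Sum>i\<in>UNIV. \<Sum>j\<in>UNIV. P $ i $ j * second_moments_rate r i j) has_integral V T - V 0) {0..T}"
      by simp
    have "mean_square integrable_on {0..T}"
      by (intro integrable_continuous_interval continuous_on_subset[OF mean_square_continuous]) auto
    then have "((\<lambda>r. - mean_square r) has_integral - integral {0..T} mean_square) {0..T}"
      by (intro has_integral_neg integrable_integral)
    from has_integral_le[OF I this] have "V T - V 0 \<le> - integral {0..T} mean_square"
      using rate by auto
    moreover have "0 \<le> V T" unfolding V[OF T] using psd by simp
    ultimately show "integral {0..T} mean_square \<le> V 0" by linarith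
  qed
qed

end

lemma riccati_consensus:
  assumes st: "stabilizing_solution 0 B D R P" and R: "positive_definite R"
  shows "closed_loop_reaches_consensus TYPE('w) B D R P N xbar"
  unfolding closed_loop_reaches_consensus_def
proof (intro allI impI, elim conjE, rule mean_square_consensusI)
  fix M :: "'w measure" and W x0 x i
  assume data: "multi_agent_data N xbar M W x0" and cl: "closed_loop_agents B D R P N xbar M W x0 x"
    and i: "i \<in> {1..N}"
  note agent = multi_agent_data_agent[OF data i] and sol = closed_loop_deviation[OF data cl i]
  interpret linear_sde M "augmented_filtration M (W i) (\<lambda>\<omega>. x0 i \<omega> - xbar)" "W i" "\<lambda>\<omega>. x0 i \<omega> - xbar"
    "- (B ** fb_gain B D R P)" "- (D ** fb_gain B D R P)" "\<lambda>t \<omega>. x i t \<omega> - xbar"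
    using linear_sde_strong_solution[OF agent sol] .
  show "((\<lambda>t. second_moment M (\<lambda>\<omega>. x i t \<omega> - xbar)) \<longlongrightarrow> 0) at_top"
    unfolding mean_square_tendsto_iff
    using stabilizing_solution_positive(2)[OF st] riccati_lyapunov_decrease[OF st R]
    by (rule lyapunov_second_moments_tendsto_zero)
qed

section \<open>Necessity\<close>

text \<open>An infinite set is equinumerous with its square, so iterated pairing codes a tuple by a
  single point. This makes room in the type \<open>'w\<close>, for which alone consensus is assumed,
  for a finite product of copies with signs.\<close>

lemma infinite_tuple_injection:
  fixes N :: nat
  assumes inf: "infinite (UNIV :: 'w set)"
  shows "\<exists>f :: (nat \<Rightarrow> 'w \<times> bool) \<Rightarrow> 'w. inj_on f (PiE {1..N} (\<lambda>_. UNIV))"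
proof -
  have "\<exists>p. bij_betw p ((UNIV :: 'w set) \<times> (UNIV :: 'w set)) (UNIV :: 'w set)"
    using card_of_Times_same_infinite[OF inf] card_of_ordIso by blast
  then obtain p :: "'w \<times> 'w \<Rightarrow> 'w" where p: "inj p" by (auto simp: bij_betw_def)
  obtain a b :: 'w where ab: "a \<noteq> b"
    using ex_new_if_finite[OF inf, of "{undefined}"] by blast
  \<comment> \<open>The truth value is coded by one of two distinct points \<open>a\<close> and
    \<open>b\<close>.\<close>
  define q where "q z = p (fst z, if snd z then a else b)" for z :: "'w \<times> bool"
  have q: "inj q"
  proof (rule injI)
    fix y z assume "q y = q z"
    then have "fst y = fst z" "(if snd y then a else b) = (if snd z then a else b)"
      by (simp_all add: q_def inj_eq[OF p])
    then show "y = z" using ab by (cases "snd y"; cases "snd z") (simp_all add: prod_eq_iff)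
  qed
  \<comment> \<open>Coordinates are read from 1 to \<open>n\<close>; the start value
    \<open>a\<close> is a constant without information.\<close>
  define F where "F = rec_nat (\<lambda>_. a) (\<lambda>n r f. p (r f, q (f (Suc n))))"
  have F_inj: "F n f = F n g \<Longrightarrow> i \<in> {1..n} \<Longrightarrow> f i = g i" for n i and f g :: "nat \<Rightarrow> 'w \<times> bool"
  proof (induction n)
    case (Suc n)
    then have "p (F n f, q (f (Suc n))) = p (F n g, q (g (Suc n)))" by (simp add: F_def)
    then have "F n f = F n g" "f (Suc n) = g (Suc n)"
      by (simp_all add: inj_eq[OF p] inj_eq[OF q])
    then show ?case using Suc by (cases "i = Suc n") auto
  qed simp
  have "inj_on (F N) (PiE {1..N} (\<lambda>_. UNIV))"
    by (rule inj_onI, erule PiE_ext, assumption, rule F_inj)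
  then show ?thesis by blast
qed

text \<open>On a finite space a Gaussian increment would take finitely many values, a Lebesgue null
  set, with probability one.\<close>

lemma standard_brownian_motion_infinite:
  fixes M :: "'w measure"
  assumes "standard_brownian_motion M W"
  shows "infinite (UNIV :: 'w set)"
proof
  assume fin: "finite (UNIV :: 'w set)"
  interpret prob_space M using assms by (simp add: standard_brownian_motion_def)
  let ?X = "\<lambda>\<omega>. W 1 \<omega> - W 0 \<omega>"
  have D: "distributed M lborel ?X (\<lambda>y. ennreal (normal_density 0 (sqrt (1 - 0)) y))"
    using assms unfolding standard_brownian_motion_def by (metis order_refl zero_less_one)
  have fX: "finite (range ?X)" using fin by simp
  then have "range ?X \<in> null_sets lborel" by (intro finite_imp_null_set_lborel)
  moreover have "emeasure M (?X -` range ?X \<inter> space M) = 1"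
    using emeasure_space_1 by (simp add: vimage_def)
  ultimately show False
    using distributed_emeasure[OF D, of "range ?X"] nn_integral_null_set[of "range ?X" lborel]
    by (auto simp: null_sets_def)
qed

text \<open>The measure is carried over along \<open>f\<close>, and the inverse of \<open>f\<close>
  on its image is a measure-preserving map back; random variables on \<open>\<Omega>\<close> can be
  pulled back along it.\<close>

lemma embedded_probability_space:
  fixes \<Omega> :: "'v measure" and f :: "'v \<Rightarrow> 'w"
  assumes \<Omega>: "prob_space \<Omega>" and f: "inj_on f (space \<Omega>)"
  shows "\<exists>(M :: 'w measure) g. prob_space M \<and> g \<in> measurable M \<Omega> \<and> distr M \<Omega> g = \<Omega>"
proof (intro exI conjI)
  let ?M = "embed_measure \<Omega> f" and ?g = "the_inv_into (space \<Omega>) f"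
  have sp: "space ?M = f ` space \<Omega>" by (rule space_embed_measure)
  have pre: "?g -` A \<inter> space ?M = f ` A" if "A \<in> sets \<Omega>" for A
    unfolding sp using the_inv_into_vimage[OF f sets.sets_into_space[OF that]] by simp
  show "prob_space ?M"
    using prob_space.emeasure_space_1[OF \<Omega>] emeasure_embed_measure_image'[OF f sets.top] by (intro prob_spaceI) (simp add: sp)
  show g: "?g \<in> measurable ?M \<Omega>"
    by (rule measurableI) (auto simp: sp pre[unfolded sp] the_inv_into_f_f[OF f] sets_embed_measure'[OF f])
  show "distr ?M \<Omega> ?g = \<Omega>"
    by (rule measure_eqI) (simp_all add: emeasure_distr[OF g] pre emeasure_embed_measure_image'[OF f])
qed

text \<open>The coordinates of the \<open>N\<close>-fold product of \<open>Q\<close>, composed with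
  the map that realises this product on the type \<open>'w\<close>. The boolean factor of
  \<open>Q\<close> is meant for the sign.\<close>

lemma independent_copies:
  fixes Q :: "('w \<times> bool) measure" and N :: nat
  assumes Q: "prob_space Q" and inf: "infinite (UNIV :: 'w set)" and N: "N \<ge> 1"
  shows "\<exists>(M :: 'w measure) \<psi>. prob_space M \<and>
    (\<forall>i\<in>{1..N}. \<psi> i \<in> measurable M Q \<and> distr M Q (\<psi> i) = Q) \<and> prob_space.indep_vars M (\<lambda>_. Q) \<psi> {1..N}"
proof -
  interpret Q: prob_space Q by fact
  let ?\<Omega> = "PiM {1..N} (\<lambda>_. Q)"
  interpret PP: product_prob_space "\<lambda>_. Q" "{1..N}" by unfold_locales
  have \<Omega>: "prob_space ?\<Omega>" by (rule prob_space_PiM) (rule Q)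
  obtain f :: "(nat \<Rightarrow> 'w \<times> bool) \<Rightarrow> 'w" where f: "inj_on f (PiE {1..N} (\<lambda>_. UNIV))"
    using infinite_tuple_injection[OF inf] by blast
  have "inj_on f (space ?\<Omega>)" by (rule inj_on_subset[OF f]) (auto simp: space_PiM)
  from embedded_probability_space[OF \<Omega> this]
  obtain M :: "'w measure" and g where M: "prob_space M" and g: "g \<in> measurable M ?\<Omega>" and d: "distr M ?\<Omega> g = ?\<Omega>"
    by blast
  interpret M: prob_space M by fact
  define \<psi> where "\<psi> i \<omega> = g \<omega> i" for i \<omega>
  have m: "\<psi> i \<in> measurable M Q" if "i \<in> {1..N}" for i
    unfolding \<psi>_def by (rule measurable_compose[OF g measurable_component_singleton[OF that]])
  have dd: "distr M Q (\<psi> i) = Q" if "i \<in> {1..N}" for i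
  proof -
    have "distr M Q (\<psi> i) = distr (distr M ?\<Omega> g) Q (\<lambda>\<omega>. \<omega> i)"
      using g measurable_component_singleton[OF that]
      by (subst distr_distr) (auto simp: \<psi>_def[abs_def] o_def)
    also have "\<dots> = Q" unfolding d by (rule PP.PiM_component[OF that])
    finally show ?thesis .
  qed
  have "M.indep_vars (\<lambda>_. Q) \<psi> {1..N}"
  proof (subst M.indep_vars_iff_distr_eq_PiM')
    show "{1..N} \<noteq> {}" using N by auto
    have "distr M ?\<Omega> (\<lambda>x. \<lambda>i\<in>{1..N}. \<psi> i x) = distr M ?\<Omega> g"
    proof (rule distr_cong)
      fix \<omega> assume "\<omega> \<in> space M"
      then have "g \<omega> \<in> space ?\<Omega>" by (rule measurable_space[OF g])
      then show "(\<lambda>i\<in>{1..N}. \<psi> i \<omega>) = g \<omega>" by (auto simp: \<psi>_def space_PiM PiE_def extensional_restrict)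
    qed simp_all
    also have "\<dots> = PiM {1..N} (\<lambda>i. distr M Q (\<psi> i))" unfolding d by (rule PiM_cong) (simp_all add: dd)
    finally show "distr M ?\<Omega> (\<lambda>x. \<lambda>i\<in>{1..N}. \<psi> i x) = PiM {1..N} (\<lambda>i. distr M Q (\<psi> i))" .
  qed (use m in simp)
  with M m dd show ?thesis by blast
qed

lemma measure_preserving_prob:
  assumes "\<psi> \<in> measurable M Q" "distr M Q \<psi> = Q" "A \<in> sets Q"
  shows "measure M (\<psi> -` A \<inter> space M) = measure Q A"
  using measure_distr[OF assms(1,3)] assms(2) by simp

lemma independent_rv_pullback:
  assumes ind: "independent_rv Q S X T Y" and Q: "prob_space Q" and M: "prob_space M"
    and \<psi>: "\<psi> \<in> measurable M Q" "distr M Q \<psi> = Q"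
  shows "independent_rv M S (\<lambda>\<omega>. X (\<psi> \<omega>)) T (\<lambda>\<omega>. Y (\<psi> \<omega>))"
proof -
  interpret Q: prob_space Q by fact
  interpret prob_space M by fact
  have X: "X \<in> measurable Q S" and Y: "Y \<in> measurable Q T"
    and i: "Q.indep_set {X -` A \<inter> space Q | A. A \<in> sets S} {Y -` A \<inter> space Q | A. A \<in> sets T}"
    using ind by (auto simp: independent_rv_def)
  note m = measurable_compose[OF \<psi>(1) X] measurable_compose[OF \<psi>(1) Y]
  have "indep_set {(\<lambda>\<omega>. X (\<psi> \<omega>)) -` A \<inter> space M | A. A \<in> sets S} {(\<lambda>\<omega>. Y (\<psi> \<omega>)) -` A \<inter> space M | A. A \<in> sets T}"
  proof (rule indep_setI)
    fix a b assume "a \<in> {(\<lambda>\<omega>. X (\<psi> \<omega>)) -` A \<inter> space M | A. A \<in> sets S}"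
      and "b \<in> {(\<lambda>\<omega>. Y (\<psi> \<omega>)) -` A \<inter> space M | A. A \<in> sets T}"
    then obtain A B where AB: "A \<in> sets S" "a = (\<lambda>\<omega>. X (\<psi> \<omega>)) -` A \<inter> space M"
      "B \<in> sets T" "b = (\<lambda>\<omega>. Y (\<psi> \<omega>)) -` B \<inter> space M" by auto
    note s = measurable_sets[OF X AB(1)] measurable_sets[OF Y AB(3)]
    have ea: "a = \<psi> -` (X -` A \<inter> space Q) \<inter> space M" and eb: "b = \<psi> -` (Y -` B \<inter> space Q) \<inter> space M"
      and eab: "a \<inter> b = \<psi> -` ((X -` A \<inter> space Q) \<inter> (Y -` B \<inter> space Q)) \<inter> space M"
      using AB measurable_space[OF \<psi>(1)] by auto
    have "prob a = Q.prob (X -` A \<inter> space Q)" "prob b = Q.prob (Y -` B \<inter> space Q)"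
      "prob (a \<inter> b) = Q.prob ((X -` A \<inter> space Q) \<inter> (Y -` B \<inter> space Q))"
      unfolding eab unfolding ea eb by (intro measure_preserving_prob[OF \<psi>] sets.Int s)+
    moreover have "Q.prob ((X -` A \<inter> space Q) \<inter> (Y -` B \<inter> space Q)) =
        Q.prob (X -` A \<inter> space Q) * Q.prob (Y -` B \<inter> space Q)"
      using AB by (intro Q.indep_setD[OF i]) blast+
    ultimately show "prob (a \<inter> b) = prob a * prob b" by (simp only:)
  qed (use m in auto)
  then show ?thesis using m by (simp add: independent_rv_def)
qed

text \<open>Brownian motion is described by almost sure properties, laws of increments and
  independence, all of which are preserved by composition with a measure-preserving map.\<close>

lemma standard_brownian_motion_pullback:
  assumes W: "standard_brownian_motion Q W" and M: "prob_space M"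
    and \<psi>: "\<psi> \<in> measurable M Q" "distr M Q \<psi> = Q"
  shows "standard_brownian_motion M (\<lambda>t \<omega>. W t (\<psi> \<omega>))"
proof -
  have Q: "prob_space Q" using W by (simp add: standard_brownian_motion_def)
  have AE: "AE \<omega> in M. P (\<psi> \<omega>)" if "AE \<omega> in Q. P \<omega>" for P
  proof -
    have "AE \<omega> in distr M Q \<psi>. P \<omega>" unfolding \<psi>(2) by (rule that)
    then show ?thesis by (rule AE_distrD[OF \<psi>(1)])
  qed
  have dist: "distributed M lborel (\<lambda>\<omega>. X (\<psi> \<omega>)) f" if "distributed Q lborel X f" for X :: "_ \<Rightarrow> real" and f
  proof -
    have X: "X \<in> measurable Q lborel" using that by (simp add: distributed_def)
    have "distr M lborel (\<lambda>\<omega>. X (\<psi> \<omega>)) = distr (distr M Q \<psi>) lborel X"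
      using X \<psi>(1) by (subst distr_distr) (auto simp: o_def)
    then show ?thesis
      using that measurable_compose[OF \<psi>(1) X] by (simp add: distributed_def \<psi>(2))
  qed
  have ind: "independent_rv M borel (\<lambda>\<omega>. W t (\<psi> \<omega>) - W s (\<psi> \<omega>)) (PiM {0..s} (\<lambda>_. borel)) (\<lambda>\<omega>. \<lambda>r\<in>{0..s}. W r (\<psi> \<omega>))"
    if "0 \<le> s" "s < t" for s t
  proof -
    have "independent_rv Q borel (\<lambda>\<omega>. W t \<omega> - W s \<omega>) (PiM {0..s} (\<lambda>_. borel)) (\<lambda>\<omega>. \<lambda>r\<in>{0..s}. W r \<omega>)"
      using W that by (simp add: standard_brownian_motion_def)
    from independent_rv_pullback[OF this Q M \<psi>] show ?thesis .
  qed
  have m: "(\<lambda>\<omega>. W t (\<psi> \<omega>)) \<in> borel_measurable M" if "0 \<le> t" for t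
    using W that measurable_compose[OF \<psi>(1), of "W t" borel] by (simp add: standard_brownian_motion_def)
  show ?thesis
    unfolding standard_brownian_motion_def
  proof (intro conjI allI impI)
    show "AE \<omega> in M. W 0 (\<psi> \<omega>) = 0"
      using W AE[of "\<lambda>\<omega>. W 0 \<omega> = 0"] by (simp add: standard_brownian_motion_def)
    show "AE \<omega> in M. continuous_on {0..} (\<lambda>t. W t (\<psi> \<omega>))"
      using W AE[of "\<lambda>\<omega>. continuous_on {0..} (\<lambda>t. W t \<omega>)"] by (simp add: standard_brownian_motion_def)
    show "distributed M lborel (\<lambda>\<omega>. W t (\<psi> \<omega>) - W s (\<psi> \<omega>)) (\<lambda>y. ennreal (normal_density 0 (sqrt (t - s)) y))"
      if "0 \<le> s \<and> s < t" for s t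
      using W that dist[of "\<lambda>\<omega>. W t \<omega> - W s \<omega>"] by (simp add: standard_brownian_motion_def)
  qed (use M m ind in auto)
qed

text \<open>On boxes the probability factorises twice, over the copies and within each copy into its
  \<open>X\<close> and its \<open>Y\<close> part; regrouping the product gives independence of the
  two tuples. Boxes are intersection-stable and generate the product sigma-algebras.\<close>

lemma independent_rv_product:
  assumes M: "prob_space M" and Q: "prob_space Q" and I: "finite I" "I \<noteq> {}"
    and \<psi>: "prob_space.indep_vars M (\<lambda>_. Q) \<psi> I" and d: "\<And>i. i \<in> I \<Longrightarrow> distr M Q (\<psi> i) = Q"
    and ind: "independent_rv Q S X T Y"
  shows "independent_rv M (PiM I (\<lambda>_. S)) (\<lambda>\<omega>. \<lambda>i\<in>I. X (\<psi> i \<omega>)) (PiM I (\<lambda>_. T)) (\<lambda>\<omega>. \<lambda>i\<in>I. Y (\<psi> i \<omega>))"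
proof -
  interpret prob_space M by fact
  interpret Q: prob_space Q by fact
  have X: "X \<in> measurable Q S" and Y: "Y \<in> measurable Q T"
    and i: "Q.indep_set {X -` A \<inter> space Q | A. A \<in> sets S} {Y -` A \<inter> space Q | A. A \<in> sets T}"
    using ind by (auto simp: independent_rv_def)
  have \<psi>m: "\<psi> i \<in> measurable M Q" if "i \<in> I" for i using \<psi> that by (simp add: indep_vars_def)
  let ?X = "\<lambda>\<omega>. \<lambda>i\<in>I. X (\<psi> i \<omega>)" and ?Y = "\<lambda>\<omega>. \<lambda>i\<in>I. Y (\<psi> i \<omega>)"
  have Xm: "?X \<in> measurable M (PiM I (\<lambda>_. S))" and Ym: "?Y \<in> measurable M (PiM I (\<lambda>_. T))"
    using measurable_compose[OF \<psi>m X] measurable_compose[OF \<psi>m Y] by (auto intro!: measurable_restrict)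
  have gen: "{Z -` A \<inter> space M | A. A \<in> sets (PiM I (\<lambda>_. U))} =
      sigma_sets (space M) {Z -` A \<inter> space M | A. A \<in> prod_algebra I (\<lambda>_. U)}"
    if "Z \<in> measurable M (PiM I (\<lambda>_. U))" for Z and U :: "'z measure"
    unfolding sets_PiM
    by (rule sigma_sets_vimage_commute) (use measurable_space[OF that] in \<open>auto simp: space_PiM\<close>)
  have stable: "Int_stable {Z -` A \<inter> space M | A. A \<in> prod_algebra I (\<lambda>_. U)}" for Z and U :: "'z measure"
  proof (rule Int_stableI)
    fix a b assume "a \<in> {Z -` A \<inter> space M | A. A \<in> prod_algebra I (\<lambda>_. U)}"
      "b \<in> {Z -` A \<inter> space M | A. A \<in> prod_algebra I (\<lambda>_. U)}"
    then obtain A B where "A \<in> prod_algebra I (\<lambda>_. U)" "B \<in> prod_algebra I (\<lambda>_. U)"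
      "a = Z -` A \<inter> space M" "b = Z -` B \<inter> space M" by auto
    then show "a \<inter> b \<in> {Z -` A \<inter> space M | A. A \<in> prod_algebra I (\<lambda>_. U)}"
      using Int_stable_prod_algebra[of I "\<lambda>_. U"]
      by (intro CollectI exI[of _ "A \<inter> B"]) (auto simp: Int_stable_def)
  qed
  have sub: "{Z -` A \<inter> space M | A. A \<in> prod_algebra I (\<lambda>_. U)} \<subseteq> events"
    if "Z \<in> measurable M (PiM I (\<lambda>_. U))" for Z and U :: "'z measure"
    using measurable_sets[OF that] by (auto simp: sets_PiM)
  have "indep_set {?X -` A \<inter> space M | A. A \<in> prod_algebra I (\<lambda>_. S)} {?Y -` A \<inter> space M | A. A \<in> prod_algebra I (\<lambda>_. T)}"
  proof (rule indep_setI[OF sub[OF Xm] sub[OF Ym]])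
    fix a b assume "a \<in> {?X -` A \<inter> space M | A. A \<in> prod_algebra I (\<lambda>_. S)}"
      "b \<in> {?Y -` A \<inter> space M | A. A \<in> prod_algebra I (\<lambda>_. T)}"
    then obtain A B where A: "\<And>i. i \<in> I \<Longrightarrow> A i \<in> sets S" "a = ?X -` (PiE I A) \<inter> space M"
      and B: "\<And>i. i \<in> I \<Longrightarrow> B i \<in> sets T" "b = ?Y -` (PiE I B) \<inter> space M"
      by (auto simp: prod_algebra_eq_finite[OF I(1)])
    define A' where "A' i = X -` A i \<inter> space Q" for i
    define B' where "B' i = Y -` B i \<inter> space Q" for i
    have s: "A' i \<in> sets Q" "B' i \<in> sets Q" if "i \<in> I" for i
      using measurable_sets[OF X A(1)[OF that]] measurable_sets[OF Y B(1)[OF that]] by (auto simp: A'_def B'_def)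
    have sp: "\<psi> i \<omega> \<in> space Q" if "i \<in> I" "\<omega> \<in> space M" for i \<omega>
      using measurable_space[OF \<psi>m] that by auto
    have ea: "a = (\<Inter>i\<in>I. \<psi> i -` A' i \<inter> space M)" and eb: "b = (\<Inter>i\<in>I. \<psi> i -` B' i \<inter> space M)"
      and eab: "a \<inter> b = (\<Inter>i\<in>I. \<psi> i -` (A' i \<inter> B' i) \<inter> space M)"
      using A(2) B(2) I sp by (auto simp: A'_def B'_def PiE_iff)
    have pE: "prob (\<Inter>i\<in>I. \<psi> i -` E i \<inter> space M) = (\<Prod>i\<in>I. Q.prob (E i))"
      if E: "\<And>i. i \<in> I \<Longrightarrow> E i \<in> sets Q" for E
    proof -
      have "prob (\<Inter>i\<in>I. \<psi> i -` E i \<inter> space M) = (\<Prod>i\<in>I. prob (\<psi> i -` E i \<inter> space M))"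
        by (rule indep_varsD_finite[OF \<psi> I(2,1) E])
      also have "\<dots> = (\<Prod>i\<in>I. Q.prob (E i))"
        by (intro prod.cong refl measure_preserving_prob \<psi>m d E)
      finally show ?thesis .
    qed
    have "prob (a \<inter> b) = (\<Prod>i\<in>I. Q.prob (A' i \<inter> B' i))"
      unfolding eab by (intro pE sets.Int s)
    also have "\<dots> = (\<Prod>i\<in>I. Q.prob (A' i) * Q.prob (B' i))"
    proof (rule prod.cong[OF refl])
      fix j assume j: "j \<in> I"
      show "Q.prob (A' j \<inter> B' j) = Q.prob (A' j) * Q.prob (B' j)"
        using A(1)[OF j] B(1)[OF j] unfolding A'_def B'_def by (intro Q.indep_setD[OF i]) blast+
    qed
    also have "\<dots> = (\<Prod>i\<in>I. Q.prob (A' i)) * (\<Prod>i\<in>I. Q.prob (B' i))" by (rule prod.distrib)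
    also have "(\<Prod>i\<in>I. Q.prob (A' i)) = prob a" unfolding ea by (intro pE[symmetric] s)
    also have "(\<Prod>i\<in>I. Q.prob (B' i)) = prob b" unfolding eb by (intro pE[symmetric] s)
    finally show "prob (a \<inter> b) = prob a * prob b" .
  qed
  then have "indep_set {?X -` A \<inter> space M | A. A \<in> sets (PiM I (\<lambda>_. S))} {?Y -` A \<inter> space M | A. A \<in> sets (PiM I (\<lambda>_. T))}"
    unfolding gen[OF Xm] gen[OF Ym] by (rule indep_set_sigma_sets) (rule stable)+
  then show ?thesis using Xm Ym by (simp add: independent_rv_def)
qed

section \<open>Random signs\<close>

abbreviation coin :: "bool measure" where "coin \<equiv> measure_pmf (bernoulli_pmf (1 / 2))"

definition coin_sign :: "bool \<Rightarrow> real" where "coin_sign b = (if b then 1 else - 1)"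

lemma pair_prob_space_coin:
  assumes "prob_space M"
  shows "pair_prob_space M coin"
  unfolding pair_prob_space_def pair_sigma_finite_def
  using assms measure_pmf.prob_space_axioms[of "bernoulli_pmf (1 / 2)"]
    prob_space_imp_sigma_finite[OF measure_pmf.prob_space_axioms[of "bernoulli_pmf (1 / 2)"]]
    prob_space_imp_sigma_finite[OF assms] by blast

lemma measure_coin_pair:
  assumes M: "prob_space M" and S: "S \<in> sets (M \<Otimes>\<^sub>M coin)"
  shows "measure (M \<Otimes>\<^sub>M coin) S = (measure M {\<omega>. (\<omega>, True) \<in> S} + measure M {\<omega>. (\<omega>, False) \<in> S}) / 2"
proof -
  interpret M: prob_space M by fact
  interpret pair_prob_space M coin
    by (rule pair_prob_space_coin[OF M])
  have "emeasure (M \<Otimes>\<^sub>M coin) S = (\<integral>\<^sup>+ b. emeasure M ((\<lambda>\<omega>. (\<omega>, b)) -` S) \<partial>coin)"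
    by (rule emeasure_pair_measure_alt2[OF S])
  also have "\<dots> = (\<integral>\<^sup>+ b. ennreal (measure M {\<omega>. (\<omega>, b) \<in> S}) \<partial>coin)"
    by (simp add: M.emeasure_eq_measure vimage_def)
  also have "\<dots> = ennreal (measure M {\<omega>. (\<omega>, True) \<in> S}) * ennreal (1 / 2) +
      ennreal (measure M {\<omega>. (\<omega>, False) \<in> S}) * ennreal (1 - 1 / 2)"
    by (rule nn_integral_bernoulli_pmf) simp_all
  also have "\<dots> = ennreal (measure M {\<omega>. (\<omega>, True) \<in> S} * (1 / 2)) + ennreal (measure M {\<omega>. (\<omega>, False) \<in> S} * (1 - 1 / 2))"
    by (rule arg_cong2[where f = "(+)"]; rule ennreal_mult''[symmetric], simp)
  also have "\<dots> = ennreal ((measure M {\<omega>. (\<omega>, True) \<in> S} + measure M {\<omega>. (\<omega>, False) \<in> S}) / 2)"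
    by (subst ennreal_plus[symmetric]) (simp_all add: field_simps)
  finally show ?thesis by (simp add: measure_def)
qed

text \<open>For each outcome \<open>b\<close> of the coin, \<open>f b\<close> of
  \<open>\<xi>\<close> is independent of \<open>Y\<close>, and an event of \<open>Y\<close> has the
  same section for both outcomes. Averaging over the coin therefore keeps the product form.\<close>

lemma independent_rv_coin:
  assumes M: "prob_space M" and ind: "independent_rv M S \<xi> T Y"
    and f: "\<And>b. f b \<in> measurable S U"
  shows "independent_rv (M \<Otimes>\<^sub>M coin) U (\<lambda>q. f (snd q) (\<xi> (fst q))) T (\<lambda>q. Y (fst q))"
proof -
  interpret prob_space M by fact
  interpret P: pair_prob_space M coin
    by (rule pair_prob_space_coin[OF M])
  have \<xi>: "\<xi> \<in> measurable M S" and Y: "Y \<in> measurable M T"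
    and i: "indep_set {\<xi> -` A \<inter> space M | A. A \<in> sets S} {Y -` A \<inter> space M | A. A \<in> sets T}"
    using ind by (auto simp: independent_rv_def)
  let ?X = "\<lambda>q. f (snd q) (\<xi> (fst q))"
  have "(\<lambda>q. if snd q then f True (\<xi> (fst q)) else f False (\<xi> (fst q))) \<in> measurable (M \<Otimes>\<^sub>M coin) U"
  proof (rule measurable_If)
    show "{q \<in> space (M \<Otimes>\<^sub>M coin). snd q} \<in> sets (M \<Otimes>\<^sub>M coin)" by measurable
  qed (intro measurable_compose[OF measurable_compose[OF measurable_fst \<xi>] f])+
  moreover have "(\<lambda>q. if snd q then f True (\<xi> (fst q)) else f False (\<xi> (fst q))) = ?X"
    by (auto simp: fun_eq_iff)
  ultimately have X: "?X \<in> measurable (M \<Otimes>\<^sub>M coin) U" by simp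
  have Y': "(\<lambda>q. Y (fst q)) \<in> measurable (M \<Otimes>\<^sub>M coin) T" by (rule measurable_compose[OF measurable_fst Y])
  have "P.indep_set {?X -` A \<inter> space (M \<Otimes>\<^sub>M coin) | A. A \<in> sets U}
      {(\<lambda>q. Y (fst q)) -` A \<inter> space (M \<Otimes>\<^sub>M coin) | A. A \<in> sets T}"
  proof (rule P.indep_setI)
    fix a b assume "a \<in> {?X -` A \<inter> space (M \<Otimes>\<^sub>M coin) | A. A \<in> sets U}"
      "b \<in> {(\<lambda>q. Y (fst q)) -` A \<inter> space (M \<Otimes>\<^sub>M coin) | A. A \<in> sets T}"
    then obtain A B where AB: "A \<in> sets U" "a = ?X -` A \<inter> space (M \<Otimes>\<^sub>M coin)"
      "B \<in> sets T" "b = (\<lambda>q. Y (fst q)) -` B \<inter> space (M \<Otimes>\<^sub>M coin)" by auto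
    have ab: "a \<in> sets (M \<Otimes>\<^sub>M coin)" "b \<in> sets (M \<Otimes>\<^sub>M coin)"
      using AB measurable_sets[OF X] measurable_sets[OF Y'] by auto
    let ?a = "\<lambda>c. \<xi> -` (f c -` A \<inter> space S) \<inter> space M" and ?b = "Y -` B \<inter> space M"
    have sec: "{\<omega>. (\<omega>, c) \<in> a} = ?a c" "{\<omega>. (\<omega>, c) \<in> b} = ?b" "{\<omega>. (\<omega>, c) \<in> a \<inter> b} = ?a c \<inter> ?b" for c
      using AB measurable_space[OF \<xi>] by (auto simp: space_pair_measure)
    have ab_sec: "prob (?a c \<inter> ?b) = prob (?a c) * prob ?b" for c
      using AB measurable_sets[OF f AB(1)] by (intro indep_setD[OF i]) blast+
    show "P.prob (a \<inter> b) = P.prob a * P.prob b"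
      unfolding measure_coin_pair[OF M sets.Int[OF ab]] measure_coin_pair[OF M ab(1)] measure_coin_pair[OF M ab(2)]
        sec ab_sec by (simp add: field_simps)
  qed (use X Y' in auto)
  then show ?thesis using X Y' by (simp add: independent_rv_def)
qed

text \<open>For each fixed first coordinate the two signs average to zero; this is how initial
  values of arbitrary mean are centred.\<close>

lemma
  fixes f :: "'w \<Rightarrow> 'b::{banach, second_countable_topology}"
  assumes M: "prob_space M" and f: "integrable M f"
  shows integrable_sign: "integrable (M \<Otimes>\<^sub>M coin) (\<lambda>q. coin_sign (snd q) *\<^sub>R f (fst q))"
    and integral_sign: "(\<integral>q. coin_sign (snd q) *\<^sub>R f (fst q) \<partial>(M \<Otimes>\<^sub>M coin)) = 0"
proof -
  interpret prob_space M by fact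
  interpret P: pair_prob_space M coin
    by (rule pair_prob_space_coin[OF M])
  have [measurable]: "f \<in> borel_measurable M" using f by (rule borel_measurable_integrable)
  have [measurable]: "(\<lambda>q. coin_sign (snd q)) \<in> borel_measurable (M \<Otimes>\<^sub>M coin)"
    by (rule measurable_compose[OF measurable_snd]) simp
  have "integrable (M \<Otimes>\<^sub>M coin) (\<lambda>q. norm (f (fst q)) * 1)"
    using integrable_pair_mult[OF P.pair_sigma_finite_axioms integrable_norm[OF f], of "\<lambda>_. 1"] by simp
  then show i: "integrable (M \<Otimes>\<^sub>M coin) (\<lambda>q. coin_sign (snd q) *\<^sub>R f (fst q))"
    by (rule Bochner_Integration.integrable_bound) (auto simp: coin_sign_def)
  have "(\<integral>q. coin_sign (snd q) *\<^sub>R f (fst q) \<partial>(M \<Otimes>\<^sub>M coin)) = (\<integral>\<omega>. (\<integral>b. coin_sign b *\<^sub>R f \<omega> \<partial>coin) \<partial>M)"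
    using P.integral_fst'[OF i] by simp
  also have "\<dots> = 0"
    by (subst integral_measure_pmf[of UNIV]) (auto simp: UNIV_bool coin_sign_def)
  finally show "(\<integral>q. coin_sign (snd q) *\<^sub>R f (fst q) \<partial>(M \<Otimes>\<^sub>M coin)) = 0" .
qed

lemma second_moment_diff_le:
  fixes X Y Z :: "'w \<Rightarrow> real ^ 'n"
  assumes [measurable]: "X \<in> borel_measurable M" "Y \<in> borel_measurable M" "Z \<in> borel_measurable M"
  shows "second_moment M (\<lambda>\<omega>. X \<omega> - Y \<omega>) \<le>
    2 * second_moment M (\<lambda>\<omega>. X \<omega> - Z \<omega>) + 2 * second_moment M (\<lambda>\<omega>. Y \<omega> - Z \<omega>)"
proof -
  have "second_moment M (\<lambda>\<omega>. X \<omega> - Y \<omega>) \<le>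
    (\<integral>\<^sup>+\<omega>. 2 * ennreal ((norm (X \<omega> - Z \<omega>))\<^sup>2) + 2 * ennreal ((norm (Y \<omega> - Z \<omega>))\<^sup>2) \<partial>M)"
    unfolding second_moment_def
  proof (rule nn_integral_mono)
    fix \<omega>
    have "ennreal ((norm (X \<omega> - Y \<omega>))\<^sup>2) \<le> 2 * ennreal ((norm (X \<omega> - Z \<omega>))\<^sup>2) + ennreal (2 * (norm (Z \<omega> - Y \<omega>))\<^sup>2)"
      using norm_add_sq_le[of "X \<omega> - Z \<omega>" "Z \<omega> - Y \<omega>"] by simp
    then show "ennreal ((norm (X \<omega> - Y \<omega>))\<^sup>2) \<le> 2 * ennreal ((norm (X \<omega> - Z \<omega>))\<^sup>2) + 2 * ennreal ((norm (Y \<omega> - Z \<omega>))\<^sup>2)"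
      by (simp add: ennreal_mult norm_minus_commute[of "Z \<omega>"])
  qed
  also have "\<dots> = 2 * second_moment M (\<lambda>\<omega>. X \<omega> - Z \<omega>) + 2 * second_moment M (\<lambda>\<omega>. Y \<omega> - Z \<omega>)"
    by (simp add: second_moment_def nn_integral_add nn_integral_cmult)
  finally show ?thesis .
qed

lemma norm_restrict_halfspace:
  "(norm ((coin_sign b * indicator H v) *\<^sub>R y))\<^sup>2 = indicator H v * (norm y)\<^sup>2"
  by (auto simp: coin_sign_def indicator_def)

text \<open>The sign and the indicator are functions of the initial value \<open>\<theta> \<xi>\<close> itself, because
  \<open>\<theta> = sgn (h \<bullet> \<theta> \<xi>)\<close>; hence the signed and restricted process is adapted to the smaller
  filtration generated by \<open>\<theta> \<xi>\<close> and the Brownian motion.\<close>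

lemma signed_restriction_strong_solution:
  fixes M0 :: "'v measure" and \<psi> :: "'w \<Rightarrow> 'v \<times> bool" and h :: "real ^ 'n"
  assumes W0: "standard_brownian_motion M0 W0"
    and ind: "independent_rv M0 borel \<xi> (PiM {0..} (\<lambda>_. borel)) (\<lambda>\<omega>. \<lambda>t\<in>{0..}. W0 t \<omega>)"
    and sol: "strong_solution M0 W0 \<xi> (\<lambda>y. A *v y) (\<lambda>y. C *v y) x"
    and M: "prob_space M" and \<psi>: "\<psi> \<in> measurable M (M0 \<Otimes>\<^sub>M coin)" "distr M (M0 \<Otimes>\<^sub>M coin) \<psi> = M0 \<Otimes>\<^sub>M coin"
  defines "\<theta> \<equiv> \<lambda>\<omega>. coin_sign (snd (\<psi> \<omega>)) * indicator {v. 0 < inner h v} (\<xi> (fst (\<psi> \<omega>)))"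
  shows "strong_solution M (\<lambda>t \<omega>. W0 t (fst (\<psi> \<omega>))) (\<lambda>\<omega>. \<theta> \<omega> *\<^sub>R \<xi> (fst (\<psi> \<omega>))) (\<lambda>y. A *v y) (\<lambda>y. C *v y)
    (\<lambda>t \<omega>. \<theta> \<omega> *\<^sub>R x t (fst (\<psi> \<omega>)))"
    and "second_moment M0 \<xi> < \<infinity> \<Longrightarrow> second_moment M (\<lambda>\<omega>. \<theta> \<omega> *\<^sub>R \<xi> (fst (\<psi> \<omega>))) < \<infinity>"
    and "X \<in> borel_measurable M0 \<Longrightarrow> second_moment M (\<lambda>\<omega>. \<theta> \<omega> *\<^sub>R X (fst (\<psi> \<omega>))) =
      (\<integral>\<^sup>+ \<omega>. indicator {v. 0 < inner h v} (\<xi> \<omega>) * ennreal ((norm (X \<omega>))\<^sup>2) \<partial>M0)"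
proof -
  interpret M0: prob_space M0 using W0 by (simp add: standard_brownian_motion_def)
  interpret M: prob_space M by fact
  interpret BF: brownian_filtration M0 "augmented_filtration M0 W0 \<xi>" W0
    by (rule brownian_filtration_augmented[OF W0 ind])
  have \<xi>[measurable]: "\<xi> \<in> borel_measurable M0" using ind by (simp add: independent_rv_def)
  define \<phi> where "\<phi> \<omega> = fst (\<psi> \<omega>)" for \<omega>
  define W where "W t \<omega> = W0 t (\<phi> \<omega>)" for t \<omega>
  define \<eta> where "\<eta> \<omega> = \<theta> \<omega> *\<^sub>R \<xi> (\<phi> \<omega>)" for \<omega>
  have \<phi>m: "\<phi> \<in> measurable M M0" unfolding \<phi>_def[abs_def] by (rule measurable_compose[OF \<psi>(1) measurable_fst])
  have \<phi>d: "distr M M0 \<phi> = M0"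
  proof -
    have "distr M M0 \<phi> = distr (distr M (M0 \<Otimes>\<^sub>M coin) \<psi>) M0 fst"
      using \<psi>(1) by (subst distr_distr) (auto simp: \<phi>_def[abs_def] o_def)
    also have "\<dots> = M0" unfolding \<psi>(2) by (rule measure_pmf.distr_pair_fst)
    finally show ?thesis .
  qed
  have \<theta>_eq: "\<theta> \<omega> = sgn (inner h (\<eta> \<omega>))" for \<omega>
    by (auto simp: \<theta>_def \<eta>_def \<phi>_def coin_sign_def indicator_def sgn_if)
  \<comment> \<open>Where \<open>\<theta>\<close> is nonzero its square is 1, so the original
    initial value is recovered from the signed one. This makes the events of \<open>\<xi>\<close>
    visible in the smaller filtration.\<close>
  have \<xi>_eq: "\<xi> (\<phi> \<omega>) = \<theta> \<omega> *\<^sub>R \<eta> \<omega>" if "\<theta> \<omega> \<noteq> 0" for \<omega>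
    using that by (auto simp: \<theta>_def \<eta>_def coin_sign_def indicator_def split: if_splits)
  have \<theta>m: "\<theta> \<in> borel_measurable M"
  proof -
    have [measurable]: "(\<lambda>\<omega>. coin_sign (snd (\<psi> \<omega>))) \<in> borel_measurable M"
      by (rule measurable_compose[OF measurable_compose[OF \<psi>(1) measurable_snd]]) simp
    have [measurable]: "(\<lambda>\<omega>. \<xi> (fst (\<psi> \<omega>))) \<in> borel_measurable M"
      using measurable_compose[OF \<phi>m \<xi>] by (simp add: \<phi>_def)
    show ?thesis unfolding \<theta>_def by measurable
  qed
  have \<eta>m: "\<eta> \<in> borel_measurable M"
    unfolding \<eta>_def[abs_def] by (intro borel_measurable_scaleR \<theta>m measurable_compose[OF \<phi>m \<xi>])
  have Wm: "W t \<in> borel_measurable M" if "0 \<le> t" for t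
    using W0 that measurable_compose[OF \<phi>m, of "W0 t" borel] by (simp add: standard_brownian_motion_def W_def[abs_def])
  let ?F = "augmented_filtration M W \<eta>"
  have \<theta>F: "\<theta> \<in> borel_measurable (?F s)" for s
  proof -
    note [measurable] = augmented_filtration_initial_measurable[of \<eta> M W s]
    have "(\<lambda>\<omega>. sgn (inner h (\<eta> \<omega>))) \<in> borel_measurable (?F s)" by measurable
    then show ?thesis by (simp add: \<theta>_eq[abs_def])
  qed
  interpret T: solution_transfer M0 "augmented_filtration M0 W0 \<xi>" W0 M ?F \<phi> \<theta>
  proof
    show "\<phi> \<in> measurable M M0" "distr M M0 \<phi> = M0" by (fact \<phi>m, fact \<phi>d)
    show "\<bar>\<theta> \<omega>\<bar> \<le> 1" for \<omega> by (auto simp: \<theta>_def coin_sign_def indicator_def)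
    show "\<theta> \<in> borel_measurable (?F s)" for s by (rule \<theta>F)
    show "space (?F s) = space M" for s by (rule augmented_filtration_space)
    show "sets (?F s) \<subseteq> sets M" for s by (rule augmented_filtration_subset[OF \<eta>m Wm])
    fix s :: real and S assume "0 \<le> s" and "S \<in> sets (augmented_filtration M0 W0 \<xi> s)"
    have nz: "{\<omega> \<in> space M. \<theta> \<omega> \<noteq> 0} \<in> sets (?F s)"
    proof -
      have "\<theta> -` (- {0}) \<inter> space (?F s) \<in> sets (?F s)" by (rule measurable_sets[OF \<theta>F]) simp
      then show ?thesis by (simp add: augmented_filtration_space vimage_def Int_def conj_commute)
    qed
    from \<open>S \<in> sets (augmented_filtration M0 W0 \<xi> s)\<close>
    show "\<phi> -` S \<inter> {\<omega> \<in> space M. \<theta> \<omega> \<noteq> 0} \<in> sets (?F s)"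
      unfolding augmented_filtration_sets[of M0]
    proof (induction rule: sigma_sets.induct)
      case (Basic a)
      then consider (init) B where "B \<in> sets borel" "a = \<xi> -` B \<inter> space M0"
        | (path) r B where "0 \<le> r" "r \<le> s" "B \<in> sets borel" "a = W0 r -` B \<inter> space M0"
        | (null) "a \<in> null_sets M0" by blast
      then show ?case
      proof cases
        case init
        have "(\<lambda>\<omega>. \<theta> \<omega> *\<^sub>R \<eta> \<omega>) \<in> borel_measurable (?F s)"
          by (intro borel_measurable_scaleR \<theta>F augmented_filtration_initial_measurable)
        from measurable_sets[OF this init(1)]
        have "(\<lambda>\<omega>. \<theta> \<omega> *\<^sub>R \<eta> \<omega>) -` B \<inter> space M \<in> sets (?F s)" by (simp add: augmented_filtration_space)
        moreover have "\<phi> -` a \<inter> {\<omega> \<in> space M. \<theta> \<omega> \<noteq> 0} =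
            ((\<lambda>\<omega>. \<theta> \<omega> *\<^sub>R \<eta> \<omega>) -` B \<inter> space M) \<inter> {\<omega> \<in> space M. \<theta> \<omega> \<noteq> 0}"
          using \<xi>_eq measurable_space[OF \<phi>m] by (auto simp: init(2))
        ultimately show ?thesis using nz by (simp add: sets.Int)
      next
        case path
        have "W r -` B \<inter> space (?F s) \<in> sets (?F s)"
          using augmented_filtration_brownian_measurable[OF path(1,2)] path(3) by (rule measurable_sets)
        moreover have "\<phi> -` a \<inter> {\<omega> \<in> space M. \<theta> \<omega> \<noteq> 0} = (W r -` B \<inter> space (?F s)) \<inter> {\<omega> \<in> space M. \<theta> \<omega> \<noteq> 0}"
          using measurable_space[OF \<phi>m] by (auto simp: path(4) W_def augmented_filtration_space)
        ultimately show ?thesis using nz by (simp add: sets.Int)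
      next
        case null
        then have "emeasure (distr M M0 \<phi>) a = 0" unfolding \<phi>d by auto
        then have "\<phi> -` a \<inter> space M \<in> null_sets M"
          using null measurable_sets[OF \<phi>m] by (subst (asm) emeasure_distr[OF \<phi>m]) auto
        then have "\<phi> -` a \<inter> space M \<in> sets (?F s)"
          unfolding augmented_filtration_sets by (intro sigma_sets.Basic) blast
        moreover have "\<phi> -` a \<inter> {\<omega> \<in> space M. \<theta> \<omega> \<noteq> 0} = (\<phi> -` a \<inter> space M) \<inter> {\<omega> \<in> space M. \<theta> \<omega> \<noteq> 0}" by auto
        ultimately show ?thesis using nz by (simp add: sets.Int)
      qed
    next
      case Empty
      then show ?case by simp
    next
      case (Compl a)
      have "\<phi> -` (space M0 - a) \<inter> {\<omega> \<in> space M. \<theta> \<omega> \<noteq> 0} =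
          {\<omega> \<in> space M. \<theta> \<omega> \<noteq> 0} - (\<phi> -` a \<inter> {\<omega> \<in> space M. \<theta> \<omega> \<noteq> 0})"
        using measurable_space[OF \<phi>m] by auto
      then show ?case using Compl nz by (simp add: sets.Diff)
    next
      case (Union a)
      have eq: "\<phi> -` (\<Union>i. a i) \<inter> {\<omega> \<in> space M. \<theta> \<omega> \<noteq> 0} = (\<Union>i. \<phi> -` a i \<inter> {\<omega> \<in> space M. \<theta> \<omega> \<noteq> 0})" by auto
      show ?case unfolding eq using Union.IH by (intro sets.countable_nat_UN) auto
    qed
  qed
  show "strong_solution M (\<lambda>t \<omega>. W0 t (fst (\<psi> \<omega>))) (\<lambda>\<omega>. \<theta> \<omega> *\<^sub>R \<xi> (fst (\<psi> \<omega>))) (\<lambda>y. A *v y) (\<lambda>y. C *v y)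
    (\<lambda>t \<omega>. \<theta> \<omega> *\<^sub>R x t (fst (\<psi> \<omega>)))"
    using T.transfer_ito_solution[OF sol[unfolded strong_solution_iff_ito_solution]]
    unfolding strong_solution_iff_ito_solution by (simp add: \<eta>_def[abs_def] W_def[abs_def] \<phi>_def)
  show "second_moment M (\<lambda>\<omega>. \<theta> \<omega> *\<^sub>R \<xi> (fst (\<psi> \<omega>))) < \<infinity>" if "second_moment M0 \<xi> < \<infinity>"
    using le_less_trans[OF T.transfer_second_moment_le[OF \<xi>] that] by (simp add: \<phi>_def)
  show "second_moment M (\<lambda>\<omega>. \<theta> \<omega> *\<^sub>R X (fst (\<psi> \<omega>))) =
      (\<integral>\<^sup>+ \<omega>. indicator {v. 0 < inner h v} (\<xi> \<omega>) * ennreal ((norm (X \<omega>))\<^sup>2) \<partial>M0)"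
    if [measurable]: "X \<in> borel_measurable M0"
  proof -
    have "second_moment M (\<lambda>\<omega>. \<theta> \<omega> *\<^sub>R X (fst (\<psi> \<omega>))) =
        (\<integral>\<^sup>+ \<omega>. indicator {v. 0 < inner h v} (\<xi> (\<phi> \<omega>)) * ennreal ((norm (X (\<phi> \<omega>)))\<^sup>2) \<partial>M)"
      unfolding second_moment_def \<theta>_def norm_restrict_halfspace
      by (intro nn_integral_cong) (auto simp: \<phi>_def indicator_def)
    also have "\<dots> = (\<integral>\<^sup>+ \<omega>. indicator {v. 0 < inner h v} (\<xi> \<omega>) * ennreal ((norm (X \<omega>))\<^sup>2) \<partial>M0)"
      by (rule T.transfer_nn_integral) measurable
    finally show ?thesis .
  qed
qed

text \<open>Two agents of the constructed system decide. Their deviations are independent and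
  centred, so the mean square of the difference is the sum of both mean squares, while convergence
  to a common limit makes the difference vanish. The mean square of one signed copy is the integral
  over the half-space.\<close>

lemma consensus_imp_halfspace_decay:
  fixes M0 :: "'w measure" and h :: "real ^ 'n" and B D :: "real ^ 'm ^ 'n"
    and R :: "real ^ 'm ^ 'm" and P :: "real ^ 'n ^ 'n"
  defines "A \<equiv> - (B ** fb_gain B D R P)" and "C \<equiv> - (D ** fb_gain B D R P)"
  assumes N: "N \<ge> 2" and consensus: "closed_loop_reaches_consensus TYPE('w) B D R P N xbar"
    and W0: "standard_brownian_motion M0 W0"
    and ind: "independent_rv M0 borel \<xi> (PiM {0..} (\<lambda>_. borel)) (\<lambda>\<omega>. \<lambda>t\<in>{0..}. W0 t \<omega>)"
    and \<xi>2: "second_moment M0 \<xi> < \<infinity>"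
    and sol: "strong_solution M0 W0 \<xi> (\<lambda>y. A *v y) (\<lambda>y. C *v y) x"
  shows "((\<lambda>t. \<integral>\<^sup>+ \<omega>. indicator {v. 0 < inner h v} (\<xi> \<omega>) * ennreal ((norm (x t \<omega>))\<^sup>2) \<partial>M0) \<longlongrightarrow> 0) at_top"
proof -
  have M0: "prob_space M0" using W0 by (simp add: standard_brownian_motion_def)
  interpret M0: prob_space M0 by fact
  interpret S0: linear_sde M0 "augmented_filtration M0 W0 \<xi>" W0 \<xi> A C x
    by (rule linear_sde_strong_solution[OF W0 \<xi>2 ind sol])
  let ?Q = "M0 \<Otimes>\<^sub>M coin" and ?H = "{v. 0 < inner h v}"
  interpret Q: pair_prob_space M0 coin by (rule pair_prob_space_coin[OF M0])
  have Q: "prob_space ?Q" by (rule Q.prob_space_axioms)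
  have "N \<ge> 1" using N by simp
  then obtain M :: "'w measure" and \<psi> where "prob_space M \<and>
    (\<forall>i\<in>{1..N}. \<psi> i \<in> measurable M ?Q \<and> distr M ?Q (\<psi> i) = ?Q) \<and> prob_space.indep_vars M (\<lambda>_. ?Q) \<psi> {1..N}"
    using independent_copies[OF Q standard_brownian_motion_infinite[OF W0]] by metis
  then have M: "prob_space M"
    and \<psi>: "\<And>i. i \<in> {1..N} \<Longrightarrow> \<psi> i \<in> measurable M ?Q" "\<And>i. i \<in> {1..N} \<Longrightarrow> distr M ?Q (\<psi> i) = ?Q"
    and iid: "prob_space.indep_vars M (\<lambda>_. ?Q) \<psi> {1..N}"
    by blast+
  interpret M: prob_space M by fact
  have \<phi>: "(\<lambda>\<omega>. fst (\<psi> i \<omega>)) \<in> measurable M M0" "distr M M0 (\<lambda>\<omega>. fst (\<psi> i \<omega>)) = M0" if "i \<in> {1..N}" for i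
  proof -
    show "(\<lambda>\<omega>. fst (\<psi> i \<omega>)) \<in> measurable M M0" by (rule measurable_compose[OF \<psi>(1)[OF that] measurable_fst])
    have "distr M M0 (\<lambda>\<omega>. fst (\<psi> i \<omega>)) = distr (distr M ?Q (\<psi> i)) M0 fst"
      using \<psi>(1)[OF that] by (subst distr_distr) (auto simp: o_def)
    also have "\<dots> = M0" unfolding \<psi>(2)[OF that] by (rule measure_pmf.distr_pair_fst)
    finally show "distr M M0 (\<lambda>\<omega>. fst (\<psi> i \<omega>)) = M0" .
  qed
  define \<Theta> where "\<Theta> q = coin_sign (snd q) * indicator ?H (\<xi> (fst q))" for q :: "'w \<times> bool"
  define W where "W i t \<omega> = W0 t (fst (\<psi> i \<omega>))" for i t \<omega>
  define \<eta> where "\<eta> i \<omega> = \<Theta> (\<psi> i \<omega>) *\<^sub>R \<xi> (fst (\<psi> i \<omega>))" for i \<omega>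
  define y where "y i t \<omega> = \<Theta> (\<psi> i \<omega>) *\<^sub>R x t (fst (\<psi> i \<omega>))" for i t \<omega>
  have \<xi>m[measurable]: "\<xi> \<in> borel_measurable M0" by (rule S0.initial_measurable)
  have sgn_ind: "\<Theta> q *\<^sub>R X (fst q) = coin_sign (snd q) *\<^sub>R (indicator ?H (\<xi> (fst q)) *\<^sub>R X (fst q))" for X :: "'w \<Rightarrow> real ^ 'n" and q
    by (simp add: \<Theta>_def)
  have \<eta>_sol: "strong_solution M (W i) (\<eta> i) (\<lambda>y. A *v y) (\<lambda>y. C *v y) (y i)"
    and \<eta>2: "second_moment M (\<eta> i) < \<infinity>"
    and y2: "X \<in> borel_measurable M0 \<Longrightarrow> second_moment M (\<lambda>\<omega>. \<Theta> (\<psi> i \<omega>) *\<^sub>R X (fst (\<psi> i \<omega>))) =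
      (\<integral>\<^sup>+ \<omega>. indicator ?H (\<xi> \<omega>) * ennreal ((norm (X \<omega>))\<^sup>2) \<partial>M0)"
    if "i \<in> {1..N}" for i and X :: "'w \<Rightarrow> real ^ 'n"
    using signed_restriction_strong_solution[OF W0 ind sol M \<psi>(1)[OF that] \<psi>(2)[OF that], where h = h] \<xi>2
    by (simp_all add: W_def[abs_def] \<eta>_def[abs_def] y_def[abs_def] \<Theta>_def)
  have bm: "standard_brownian_motion M (W i)" if "i \<in> {1..N}" for i
    using standard_brownian_motion_pullback[OF W0 M \<phi>[OF that]] by (simp add: W_def[abs_def])
  have indQ: "independent_rv ?Q borel (\<lambda>q. \<Theta> q *\<^sub>R \<xi> (fst q)) (PiM {0..} (\<lambda>_. borel)) (\<lambda>q. \<lambda>t\<in>{0..}. W0 t (fst q))"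
  proof -
    have "(\<lambda>v. (coin_sign b * indicator ?H v) *\<^sub>R v) \<in> borel_measurable borel" for b by measurable
    from independent_rv_coin[OF M0 ind, of "\<lambda>b v. (coin_sign b * indicator ?H v) *\<^sub>R v" borel, OF this]
    show ?thesis by (simp add: \<Theta>_def)
  qed
  then have Xm: "(\<lambda>q. \<Theta> q *\<^sub>R \<xi> (fst q)) \<in> borel_measurable ?Q"
    and Ym: "(\<lambda>q. \<lambda>t\<in>{0..}. W0 t (fst q)) \<in> measurable ?Q (PiM {0..} (\<lambda>_. borel))"
    by (simp_all add: independent_rv_def)
  have ind_i: "independent_rv M borel (\<eta> i) (PiM {0..} (\<lambda>_. borel)) (\<lambda>\<omega>. \<lambda>t\<in>{0..}. W i t \<omega>)" if "i \<in> {1..N}" for i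
    using independent_rv_pullback[OF indQ Q M \<psi>(1)[OF that] \<psi>(2)[OF that]] by (simp add: \<eta>_def[abs_def] W_def)
  \<comment> \<open>Stated for a general \<open>X\<close> because it serves twice: for the initial
    value, to obtain the mean \<open>xbar\<close>, and for the state at a time \<open>t\<close>, to
    obtain orthogonality of two agents.\<close>
  have mean0: "integrable M (\<lambda>\<omega>. \<Theta> (\<psi> i \<omega>) *\<^sub>R X (fst (\<psi> i \<omega>)))" "(LINT \<omega>|M. \<Theta> (\<psi> i \<omega>) *\<^sub>R X (fst (\<psi> i \<omega>))) = 0"
    if i: "i \<in> {1..N}" and X: "X \<in> borel_measurable M0" "integrable M0 X" for i and X :: "'w \<Rightarrow> real ^ 'n"
  proof -
    note [measurable] = X(1)
    have "integrable M0 (\<lambda>\<omega>. indicator ?H (\<xi> \<omega>) *\<^sub>R X \<omega>)"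
      by (rule Bochner_Integration.integrable_bound[OF X(2)]) (auto simp: indicator_def)
    note s = integrable_sign[OF M0 this] integral_sign[OF M0 this]
    have "integrable (distr M ?Q (\<psi> i)) (\<lambda>q. \<Theta> q *\<^sub>R X (fst q))" unfolding \<psi>(2)[OF i] sgn_ind by (rule s(1))
    then show "integrable M (\<lambda>\<omega>. \<Theta> (\<psi> i \<omega>) *\<^sub>R X (fst (\<psi> i \<omega>)))" by (rule integrable_distr[OF \<psi>(1)[OF i]])
    have "(LINT \<omega>|M. \<Theta> (\<psi> i \<omega>) *\<^sub>R X (fst (\<psi> i \<omega>))) = (LINT q|distr M ?Q (\<psi> i). \<Theta> q *\<^sub>R X (fst q))"
      using borel_measurable_integrable[OF s(1)] by (intro integral_distr[symmetric] \<psi>(1)[OF i]) (simp add: sgn_ind)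
    also have "\<dots> = 0" unfolding \<psi>(2)[OF i] sgn_ind by (rule s(2))
    finally show "(LINT \<omega>|M. \<Theta> (\<psi> i \<omega>) *\<^sub>R X (fst (\<psi> i \<omega>))) = 0" .
  qed
  have vec_int: "integrable M0 X" if "X \<in> borel_measurable M0" "\<And>k. square_integrable M0 (\<lambda>\<omega>. X \<omega> $ k)" for X :: "'w \<Rightarrow> real ^ 'n"
  proof -
    have "integrable M0 (\<lambda>\<omega>. \<Sum>k\<in>UNIV. \<bar>X \<omega> $ k\<bar>)"
      using square_integrable_imp_integrable_finite[OF M0.finite_measure_axioms that(2)] by simp
    then show ?thesis
      by (rule Bochner_Integration.integrable_bound[OF _ that(1)])
         (auto intro!: order_trans[OF norm_le_l1_cart] simp: sum_nonneg)
  qed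
  have data: "multi_agent_data N xbar M W (\<lambda>i \<omega>. \<eta> i \<omega> + xbar)"
    unfolding multi_agent_data_def
  proof (intro conjI ballI)
    show "prob_space M" by fact
    show "standard_brownian_motion M (W i)" if "i \<in> {1..N}" for i by (rule bm[OF that])
    show "M.indep_vars (\<lambda>_. PiM {0..} (\<lambda>_. borel)) (\<lambda>i \<omega>. \<lambda>t\<in>{0..}. W i t \<omega>) {1..N}"
      using M.indep_vars_compose2[OF iid, of "\<lambda>_ q. \<lambda>t\<in>{0..}. W0 t (fst q)" "\<lambda>_. PiM {0..} (\<lambda>_. borel)"] Ym
      by (simp add: W_def)
    have X'm: "(\<lambda>q. \<Theta> q *\<^sub>R \<xi> (fst q) + xbar) \<in> borel_measurable ?Q" using Xm by simp
    show "M.indep_vars (\<lambda>_. borel) (\<lambda>i \<omega>. \<eta> i \<omega> + xbar) {1..N}"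
      using M.indep_vars_compose2[OF iid, of "\<lambda>_ q. \<Theta> q *\<^sub>R \<xi> (fst q) + xbar" "\<lambda>_. borel"] X'm
      by (simp add: \<eta>_def)
    have "independent_rv ?Q borel (\<lambda>q. \<Theta> q *\<^sub>R \<xi> (fst q) + xbar) (PiM {0..} (\<lambda>_. borel)) (\<lambda>q. \<lambda>t\<in>{0..}. W0 t (fst q))"
      by (rule independent_rv_compose[OF indQ Q, of "\<lambda>v. v + xbar" borel "\<lambda>w. w"]) simp_all
    from independent_rv_product[OF M Q _ _ iid \<psi>(2) this] N
    have joint: "independent_rv M (PiM {1..N} (\<lambda>_. borel)) (\<lambda>\<omega>. \<lambda>i\<in>{1..N}. \<eta> i \<omega> + xbar)
        (PiM {1..N} (\<lambda>_. PiM {0..} (\<lambda>_. borel))) (\<lambda>\<omega>. \<lambda>i\<in>{1..N}. \<lambda>t\<in>{0..}. W i t \<omega>)"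
      by (simp add: \<eta>_def W_def)
    \<comment> \<open>The product lemma yields a tuple of paths, whereas
      \<open>multi_agent_data\<close> asks for one family indexed by pairs of agent and time;
      uncurrying is measurable.\<close>
    have "(\<lambda>w. \<lambda>p\<in>{1..N} \<times> {0::real..}. w (fst p) (snd p)) \<in>
        measurable (PiM {1..N} (\<lambda>_. PiM {0..} (\<lambda>_. borel :: real measure))) (PiM ({1..N} \<times> {0..}) (\<lambda>_. borel))"
    proof (rule measurable_restrict)
      fix p assume "p \<in> {1..N} \<times> {0::real..}"
      then have p: "fst p \<in> {1..N}" "snd p \<in> {0..}" by auto
      have "(\<lambda>w. w (fst p)) \<in> measurable (PiM {1..N} (\<lambda>_. PiM {0..} (\<lambda>_. borel :: real measure))) (PiM {0..} (\<lambda>_. borel))"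
        by (rule measurable_component_singleton[OF p(1)])
      then show "(\<lambda>w. w (fst p) (snd p)) \<in> borel_measurable (PiM {1..N} (\<lambda>_. PiM {0..} (\<lambda>_. borel :: real measure)))"
        by (rule measurable_compose) (rule measurable_component_singleton[OF p(2)])
    qed
    from independent_rv_compose[OF joint M measurable_ident this]
    have "independent_rv M (PiM {1..N} (\<lambda>_. borel)) (\<lambda>\<omega>. id (\<lambda>i\<in>{1..N}. \<eta> i \<omega> + xbar))
       (PiM ({1..N} \<times> {0..}) (\<lambda>_. borel))
       (\<lambda>\<omega>. \<lambda>p\<in>{1..N} \<times> {0..}. (\<lambda>i\<in>{1..N}. \<lambda>t\<in>{0..}. W i t \<omega>) (fst p) (snd p))" .
    moreover have "(\<lambda>p\<in>{1..N} \<times> {0..}. (\<lambda>i\<in>{1..N}. \<lambda>t\<in>{0..}. W i t \<omega>) (fst p) (snd p)) =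
        (\<lambda>p\<in>{1..N} \<times> {0..}. W (fst p) (snd p) \<omega>)" for \<omega>
      by (rule restrict_ext) auto
    ultimately show "independent_rv M (PiM {1..N} (\<lambda>_. borel)) (\<lambda>\<omega>. \<lambda>i\<in>{1..N}. \<eta> i \<omega> + xbar)
       (PiM ({1..N} \<times> {0..}) (\<lambda>_. borel)) (\<lambda>\<omega>. \<lambda>p\<in>{1..N} \<times> {0..}. W (fst p) (snd p) \<omega>)"
      by simp
    show "integrable M (\<lambda>\<omega>. \<eta> i \<omega> + xbar)" "(LINT \<omega>|M. \<eta> i \<omega> + xbar) = xbar" if "i \<in> {1..N}" for i
      using mean0[OF that \<xi>m vec_int[OF \<xi>m S0.initial_square_integrable]]
      by (simp_all add: \<eta>_def[abs_def] M.prob_space)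
    have fin: "second_moment M (\<lambda>\<omega>. \<eta> i \<omega> + xbar) < \<infinity>" if "i \<in> {1..N}" for i
      using ind_i[OF that] by (intro second_moment_shift_finite[OF M _ \<eta>2[OF that]]) (simp add: independent_rv_def)
    show "\<exists>c::real. \<forall>i\<in>{1..N}. second_moment M (\<lambda>\<omega>. \<eta> i \<omega> + xbar) \<le> ennreal c"
    proof (intro exI ballI)
      fix i assume i: "i \<in> {1..N}"
      \<comment> \<open>Each of the finitely many moments is finite, and their sum serves as the
        common bound.\<close>
      let ?f = "\<lambda>i. enn2real (second_moment M (\<lambda>\<omega>. \<eta> i \<omega> + xbar))"
      have "?f i \<le> (\<Sum>i\<in>{1..N}. ?f i)" by (rule member_le_sum[OF i]) auto
      then have "ennreal (?f i) \<le> ennreal (\<Sum>i\<in>{1..N}. ?f i)" by (rule ennreal_leI)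
      then show "second_moment M (\<lambda>\<omega>. \<eta> i \<omega> + xbar) \<le> ennreal (\<Sum>i\<in>{1..N}. ?f i)" using fin[OF i] by simp
    qed
  qed
  have closed: "closed_loop_agents B D R P N xbar M W (\<lambda>i \<omega>. \<eta> i \<omega> + xbar) (\<lambda>i t \<omega>. y i t \<omega> + xbar)"
    unfolding closed_loop_agents_def
    using strong_solution_shift[OF M \<eta>_sol, of _ xbar] by (simp add: A_def C_def)
  obtain xs where xs: "xs \<in> borel_measurable M"
    "\<And>i. i \<in> {1..N} \<Longrightarrow> ((\<lambda>t. second_moment M (\<lambda>\<omega>. y i t \<omega> + xbar - xs \<omega>)) \<longlongrightarrow> 0) at_top"
    using consensus data closed unfolding closed_loop_reaches_consensus_def mean_square_consensus_def by blast
  have one: "1 \<in> {1..N}" and two: "2 \<in> {1..N}" using N by auto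
  have S: "linear_sde M (augmented_filtration M (W i) (\<eta> i)) (W i) (\<eta> i) A C (y i)" if "i \<in> {1..N}" for i
    by (rule linear_sde_strong_solution[OF bm \<eta>2 ind_i \<eta>_sol]) (fact that)+
  interpret S1: linear_sde M "augmented_filtration M (W 1) (\<eta> 1)" "W 1" "\<eta> 1" A C "y 1" by (rule S[OF one])
  interpret S2: linear_sde M "augmented_filtration M (W 2) (\<eta> 2)" "W 2" "\<eta> 2" A C "y 2" by (rule S[OF two])
  have bound: "second_moment M (y 1 t) \<le>
      2 * second_moment M (\<lambda>\<omega>. y 1 t \<omega> + xbar - xs \<omega>) + 2 * second_moment M (\<lambda>\<omega>. y 2 t \<omega> + xbar - xs \<omega>)"
    if t: "0 \<le> t" for t
  proof -
    have y_zero: "M.expectation (\<lambda>\<omega>. y i t \<omega> $ k) = 0" if i: "i \<in> {1..N}" for i k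
    proof -
      note m = mean0[OF i S0.x_measurable[OF t] vec_int[OF S0.x_measurable[OF t] S0.x_square_integrable[OF t]]]
      from integral_bounded_linear[OF bounded_linear_vec_nth m(1), of k] m(2) show ?thesis
        by (simp add: y_def)
    qed
    have indep: "M.indep_vars (\<lambda>_. borel) (\<lambda>i \<omega>. y i t \<omega> $ k) {1, 2}" for k
    proof -
      have "(\<lambda>q. coin_sign (snd q)) \<in> borel_measurable ?Q" by (rule measurable_compose[OF measurable_snd]) simp
      note [measurable] = this S0.x_measurable[OF t]
      have "(\<lambda>q. (\<Theta> q *\<^sub>R x t (fst q)) $ k) \<in> borel_measurable ?Q"
        unfolding \<Theta>_def by measurable
      then have "M.indep_vars (\<lambda>_. borel) (\<lambda>i \<omega>. y i t \<omega> $ k) {1..N}"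
        using M.indep_vars_compose2[OF iid, of "\<lambda>_ q. (\<Theta> q *\<^sub>R x t (fst q)) $ k" "\<lambda>_. borel"]
        by (simp add: y_def)
      then show ?thesis by (rule M.indep_vars_subset) (use N in auto)
    qed
    note sq1 = S1.x_square_integrable[OF t] and sq2 = S2.x_square_integrable[OF t]
    have orth: "M.expectation (\<lambda>\<omega>. y 1 t \<omega> $ k * y 2 t \<omega> $ k) = 0" for k
    proof -
      have "integrable M (\<lambda>\<omega>. y i t \<omega> $ k)" if "i \<in> {1, 2}" for i
        using that square_integrable_imp_integrable_finite[OF M.finite_measure_axioms sq1]
          square_integrable_imp_integrable_finite[OF M.finite_measure_axioms sq2] by auto
      from M.indep_vars_lebesgue_integral[OF _ indep this] show ?thesis
        using y_zero[OF one] by simp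
    qed
    have d: "integrable M (\<lambda>\<omega>. (norm (y 1 t \<omega> - y 2 t \<omega>))\<^sup>2)"
      "M.expectation (\<lambda>\<omega>. (norm (y 1 t \<omega> - y 2 t \<omega>))\<^sup>2) = S1.mean_square t + S2.mean_square t"
    proof -
      have n: "(norm (v - w))\<^sup>2 = (norm v)\<^sup>2 + (norm w)\<^sup>2 - 2 * (\<Sum>k\<in>UNIV. v $ k * w $ k)" for v w :: "real ^ 'n"
        by (simp add: power2_norm_eq_inner inner_diff_left inner_diff_right inner_vec_def[symmetric] inner_commute[of w v])
          (simp add: inner_vec_def)
      show "integrable M (\<lambda>\<omega>. (norm (y 1 t \<omega> - y 2 t \<omega>))\<^sup>2)"
        unfolding n using S1.norm_sq_x_integrable(1)[OF t] S2.norm_sq_x_integrable(1)[OF t] square_integrable_mult[OF sq1 sq2]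
        by (intro Bochner_Integration.integrable_diff Bochner_Integration.integrable_add
            Bochner_Integration.integrable_mult_right Bochner_Integration.integrable_sum)
      show "M.expectation (\<lambda>\<omega>. (norm (y 1 t \<omega> - y 2 t \<omega>))\<^sup>2) = S1.mean_square t + S2.mean_square t"
        unfolding n using S1.norm_sq_x_integrable(1)[OF t] S2.norm_sq_x_integrable(1)[OF t] square_integrable_mult[OF sq1 sq2]
        by (simp add: Bochner_Integration.integral_sum orth S1.mean_square_def S2.mean_square_def del: One_nat_def)
    qed
    have "second_moment M (y 1 t) = ennreal (S1.mean_square t)" by (rule S1.second_moment_eq_mean_square[OF t])
    also have "\<dots> \<le> ennreal (S1.mean_square t + S2.mean_square t)"
      using S2.mean_square_nonneg by (intro ennreal_leI) simp
    also have "\<dots> = second_moment M (\<lambda>\<omega>. y 1 t \<omega> - y 2 t \<omega>)"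
      unfolding second_moment_def using d by (subst nn_integral_eq_integral) auto
    \<comment> \<open>The deviations approach \<open>xs\<close> minus \<open>xbar\<close>, which is
      inserted as the intermediate variable.\<close>
    also have "\<dots> \<le> 2 * second_moment M (\<lambda>\<omega>. y 1 t \<omega> - (xs \<omega> - xbar)) + 2 * second_moment M (\<lambda>\<omega>. y 2 t \<omega> - (xs \<omega> - xbar))"
      using xs(1) by (intro second_moment_diff_le S1.x_measurable S2.x_measurable t) simp
    finally show ?thesis by (simp add: algebra_simps)
  qed
  have "((\<lambda>t. second_moment M (y 1 t)) \<longlongrightarrow> 0) at_top"
  proof (rule tendsto_sandwich[OF _ _ tendsto_const])
    show "\<forall>\<^sub>F t in at_top. second_moment M (y 1 t) \<le>
      2 * second_moment M (\<lambda>\<omega>. y 1 t \<omega> + xbar - xs \<omega>) + 2 * second_moment M (\<lambda>\<omega>. y 2 t \<omega> + xbar - xs \<omega>)"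
      using eventually_ge_at_top[of 0] by eventually_elim (rule bound)
    have "((\<lambda>t. 2 * second_moment M (\<lambda>\<omega>. y 1 t \<omega> + xbar - xs \<omega>) + 2 * second_moment M (\<lambda>\<omega>. y 2 t \<omega> + xbar - xs \<omega>))
      \<longlongrightarrow> 2 * 0 + 2 * 0) at_top"
      by (intro tendsto_add ennreal_tendsto_cmult xs(2) one two) simp_all
    then show "((\<lambda>t. 2 * second_moment M (\<lambda>\<omega>. y 1 t \<omega> + xbar - xs \<omega>) + 2 * second_moment M (\<lambda>\<omega>. y 2 t \<omega> + xbar - xs \<omega>))
      \<longlongrightarrow> 0) at_top" by simp
  qed simp
  moreover have "\<forall>\<^sub>F t in at_top. second_moment M (y 1 t) =
      (\<integral>\<^sup>+ \<omega>. indicator ?H (\<xi> \<omega>) * ennreal ((norm (x t \<omega>))\<^sup>2) \<partial>M0)"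
    using eventually_ge_at_top[of 0]
  proof eventually_elim
    case (elim t)
    from y2[OF one S0.x_measurable[OF elim]] show ?case unfolding y_def .
  qed
  ultimately show ?thesis by (subst (asm) tendsto_cong)
qed

section \<open>The event of a zero initial value and the covering by half-spaces\<close>

context linear_sde
begin

text \<open>The indicator of \<open>\<xi> = 0\<close> is known at time 0, so multiplying by it gives
  a solution over the same filtration, and the initial value of this solution is identically
  zero.\<close>

lemma second_moment_zero_initial:
  assumes t: "0 \<le> t"
  shows "(\<integral>\<^sup>+ \<omega>. indicator {0} (\<xi> \<omega>) * ennreal ((norm (x t \<omega>))\<^sup>2) \<partial>M) = 0"
proof -
  let ?\<theta> = "\<lambda>\<omega>. indicator {0} (\<xi> \<omega>) :: real"
  have \<xi>F: "\<xi> \<in> borel_measurable (F s)" if "0 \<le> s" for s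
    using measurable_F_mono[OF _ that initial_adapted] by simp
  have \<theta>F: "?\<theta> \<in> borel_measurable (F s)" if "0 \<le> s" for s
    using \<xi>F[OF that] by measurable
  \<comment> \<open>Transport along the identity: neither space nor filtration changes, only the
    factor is new.\<close>
  interpret T: solution_transfer M F W M F "\<lambda>\<omega>. \<omega>" ?\<theta>
  proof
    fix s :: real and S assume s: "0 \<le> s" and S: "S \<in> sets (F s)"
    have "?\<theta> -` (- {0}) \<inter> space (F s) \<in> sets (F s)" by (rule measurable_sets[OF \<theta>F[OF s]]) simp
    then have "S \<inter> (?\<theta> -` (- {0}) \<inter> space M) \<in> sets (F s)" using S by (simp add: space_F[OF s] sets.Int)
    moreover have "S \<inter> (?\<theta> -` (- {0}) \<inter> space M) = (\<lambda>\<omega>. \<omega>) -` S \<inter> {\<omega> \<in> space M. ?\<theta> \<omega> \<noteq> 0}" by auto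
    ultimately show "(\<lambda>\<omega>. \<omega>) -` S \<inter> {\<omega> \<in> space M. ?\<theta> \<omega> \<noteq> 0} \<in> sets (F s)" by simp
  qed (use \<theta>F space_F sets_F in \<open>auto simp: distr_id indicator_def\<close>)
  have zero: "?\<theta> \<omega> *\<^sub>R \<xi> \<omega> = 0" for \<omega> by (simp add: indicator_def)
  interpret Z: linear_sde M F W "\<lambda>\<omega>. ?\<theta> \<omega> *\<^sub>R \<xi> \<omega>" A C "\<lambda>t \<omega>. ?\<theta> \<omega> *\<^sub>R x t \<omega>"
    by unfold_locales (use T.transfer_ito_solution[OF solution] in \<open>simp_all add: zero second_moment_def\<close>)
  have "second_moment M (\<lambda>\<omega>. ?\<theta> \<omega> *\<^sub>R x t \<omega>) = 0"
    by (rule Z.zero_initial_imp_zero[OF _ t]) (simp add: zero)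
  moreover have "second_moment M (\<lambda>\<omega>. ?\<theta> \<omega> *\<^sub>R x t \<omega>) = (\<integral>\<^sup>+ \<omega>. indicator {0} (\<xi> \<omega>) * ennreal ((norm (x t \<omega>))\<^sup>2) \<partial>M)"
    unfolding second_moment_def by (intro nn_integral_cong) (auto simp: indicator_def)
  ultimately show ?thesis by simp
qed

text \<open>The half-spaces of the positive and negative coordinate axes are enough: a nonzero
  initial value has a nonzero coordinate and so lies in one of them.\<close>

lemma decay_from_halfspaces:
  assumes half: "\<And>h. ((\<lambda>t. \<integral>\<^sup>+ \<omega>. indicator {v. 0 < inner h v} (\<xi> \<omega>) * ennreal ((norm (x t \<omega>))\<^sup>2) \<partial>M) \<longlongrightarrow> 0) at_top"
  shows "((\<lambda>t. second_moment M (x t)) \<longlongrightarrow> 0) at_top"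
proof -
  let ?g = "\<lambda>h t. \<integral>\<^sup>+ \<omega>. indicator {v. 0 < inner h v} (\<xi> \<omega>) * ennreal ((norm (x t \<omega>))\<^sup>2) \<partial>M"
  let ?e = "\<lambda>k :: 'n. axis k (1 :: real)"
  have bound: "second_moment M (x t) \<le> (\<Sum>k\<in>UNIV. ?g (?e k) t + ?g (- ?e k) t)" if t: "0 \<le> t" for t
  proof -
    note [measurable] = x_measurable[OF t]
    let ?i = "\<lambda>h \<omega>. indicator {v. 0 < inner h v} (\<xi> \<omega>) * ennreal ((norm (x t \<omega>))\<^sup>2)"
    have [measurable]: "?i h \<in> borel_measurable M" for h by measurable
    have "second_moment M (x t) \<le> (\<integral>\<^sup>+ \<omega>. (\<Sum>k\<in>UNIV. ?i (?e k) \<omega> + ?i (- ?e k) \<omega>) +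
        indicator {0} (\<xi> \<omega>) * ennreal ((norm (x t \<omega>))\<^sup>2) \<partial>M)"
      unfolding second_moment_def
    proof (rule nn_integral_mono)
      fix \<omega>
      show "ennreal ((norm (x t \<omega>))\<^sup>2) \<le> (\<Sum>k\<in>UNIV. ?i (?e k) \<omega> + ?i (- ?e k) \<omega>) +
        indicator {0} (\<xi> \<omega>) * ennreal ((norm (x t \<omega>))\<^sup>2)"
      proof (cases "\<xi> \<omega> = 0")
        case True
        then show ?thesis by (simp add: add_increasing)
      next
        case False
        then obtain k where "\<xi> \<omega> $ k \<noteq> 0" by (auto simp: vec_eq_iff)
        \<comment> \<open>Exactly one of the two opposite half-spaces contains the initial
          value.\<close>
        then have "ennreal ((norm (x t \<omega>))\<^sup>2) = ?i (?e k) \<omega> + ?i (- ?e k) \<omega>"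
          by (auto simp: inner_axis' indicator_def)
        also have "\<dots> \<le> (\<Sum>k\<in>UNIV. ?i (?e k) \<omega> + ?i (- ?e k) \<omega>)" by (rule member_le_sum) auto
        also have "\<dots> \<le> (\<Sum>k\<in>UNIV. ?i (?e k) \<omega> + ?i (- ?e k) \<omega>) + indicator {0} (\<xi> \<omega>) * ennreal ((norm (x t \<omega>))\<^sup>2)" by simp
        finally show ?thesis .
      qed
    qed
    also have "\<dots> = (\<Sum>k\<in>UNIV. ?g (?e k) t + ?g (- ?e k) t) + (\<integral>\<^sup>+ \<omega>. indicator {0} (\<xi> \<omega>) * ennreal ((norm (x t \<omega>))\<^sup>2) \<partial>M)"
      by (subst nn_integral_add, measurable, subst nn_integral_sum, measurable)
         (intro arg_cong2[where f = "(+)"] sum.cong refl nn_integral_add; measurable)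
    finally show ?thesis by (simp add: second_moment_zero_initial[OF t])
  qed
  have "((\<lambda>t. \<Sum>k\<in>UNIV. ?g (?e k) t + ?g (- ?e k) t) \<longlongrightarrow> (\<Sum>k\<in>(UNIV::'n set). 0 + 0)) at_top"
    by (intro tendsto_sum tendsto_add half)
  then have lim: "((\<lambda>t. \<Sum>k\<in>UNIV. ?g (?e k) t + ?g (- ?e k) t) \<longlongrightarrow> 0) at_top" by simp
  show ?thesis
  proof (rule tendsto_sandwich[OF _ _ tendsto_const lim])
    show "\<forall>\<^sub>F t in at_top. second_moment M (x t) \<le> (\<Sum>k\<in>UNIV. ?g (?e k) t + ?g (- ?e k) t)"
      using eventually_ge_at_top[of 0] by eventually_elim (rule bound)
  qed simp
qed

end

text \<open>Stability is tested solution by solution: each given solution serves as the template of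
  an agent system, once for every half-space.\<close>

lemma consensus_imp_ms_stable:
  fixes B D :: "real ^ 'm ^ 'n"
  assumes N: "N \<ge> 2" and consensus: "closed_loop_reaches_consensus TYPE('w) B D R P N xbar"
  shows "ms_stable TYPE('w) (- (B ** fb_gain B D R P)) (- (D ** fb_gain B D R P))"
  unfolding ms_stable_def
proof (intro allI impI, elim conjE)
  fix M :: "'w measure" and W \<xi> x
  assume W: "standard_brownian_motion M W" and \<xi>: "second_moment M \<xi> < \<infinity>"
    and ind: "independent_rv M borel \<xi> (PiM {0..} (\<lambda>_. borel)) (\<lambda>\<omega>. \<lambda>t\<in>{0..}. W t \<omega>)"
    and sol: "strong_solution M W \<xi> (\<lambda>y. - (B ** fb_gain B D R P) *v y) (\<lambda>y. - (D ** fb_gain B D R P) *v y) x"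
  interpret linear_sde M "augmented_filtration M W \<xi>" W \<xi> "- (B ** fb_gain B D R P)" "- (D ** fb_gain B D R P)" x
    by (rule linear_sde_strong_solution[OF W \<xi> ind sol])
  have "((\<lambda>t. second_moment M (x t)) \<longlongrightarrow> 0) at_top"
    by (rule decay_from_halfspaces, rule consensus_imp_halfspace_decay[OF N consensus W ind \<xi> sol])
  then show "(\<integral>\<^sup>+ \<omega>. (\<integral>\<^sup>+ t\<in>{0..}. ennreal ((norm (x t \<omega>))\<^sup>2) \<partial>lborel) \<partial>M) < \<infinity>"
    unfolding mean_square_decay_iff_integrable .
qed

theorem theorem4p14:
  fixes B D :: "real ^ 'm ^ 'n" and R :: "real ^ 'm ^ 'm" and P :: "real ^ 'n ^ 'n"
    and \<rho> :: real and N :: nat and xbar :: "real ^ 'n"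
  assumes "N \<ge> 2"
    and "\<rho> \<ge> 0"
    and "transpose R = R"
    and "stabilizing_solution \<rho> B D R P"
    and "\<exists>(M :: 'w measure) W x0. multi_agent_data N xbar M W x0"
  shows "(closed_loop_reaches_consensus TYPE('w) B D R P N xbar \<longleftrightarrow>
            ms_stable TYPE('w) (- (B ** fb_gain B D R P)) (- (D ** fb_gain B D R P)))
       \<and> (positive_definite R \<and> \<rho> = 0 \<longrightarrow>
            closed_loop_reaches_consensus TYPE('w) B D R P N xbar)"
  using consensus_imp_ms_stable[OF assms(1)] ms_stable_imp_consensus riccati_consensus assms(4) by blast

end
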